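(* Let $d\ge 1$ and let $X$ be a random vector in $\mathbb{R}^d$ with density $f$ with respect to Lebesgue measure. Let $X_1,X_2,\ldots$ be i.i.d. random vectors with the same law as $X$. Assume that for some positive numbers $\varepsilon_0,\varepsilon_1,\varepsilon_2,R_1,R_2$ one has $K_{f,\alpha}(\varepsilon_0)<\infty$ for $\alpha=1,2,3,4$, $Q_f(\varepsilon_1,R_1)<\infty$ and $T_f(\varepsilon_2,R_2)<\infty$. Then the nearest-neighbor varentropy estimator $V_N$ built from $X_1,\ldots,X_N$ is $L^2$-consistent, i.e. $$\mathsf{E}\big(V_N-V\big)^2\to 0\quad\text{as } N\to\infty .$$
   Context: Notation. $\rho(x,y)=\|x-y\|$ is the Euclidean distance on $\mathbb{R}^d$, $B(x,r)=\{y\in\mathbb{R}^d:\rho(x,y)<r\}$, $\log$ is the natural logarithm and $\log^{\alpha} t=(\log t)^{\alpha}$. $V_d=\pi^{d/2}/\Gamma(d/2+1)$ is the volume of the unit ball in $\mathbb{R}^d$, and $\gamma=-\int_0^\infty e^{-t}\log t\,dt$ is the Euler–Mascheroni constant. $\mathcal{S}(f)=\{x\in\mathbb{R}^d:f(x)>0\}$. Varentropy: $V=\int_{\mathcal{S}(f)} f(x)[\log f(x)]^2dx-\Big[\int_{\mathcal{S}(f)} f(x)\log f(x)\,dx\Big]^2$, that is, the variance of $-\log f(X)$. Estimator: for $N\ge2$ and $i=1,\ldots,N$ let $\rho_i=\min\{\rho(X_i,X_j): j\in\{1,\ldots,N\}\setminus\{i\}\}$ and $\zeta_i(N)=\log[\rho_i^{d}\,V_d\,e^{\gamma}(N-1)]$.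 Put $H_N=\frac1N\sum_{i=1}^N\zeta_i(N)$, $S_N^2=\frac1N\sum_{i=1}^N\big[\zeta_i^2(N)-\frac{\pi^2}{6}\big]$, and $V_N=S_N^2-H_N^2$. Functionals of $f$: let $G:[0,\infty)\to[0,\infty)$ be $G(t)=0$ for $0\le t<1$ and $G(t)=t\log t$ for $t\ge1$. Let $I_f(x,r)=\frac{1}{r^dV_d}\int_{B(x,r)}f(y)\,dy$, $M_f(x,R)=\sup_{r\in(0,R]}I_f(x,r)$, $m_f(x,R)=\inf_{r\in(0,R]}I_f(x,r)$. For positive $\varepsilon_0,\varepsilon_1,\varepsilon_2,R_1,R_2$ define, with values in $[0,\infty]$, $$K_{f,\alpha}(\varepsilon_0)=\int_{\mathbb{R}^d}\Big(\int_{\mathbb{R}^d\setminus\{x\}}G(|\log^{\alpha}\rho(x,y)|)f(y)\,dy\Big)^{1+\varepsilon_0}f(x)\,dx,$$ $$Q_f(\varepsilon_1,R_1)=\int_{\mathbb{R}^d}M_f(x,R_1)^{\varepsilon_1}f(x)\,dx,\qquad T_f(\varepsilon_2,R_2)=\int_{\mathbb{R}^d}m_f(x,R_2)^{-\varepsilon_2}f(x)\,dx .$$ *)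

theory Defs
  imports "HOL-Probability.Probability"
begin

definition support_set :: "(real^'d \<Rightarrow> real) \<Rightarrow> (real^'d) set" where
  "support_set f = {x. f x > 0}"

definition varentropy :: "(real^'d \<Rightarrow> real) \<Rightarrow> real" where
  "varentropy f =
     (LINT x:support_set f|lborel. f x * (ln (f x))\<^sup>2)
       - (LINT x:support_set f|lborel. f x * ln (f x))\<^sup>2"

text \<open>
  The estimator is defined for a deterministic sequence of points \<open>x 1, x 2, \<dots>\<close>; index \<open>0\<close> is
  not used. The definitions are meaningful for \<open>N \<ge> 2\<close>, since the set under \<open>Min\<close> has to be
  nonempty.
\<close>

definition nn_dist :: "nat \<Rightarrow> (nat \<Rightarrow> real^'d) \<Rightarrow> nat \<Rightarrow> real" where
  "nn_dist N x i = Min ((\<lambda>j. dist (x i) (x j)) ` ({1..N} - {i}))"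

definition zeta_stat :: "nat \<Rightarrow> (nat \<Rightarrow> real^'d) \<Rightarrow> nat \<Rightarrow> real" where
  "zeta_stat N x i =
     ln (nn_dist N x i ^ CARD('d) * unit_ball_vol (real CARD('d)) * exp euler_mascheroni
           * (real N - 1))"

definition H_est :: "nat \<Rightarrow> (nat \<Rightarrow> real^'d) \<Rightarrow> real" where
  "H_est N x = (1 / real N) * (\<Sum>i=1..N. zeta_stat N x i)"

definition S2_est :: "nat \<Rightarrow> (nat \<Rightarrow> real^'d) \<Rightarrow> real" where
  "S2_est N x = (1 / real N) * (\<Sum>i=1..N. (zeta_stat N x i)\<^sup>2 - pi\<^sup>2 / 6)"

definition V_est :: "nat \<Rightarrow> (nat \<Rightarrow> real^'d) \<Rightarrow> real" where
  "V_est N x = S2_est N x - (H_est N x)\<^sup>2"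

definition G_fun :: "real \<Rightarrow> real" where
  "G_fun t = (if t < 1 then 0 else t * ln t)"

text \<open>
  Real powers on \<open>[0, \<infinity>]\<close>, with \<open>0\<^sup>p = \<infinity>\<close> and \<open>\<infinity>\<^sup>p = 0\<close> for \<open>p < 0\<close> (in contrast to
  \<open>0 powr p = 0\<close> on the reals).
\<close>

definition ennreal_powr :: "ennreal \<Rightarrow> real \<Rightarrow> ennreal" where
  "ennreal_powr a p =
     (if p = 0 then 1
      else if a = 0 then (if p > 0 then 0 else \<infinity>)
      else if a = \<infinity> then (if p > 0 then \<infinity> else 0)
      else ennreal (enn2real a powr p))"

definition I_fun :: "(real^'d \<Rightarrow> real) \<Rightarrow> real^'d \<Rightarrow> real \<Rightarrow> ennreal" where
  "I_fun f x r =
     (\<integral>\<^sup>+ y\<in>ball x r. ennreal (f y) \<partial>lborel)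
       / ennreal (r ^ CARD('d) * unit_ball_vol (real CARD('d)))"

definition M_fun :: "(real^'d \<Rightarrow> real) \<Rightarrow> real^'d \<Rightarrow> real \<Rightarrow> ennreal" where
  "M_fun f x R = (SUP r\<in>{0<..R}. I_fun f x r)"

definition m_fun :: "(real^'d \<Rightarrow> real) \<Rightarrow> real^'d \<Rightarrow> real \<Rightarrow> ennreal" where
  "m_fun f x R = (INF r\<in>{0<..R}. I_fun f x r)"

definition K_fun :: "(real^'d \<Rightarrow> real) \<Rightarrow> nat \<Rightarrow> real \<Rightarrow> ennreal" where
  "K_fun f \<alpha> \<epsilon> =
     (\<integral>\<^sup>+ x. ennreal_powr
              (\<integral>\<^sup>+ y\<in>UNIV - {x}. ennreal (G_fun \<bar>(ln (dist x y)) ^ \<alpha>\<bar>) * ennreal (f y) \<partial>lborel)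
              (1 + \<epsilon>)
            * ennreal (f x) \<partial>lborel)"

definition Q_fun :: "(real^'d \<Rightarrow> real) \<Rightarrow> real \<Rightarrow> real \<Rightarrow> ennreal" where
  "Q_fun f \<epsilon> R = (\<integral>\<^sup>+ x. ennreal_powr (M_fun f x R) \<epsilon> * ennreal (f x) \<partial>lborel)"

definition T_fun :: "(real^'d \<Rightarrow> real) \<Rightarrow> real \<Rightarrow> real \<Rightarrow> ennreal" where
  "T_fun f \<epsilon> R = (\<integral>\<^sup>+ x. ennreal_powr (m_fun f x R) (- \<epsilon>) * ennreal (f x) \<partial>lborel)"

end

theory Submission
  imports Defs "HOL-Real_Asymp.Real_Asymp"
begin

text \<open>
  Given \<open>X\<^sub>i = x\<close>, the event \<open>\<zeta>\<^sub>i > u\<close> says that a ball around \<open>x\<close> of volume \<open>exp (u - \<gamma>) / (N - 1)\<close> contains none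
  of the other points, so by Lebesgue differentiation its probability tends to \<open>exp (- f x * exp (u - \<gamma>))\<close>.
  This is the tail of \<open>ln T + \<gamma> - ln (f X)\<close> with \<open>T\<close> standard exponential and independent of \<open>X\<close>, a variable
  with variance \<open>\<pi>\<^sup>2 / 6 + V\<close>. Small balls around two different points are disjoint, hence two events
  \<open>\<zeta>\<^sub>i > u\<close>, \<open>\<zeta>\<^sub>j > u\<close> are asymptotically independent and the empirical tails converge in \<open>L\<^sup>1\<close>; so do the
  empirical means of the truncated \<open>\<zeta>\<^sub>i\<close> and of their squares. The truncation is removed by uniform
  integrability of \<open>\<zeta>\<^sub>i\<^sup>4\<close>: the lower tail of \<open>\<zeta>\<^sub>i\<close> is exponentially small by the bound on \<open>Q\<close>, the upper tail
  on \<open>\<rho>\<^sub>i \<le> R2\<close> by the bound on \<open>T\<close>, and the contribution of \<open>\<rho>\<^sub>i > R2\<close> vanishes because of the logarithmic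
  moment bound \<open>K\<close>.
\<close>

section \<open>Empirical variances of triangular arrays\<close>

text \<open>The obstacle is dependence: each \<open>\<zeta>\<close> sees all other points, so no law
  of large numbers for independent summands applies. Second moments of empirical tails involve only
  one-point and two-point probabilities, for which exact integral formulas hold; hence the detour
  through tails. Fourth powers appear because the estimator is quadratic in the
  \<open>\<zeta>\<close> and its error is squared once more. \<open>Q_fun\<close> and
  \<open>T_fun\<close> speak only about radii up to \<open>R1\<close> and \<open>R2\<close>; they
  enter through inequalities between \<open>(1 - p) ^ n\<close> and powers of \<open>n * p\<close>,
  with \<open>p\<close> the mass of a ball. For a point without neighbour within \<open>R2\<close>,
  \<open>\<zeta>\<close> contains \<open>ln (N - 1)\<close>, unbounded in \<open>N\<close>; its
  fourth power is beaten by a negative power of \<open>N\<close> that again comes from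
  \<open>T_fun\<close>. The centring \<open>\<gamma>\<close> and the correction
  \<open>pi\<^sup>2 / 6\<close> are minus the mean and the variance of the logarithm of a standard
  exponential variable.\<close>

definition clamp_at :: "real \<Rightarrow> real \<Rightarrow> real" where
  "clamp_at K z = max (- K) (min K z)"

lemma clamp_at_measurable [measurable]: "clamp_at K \<in> borel_measurable borel"
  unfolding clamp_at_def by measurable

lemma clamp_at_bound: "K \<ge> 0 \<Longrightarrow> \<bar>clamp_at K z\<bar> \<le> K"
  by (auto simp: clamp_at_def)

lemma clamp_at_abs_le: "K \<ge> 0 \<Longrightarrow> \<bar>clamp_at K z\<bar> \<le> \<bar>z\<bar>"
  by (auto simp: clamp_at_def)

text \<open>The indicators keep exactly the increments of \<open>g\<close> that start at grid points
  below \<open>z\<close>, so the sum telescopes to \<open>g\<close> at the first grid point not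
  below \<open>z\<close>, or to \<open>g (u m)\<close> if there is none. \<open>max z (u 0)\<close>
  covers \<open>z\<close> left of the grid, where the sum is empty.\<close>

lemma step_sum_cases:
  fixes g u :: "_ \<Rightarrow> real" and h :: real
  assumes u: "\<And>k. u (Suc k) = u k + h" and h: "h > 0"
  shows "(u m < z \<longrightarrow> (\<Sum>k<m. (g (u (Suc k)) - g (u k)) * of_bool (z > u k)) = g (u m) - g (u 0))
    \<and> (z \<le> u m \<longrightarrow> (\<exists>j\<le>m. (\<Sum>k<m. (g (u (Suc k)) - g (u k)) * of_bool (z > u k)) = g (u j) - g (u 0)
         \<and> \<bar>max z (u 0) - u j\<bar> \<le> h))"
proof (induction m)
  case 0
  then show ?case using h by auto
next
  case (Suc m)
  have um: "u (Suc m) = u m + h" by (rule u)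
  consider "u (Suc m) < z" | "u m < z" "z \<le> u (Suc m)" | "z \<le> u m" by linarith
  then show ?case
  proof cases
    case 1
    then show ?thesis using Suc um h by auto
  next
    case 2
    have "u 0 \<le> u m" using lift_Suc_mono_le[of u 0 m] u h by auto
    then have "\<bar>max z (u 0) - u (Suc m)\<bar> \<le> h" using 2 um by auto
    then show ?thesis using 2 Suc by (auto intro!: exI[of _ "Suc m"])
  next
    case 3
    then obtain j where "j \<le> m" "(\<Sum>k<m. (g (u (Suc k)) - g (u k)) * of_bool (z > u k)) = g (u j) - g (u 0)"
      "\<bar>max z (u 0) - u j\<bar> \<le> h" using Suc by auto
    then show ?thesis using 3 um h by (auto intro!: exI[of _ j])
  qed
qed

text \<open>Reduces averages of \<open>g\<close> over clamped values to finitely many empirical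
  tails, with an error uniform in \<open>z\<close>. Clamping is what makes a finite grid on
  \<open>[-K, K]\<close> enough.\<close>

lemma clamp_step_approximation:
  fixes g :: "real \<Rightarrow> real"
  assumes K: "K > 0" and e: "e > 0"
    and lip: "\<And>x y. \<bar>x\<bar> \<le> K \<Longrightarrow> \<bar>y\<bar> \<le> K \<Longrightarrow> \<bar>g x - g y\<bar> \<le> B * \<bar>x - y\<bar>" and B: "B > 0"
  obtains m :: nat and w u :: "nat \<Rightarrow> real" and c where
    "\<And>z. \<bar>g (clamp_at K z) - (c + (\<Sum>k<m. w k * of_bool (z > u k)))\<bar> \<le> e"
proof -
  \<comment> \<open>With this \<open>m\<close>, the mesh \<open>2 * K / m\<close> times the
    Lipschitz constant \<open>B\<close> is below \<open>e\<close>.\<close>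
  obtain m :: nat where m: "m > 2 * K * B / e" using reals_Archimedean2 by blast
  have "0 < 2 * K * B / e" using K B e by simp
  then have "m > 0" using m by (cases m) auto
  define h where "h = 2 * K / m"
  have h: "h > 0" and hB: "h * B < e" using m \<open>m > 0\<close> K e by (auto simp: h_def field_simps)
  define u where "u = (\<lambda>k::nat. - K + k * h)"
  have us: "u (Suc k) = u k + h" for k by (simp add: u_def algebra_simps)
  have u0: "u 0 = - K" and um: "u m = K" using \<open>m > 0\<close> by (auto simp: u_def h_def)
  have ub: "\<bar>u j\<bar> \<le> K" if "j \<le> m" for j
  proof -
    have "j * h \<le> m * h" using that h by (intro mult_right_mono) auto
    moreover have "0 \<le> j * h" using h by auto
    ultimately show ?thesis using um unfolding u_def by linarith
  qed
  show ?thesis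
  proof (rule that)
    fix z
    let ?S = "\<Sum>k<m. (g (u (Suc k)) - g (u k)) * of_bool (z > u k)"
    note sp = step_sum_cases[where u = u and g = g and m = m and z = z, OF us h]
    show "\<bar>g (clamp_at K z) - (g (- K) + (\<Sum>k<m. (g (u (Suc k)) - g (u k)) * of_bool (z > u k)))\<bar> \<le> e"
    proof (cases "u m < z")
      case True
      then have "clamp_at K z = K" using um K by (auto simp: clamp_at_def)
      then show ?thesis using sp True e by (simp add: u0 um)
    next
      case False
      then obtain j where j: "j \<le> m" "?S = g (u j) - g (u 0)" "\<bar>max z (u 0) - u j\<bar> \<le> h"
        using sp by auto
      have cl: "clamp_at K z = max z (u 0)" using False um u0 K by (auto simp: clamp_at_def)
      have "\<bar>g (clamp_at K z) - g (u j)\<bar> \<le> B * \<bar>clamp_at K z - u j\<bar>"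
        using K by (intro lip clamp_at_bound ub j) auto
      also have "\<dots> \<le> B * h" using j(3) B by (intro mult_left_mono) (auto simp: cl)
      finally show ?thesis using j(2) hB by (simp add: u0 mult.commute)
    qed
  qed
qed

section \<open>Convergence of empirical tails and of means of clamped values\<close>

context prob_space
begin

text \<open>Second-moment method: after expanding the square of the centred mean, the
  \<open>N\<close> diagonal pairs contribute at most \<open>1 / N\<close>, while every other pair
  has expectation \<open>b N - 2 * F * a N + F\<^sup>2\<close>, which tends to \<open>0\<close>.
  Exchangeability enters only as the independence of \<open>a\<close> and \<open>b\<close> from the
  indices.\<close>

lemma empirical_tail_tendsto:
  fixes \<zeta> :: "nat \<Rightarrow> nat \<Rightarrow> 'a \<Rightarrow> real"
  assumes rv: "\<And>N i. N \<ge> 2 \<Longrightarrow> i \<in> {1..N} \<Longrightarrow> \<zeta> N i \<in> borel_measurable M"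
    and a: "\<And>N i. N \<ge> 2 \<Longrightarrow> i \<in> {1..N} \<Longrightarrow> \<P>(\<omega> in M. \<zeta> N i \<omega> > u) = a N"
    and b: "\<And>N i j. N \<ge> 2 \<Longrightarrow> i \<in> {1..N} \<Longrightarrow> j \<in> {1..N} \<Longrightarrow> i \<noteq> j \<Longrightarrow>
              \<P>(\<omega> in M. \<zeta> N i \<omega> > u \<and> \<zeta> N j \<omega> > u) = b N"
    and a_lim: "a \<longlonglongrightarrow> F" and b_lim: "b \<longlonglongrightarrow> F\<^sup>2" and F: "0 \<le> F" "F \<le> 1"
  shows "(\<lambda>N. expectation (\<lambda>\<omega>. \<bar>(\<Sum>i=1..N. of_bool (\<zeta> N i \<omega> > u)) / N - F\<bar>)) \<longlonglongrightarrow> 0"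
proof -
  define c where "c = (\<lambda>N. b N - 2 * F * a N + F\<^sup>2)"
  have "c \<longlonglongrightarrow> F\<^sup>2 - 2 * F * F + F\<^sup>2" unfolding c_def by (intro tendsto_intros a_lim b_lim)
  then have c: "c \<longlonglongrightarrow> 0" by (simp add: power2_eq_square)
  have bound: "(expectation (\<lambda>\<omega>. \<bar>(\<Sum>i=1..N. of_bool (\<zeta> N i \<omega> > u)) / N - F\<bar>)) \<le> sqrt (1 / N + \<bar>c N\<bar>)"
    if N: "N \<ge> 2" for N
  proof -
    define Y where "Y = (\<lambda>i \<omega>. of_bool (\<zeta> N i \<omega> > u) - F)"
    have [measurable]: "\<zeta> N i \<in> borel_measurable M" if "i \<in> {1..N}" for i using rv N that by auto
    have Ym [measurable]: "Y i \<in> borel_measurable M" if "i \<in> {1..N}" for i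
      using that unfolding Y_def of_bool_def by measurable
    have Yb: "\<bar>Y i \<omega>\<bar> \<le> 1" for i \<omega> using F by (auto simp: Y_def)
    have YYb: "\<bar>Y i \<omega> * Y j \<omega>\<bar> \<le> 1" for i j \<omega>
      unfolding abs_mult using Yb[of i \<omega>] Yb[of j \<omega>] mult_mono[of "\<bar>Y i \<omega>\<bar>" 1 "\<bar>Y j \<omega>\<bar>" 1] by auto
    have YYi: "integrable M (\<lambda>\<omega>. Y i \<omega> * Y j \<omega>)" if "i \<in> {1..N}" "j \<in> {1..N}" for i j
      using that YYb by (intro integrable_const_bound[where B = 1]) auto
    \<comment> \<open>Allowing \<open>\<bar>c N\<bar>\<close> on the diagonal as well lets the
      double sum be evaluated in closed form.\<close>
    have YY: "expectation (\<lambda>\<omega>. Y i \<omega> * Y j \<omega>) \<le> (if i = j then 1 else 0) + \<bar>c N\<bar>"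
      if ij: "i \<in> {1..N}" "j \<in> {1..N}" for i j
    proof (cases "i = j")
      case True
      have "expectation (\<lambda>\<omega>. Y i \<omega> * Y j \<omega>) \<le> expectation (\<lambda>_. 1)"
        using ij order_trans[OF abs_ge_self YYb] by (intro integral_mono YYi) auto
      then show ?thesis using True by (simp add: prob_space)
    next
      case False
      have [measurable]: "{\<omega> \<in> space M. \<zeta> N i \<omega> > u} \<in> events" if "i \<in> {1..N}" for i using that by measurable
      have "expectation (\<lambda>\<omega>. Y i \<omega> * Y j \<omega>) = expectation (\<lambda>\<omega>.
          indicator {\<omega> \<in> space M. \<zeta> N i \<omega> > u \<and> \<zeta> N j \<omega> > u} \<omega> - F * indicator {\<omega> \<in> space M. \<zeta> N i \<omega> > u} \<omega>
          - F * indicator {\<omega> \<in> space M. \<zeta> N j \<omega> > u} \<omega> + F\<^sup>2)"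
        by (intro Bochner_Integration.integral_cong)
          (auto simp: Y_def power2_eq_square algebra_simps split: split_indicator)
      also have "\<dots> = b N - F * a N - F * a N + F\<^sup>2"
        using a[OF N ij(1)] a[OF N ij(2)] b[OF N ij False] ij
        by (simp add: prob_space integrable_real_indicator emeasure_eq_measure)
      also have "\<dots> = c N" by (simp add: c_def)
      finally show ?thesis using False by simp
    qed
    have S: "(\<Sum>i=1..N. of_bool (\<zeta> N i \<omega> > u)) / N - F = (\<Sum>i=1..N. Y i \<omega>) / N" for \<omega>
      using N by (simp add: Y_def sum_subtractf field_simps)
    have alg: "(n + n * (n * x)) / n\<^sup>2 = 1 / n + x" if "n > 0" for n x :: real
      using that by (simp add: add_divide_distrib power2_eq_square)
    define Z where "Z = (\<lambda>\<omega>. (\<Sum>i=1..N. Y i \<omega>) / N)"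
    have Z2: "(Z \<omega>)\<^sup>2 = (\<Sum>i=1..N. \<Sum>j=1..N. Y i \<omega> * Y j \<omega>) / N\<^sup>2" for \<omega>
      by (simp add: Z_def power2_eq_square sum_product)
    have Zm: "Z \<in> borel_measurable M" unfolding Z_def by measurable
    have Z2i: "integrable M (\<lambda>\<omega>. (Z \<omega>)\<^sup>2)" unfolding Z2
      by (intro integrable_divide_zero Bochner_Integration.integrable_sum impI YYi)
    have Zi: "integrable M Z" using Zm Z2i by (rule square_integrable_imp_integrable)
    have "(expectation (\<lambda>\<omega>. \<bar>Z \<omega>\<bar>))\<^sup>2 \<le> expectation (\<lambda>\<omega>. \<bar>Z \<omega>\<bar>\<^sup>2)"
      using variance_positive[of "\<lambda>\<omega>. \<bar>Z \<omega>\<bar>"] variance_eq[of "\<lambda>\<omega>. \<bar>Z \<omega>\<bar>"] Zi Z2i by auto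
    also have "\<dots> = expectation (\<lambda>\<omega>. (\<Sum>i=1..N. \<Sum>j=1..N. Y i \<omega> * Y j \<omega>) / N\<^sup>2)" by (simp add: Z2)
    also have "\<dots> = (\<Sum>i=1..N. \<Sum>j=1..N. expectation (\<lambda>\<omega>. Y i \<omega> * Y j \<omega>)) / N\<^sup>2"
      by (simp only: integral_divide_zero) (simp only: Bochner_Integration.integral_sum Bochner_Integration.integrable_sum YYi cong: sum.cong)
    also have "\<dots> \<le> (\<Sum>i=1..N. \<Sum>j=1..N. (if i = j then 1 else 0) + \<bar>c N\<bar>) / N\<^sup>2"
      by (intro divide_right_mono sum_mono YY) auto
    also have "\<dots> = (N + N * (N * \<bar>c N\<bar>)) / N\<^sup>2"
      by (simp add: sum.distrib distrib_left)
    also have "\<dots> = 1 / N + \<bar>c N\<bar>" using alg[of "real N"] N by simp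
    finally show ?thesis unfolding S Z_def by (rule real_le_rsqrt)
  qed
  have lim: "(\<lambda>N. sqrt (1 / real N + \<bar>c N\<bar>)) \<longlonglongrightarrow> 0"
    using tendsto_real_sqrt[OF tendsto_add[OF lim_1_over_n tendsto_rabs_zero[OF c]]] by simp
  show ?thesis
    by (rule tendsto_sandwich[OF _ _ tendsto_const lim])
      (use bound in \<open>auto intro!: eventually_sequentiallyI[of 2]\<close>)
qed

text \<open>Replacing \<open>g\<close> of the clamped value by a step function costs
  \<open>e / 4\<close> under the empirical measure and another \<open>e / 4\<close> under the limit
  law \<open>(Q, L)\<close>. What remains is a fixed finite combination of empirical tail errors,
  which is small for large \<open>N\<close>.\<close>

lemma empirical_mean_clamp_tendsto:
  notes [simp del] = One_nat_def sum_of_bool_eq sum_mult_of_bool_eq sum_of_bool_mult_eq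
  fixes \<zeta> :: "nat \<Rightarrow> nat \<Rightarrow> 'a \<Rightarrow> real" and Q :: "'q measure" and g :: "real \<Rightarrow> real"
  assumes rv: "\<And>N i. N \<ge> 2 \<Longrightarrow> i \<in> {1..N} \<Longrightarrow> \<zeta> N i \<in> borel_measurable M"
    and Q: "prob_space Q" and L [measurable]: "L \<in> borel_measurable Q"
    and tail: "\<And>u. (\<lambda>N. expectation (\<lambda>\<omega>. \<bar>(\<Sum>i=1..N. of_bool (\<zeta> N i \<omega> > u)) / N - measure Q {q \<in> space Q. L q > u}\<bar>)) \<longlonglongrightarrow> 0"
    and K: "K > 0" and gm [measurable]: "g \<in> borel_measurable borel"
    and lip: "\<And>x y. \<bar>x\<bar> \<le> K \<Longrightarrow> \<bar>y\<bar> \<le> K \<Longrightarrow> \<bar>g x - g y\<bar> \<le> B * \<bar>x - y\<bar>" and B: "B > 0"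
  shows "(\<lambda>N. expectation (\<lambda>\<omega>. \<bar>(\<Sum>i=1..N. g (clamp_at K (\<zeta> N i \<omega>))) / N
           - (\<integral>q. g (clamp_at K (L q)) \<partial>Q)\<bar>)) \<longlonglongrightarrow> 0"
proof -
  interpret Q: prob_space Q by (rule Q)
  let ?l = "\<integral>q. g (clamp_at K (L q)) \<partial>Q"
  let ?F = "\<lambda>u. measure Q {q \<in> space Q. L q > u}"
  have gb: "\<bar>g (clamp_at K z)\<bar> \<le> \<bar>g 0\<bar> + B * K" for z
  proof -
    have "\<bar>g (clamp_at K z) - g 0\<bar> \<le> B * \<bar>clamp_at K z - 0\<bar>"
      using K clamp_at_bound[of K z] by (intro lip) auto
    also have "\<dots> \<le> B * K" using B clamp_at_bound[of K z] K by (intro mult_left_mono) auto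
    finally show ?thesis by linarith
  qed
  show ?thesis
  proof (rule LIMSEQ_I)
    fix e :: real assume "e > 0"
    obtain m :: nat and w u :: "nat \<Rightarrow> real" and c where sa: "\<And>z. \<bar>g (clamp_at K z) - (c + (\<Sum>k<m. w k * of_bool (z > u k)))\<bar> \<le> e / 4"
      by (rule clamp_step_approximation[of K "e/4" g B]) (use K \<open>e > 0\<close> B lip in auto)
    define s where "s = (\<lambda>N. \<Sum>k<m. \<bar>w k\<bar> * expectation (\<lambda>\<omega>. \<bar>(\<Sum>i=1..N. of_bool (\<zeta> N i \<omega> > u k)) / N - ?F (u k)\<bar>))"
    have "s \<longlonglongrightarrow> (\<Sum>k<m. \<bar>w k\<bar> * 0)" unfolding s_def by (intro tendsto_intros tail)
    then have "s \<longlonglongrightarrow> 0" by simp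
    then obtain N0 where N0: "\<And>N. N \<ge> N0 \<Longrightarrow> s N < e / 4"
      using LIMSEQ_D[of s 0 "e/4"] \<open>e > 0\<close> by fastforce
    have lQ: "\<bar>?l - (c + (\<Sum>k<m. w k * ?F (u k)))\<bar> \<le> e / 4"
    proof -
      have [measurable]: "{q \<in> space Q. L q > v} \<in> sets Q" for v by measurable
      have ind: "(\<integral>q. of_bool (L q > v) \<partial>Q) = ?F v" for v
        by (subst Bochner_Integration.integral_cong[where g = "indicator {q \<in> space Q. L q > v}", OF refl])
          (auto split: split_indicator)
      have indi: "integrable Q (\<lambda>q. of_bool (L q > v) :: real)" for v
        by (rule Q.integrable_const_bound[where B = 1]) (auto simp: of_bool_def)
      have gi: "integrable Q (\<lambda>q. g (clamp_at K (L q)))"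
        by (rule Q.integrable_const_bound[where B = "\<bar>g 0\<bar> + B * K"]) (use gb in auto)
      have "?l - (c + (\<Sum>k<m. w k * ?F (u k))) =
         (\<integral>q. g (clamp_at K (L q)) - (c + (\<Sum>k<m. w k * of_bool (L q > u k))) \<partial>Q)"
        using gi indi by (simp add: ind Q.prob_space del: sum_mult_of_bool_eq)
      also have "\<bar>\<dots>\<bar> \<le> (\<integral>q. \<bar>g (clamp_at K (L q)) - (c + (\<Sum>k<m. w k * of_bool (L q > u k)))\<bar> \<partial>Q)"
        by (rule integral_abs_bound)
      also have "\<dots> \<le> (\<integral>q. e / 4 \<partial>Q)"
        using sa gi indi by (intro integral_mono) auto
      finally show ?thesis by (simp add: Q.prob_space)
    qed
    show "\<exists>no. \<forall>N\<ge>no. norm (expectation (\<lambda>\<omega>. \<bar>(\<Sum>i=1..N. g (clamp_at K (\<zeta> N i \<omega>))) / N - ?l\<bar>) - 0) < e"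
    proof (intro exI allI impI)
      fix N assume N: "N \<ge> max N0 2"
      have [measurable]: "\<zeta> N i \<in> borel_measurable M" if "i \<in> {1..N}" for i using rv N that by auto
      have [simp]: "integrable M (\<lambda>\<omega>. \<bar>(\<Sum>i=1..N. of_bool (\<zeta> N i \<omega> > u k)) / N - ?F (u k)\<bar>)" for k
      proof (rule integrable_const_bound[where B = 2], rule AE_I2)
        fix \<omega>
        have "(\<Sum>i=1..N. of_bool (\<zeta> N i \<omega> > u k)) \<le> (\<Sum>i=1..N. 1::real)" by (intro sum_mono) auto
        then have "(\<Sum>i=1..N. of_bool (\<zeta> N i \<omega> > u k)) / real N \<le> 1" using N by (simp add: divide_le_eq)
        moreover have "(\<Sum>i=1..N. of_bool (\<zeta> N i \<omega> > u k)) / real N \<ge> 0" by (intro divide_nonneg_nonneg sum_nonneg) auto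
        moreover have "0 \<le> ?F (u k)" "?F (u k) \<le> 1" by auto
        ultimately show "norm \<bar>(\<Sum>i=1..N. of_bool (\<zeta> N i \<omega> > u k)) / N - ?F (u k)\<bar> \<le> 2"
          unfolding real_norm_def abs_idempotent by linarith
      qed (auto simp: of_bool_def)
      have "\<bar>(\<Sum>i=1..N. g (clamp_at K (\<zeta> N i \<omega>))) / N - ?l\<bar> \<le> e / 2 +
          (\<Sum>k<m. \<bar>w k\<bar> * \<bar>(\<Sum>i=1..N. of_bool (\<zeta> N i \<omega> > u k)) / N - ?F (u k)\<bar>)" (is "?a \<le> _") for \<omega>
      proof -
        let ?p = "\<lambda>k. (\<Sum>i=1..N. of_bool (\<zeta> N i \<omega> > u k)) / real N"
        have "(\<Sum>i=1..N. g (clamp_at K (\<zeta> N i \<omega>))) / N - (c + (\<Sum>k<m. w k * ?p k)) =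
           (\<Sum>i=1..N. g (clamp_at K (\<zeta> N i \<omega>)) - (c + (\<Sum>k<m. w k * of_bool (\<zeta> N i \<omega> > u k)))) / N"
        proof -
          have "(\<Sum>i=1..N. \<Sum>k<m. w k * of_bool (\<zeta> N i \<omega> > u k)) = (\<Sum>k<m. w k * (\<Sum>i=1..N. of_bool (\<zeta> N i \<omega> > u k)))"
            by (subst sum.swap) (simp add: sum_distrib_left)
          then show ?thesis using N
            by (simp only: sum_subtractf sum.distrib) (simp add: diff_divide_distrib add_divide_distrib sum_divide_distrib sum_distrib_left)
        qed
        also have "\<bar>\<dots>\<bar> \<le> (\<Sum>i=1..N. e / 4) / N"
          unfolding abs_divide using sa by (auto intro!: divide_right_mono order_trans[OF sum_abs] sum_mono simp del: sum_constant)
        also have "\<dots> = e / 4" using N by simp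
        finally have 1: "\<bar>(\<Sum>i=1..N. g (clamp_at K (\<zeta> N i \<omega>))) / N - (c + (\<Sum>k<m. w k * ?p k))\<bar> \<le> e / 4" .
        have "\<bar>(\<Sum>k<m. w k * ?p k) - (\<Sum>k<m. w k * ?F (u k))\<bar> \<le> (\<Sum>k<m. \<bar>w k\<bar> * \<bar>?p k - ?F (u k)\<bar>)"
          unfolding sum_subtractf[symmetric] right_diff_distrib[symmetric] abs_mult[symmetric] by (rule sum_abs)
        then show ?thesis using 1 lQ by linarith
      qed
      then have "expectation (\<lambda>\<omega>. \<bar>(\<Sum>i=1..N. g (clamp_at K (\<zeta> N i \<omega>))) / N - ?l\<bar>) \<le> expectation (\<lambda>\<omega>. e / 2 +
          (\<Sum>k<m. \<bar>w k\<bar> * \<bar>(\<Sum>i=1..N. of_bool (\<zeta> N i \<omega> > u k)) / N - ?F (u k)\<bar>))"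
        by (intro integral_mono') (auto intro!: add_nonneg_nonneg sum_nonneg simp: \<open>e > 0\<close> less_imp_le)
      also have "\<dots> = e / 2 + s N" by (simp add: s_def prob_space)
      also have "\<dots> < e" using N0[of N] N \<open>e > 0\<close> by auto
      finally show "norm (expectation (\<lambda>\<omega>. \<bar>(\<Sum>i=1..N. g (clamp_at K (\<zeta> N i \<omega>))) / N - ?l\<bar>) - 0) < e"
        by simp
    qed
  qed
qed

end

section \<open>Truncation error of the empirical variance\<close>

lemma clamp_tail_bounds:
  fixes z :: real
  assumes "K > 0"
  shows "(z\<^sup>2 - (clamp_at K z)\<^sup>2)\<^sup>2 \<le> of_bool (\<bar>z\<bar> > K) * z ^ 4"
    and "(z - clamp_at K z) ^ 4 \<le> of_bool (\<bar>z\<bar> > K) * z ^ 4"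
    and "(z + clamp_at K z) ^ 4 \<le> 16 * z ^ 4"
proof -
  let ?c = "clamp_at K z"
  have c: "\<bar>?c\<bar> \<le> \<bar>z\<bar>" using assms by (intro clamp_at_abs_le) auto
  have eq: "\<bar>z\<bar> \<le> K \<Longrightarrow> ?c = z" by (auto simp: clamp_at_def)
  have c2: "?c\<^sup>2 \<le> z\<^sup>2" using c by (simp add: abs_le_square_iff)
  have "(z\<^sup>2 - ?c\<^sup>2)\<^sup>2 \<le> (z\<^sup>2)\<^sup>2" using c2 by (intro power_mono) auto
  then show "(z\<^sup>2 - ?c\<^sup>2)\<^sup>2 \<le> of_bool (\<bar>z\<bar> > K) * z ^ 4"
    using eq by (cases "\<bar>z\<bar> > K") auto
  have "\<bar>z - ?c\<bar> \<le> \<bar>z\<bar>" using assms by (auto simp: clamp_at_def)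
  then have "\<bar>z - ?c\<bar> ^ 4 \<le> \<bar>z\<bar> ^ 4" by (intro power_mono) auto
  then show "(z - ?c) ^ 4 \<le> of_bool (\<bar>z\<bar> > K) * z ^ 4"
    using eq by (cases "\<bar>z\<bar> > K") auto
  have "\<bar>z + ?c\<bar> ^ 4 \<le> (2 * \<bar>z\<bar>) ^ 4" using c by (intro power_mono) auto
  then show "(z + ?c) ^ 4 \<le> 16 * z ^ 4" by (simp add: power_mult_distrib)
qed

lemma mean_square_le:
  fixes f :: "nat \<Rightarrow> real"
  shows "((\<Sum>i=1..N. f i) / N)\<^sup>2 \<le> (\<Sum>i=1..N. (f i)\<^sup>2) / N"
proof (cases "N = 0")
  case False
  have "(\<Sum>i=1..N. f i)\<^sup>2 \<le> N * (\<Sum>i=1..N. (f i)\<^sup>2)"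
    using sum_squared_le_sum_of_squares[of f "{1..N}"] by (simp add: mult.commute)
  then show ?thesis using False by (simp add: field_simps power2_eq_square)
qed simp

text \<open>
  The difference of the squared means factors into two means; AM-GM with weight \<open>\<eta>\<close> separates the
  factor that is small from the one that is only bounded.
\<close>

lemma variance_truncation_bound:
  fixes z :: "nat \<Rightarrow> real"
  assumes K: "K > 0" and \<eta>: "\<eta> > 0" and N: "N > 0"
  shows "(((\<Sum>i=1..N. (z i)\<^sup>2) / N - ((\<Sum>i=1..N. z i) / N)\<^sup>2)
     - ((\<Sum>i=1..N. (clamp_at K (z i))\<^sup>2) / N - ((\<Sum>i=1..N. clamp_at K (z i)) / N)\<^sup>2))\<^sup>2
     \<le> (2 + 1 / \<eta>) * ((\<Sum>i=1..N. of_bool (\<bar>z i\<bar> > K) * z i ^ 4) / N) + 16 * \<eta> * ((\<Sum>i=1..N. z i ^ 4) / N)"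
proof -
  define A :: "(nat \<Rightarrow> real) \<Rightarrow> real" where "A = (\<lambda>f. (\<Sum>i=1..N. f i) / N)"
  define c where "c = (\<lambda>i. clamp_at K (z i))"
  have A_diff: "A (\<lambda>i. f i - g i) = A f - A g" for f g by (simp add: A_def sum_subtractf diff_divide_distrib)
  have A_add: "A (\<lambda>i. f i + g i) = A f + A g" for f g by (simp add: A_def sum.distrib add_divide_distrib)
  have A_mono: "(\<And>i. f i \<le> g i) \<Longrightarrow> A f \<le> A g" for f g unfolding A_def by (intro divide_right_mono sum_mono) auto
  have A_sq: "(A f)\<^sup>2 \<le> A (\<lambda>i. (f i)\<^sup>2)" for f unfolding A_def by (rule mean_square_le)
  have A_4: "(A f) ^ 4 \<le> A (\<lambda>i. f i ^ 4)" for f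
  proof -
    have "((A f)\<^sup>2)\<^sup>2 \<le> (A (\<lambda>i. (f i)\<^sup>2))\<^sup>2" by (intro power_mono A_sq) auto
    also have "\<dots> \<le> A (\<lambda>i. ((f i)\<^sup>2)\<^sup>2)" by (rule A_sq)
    finally show ?thesis by simp
  qed
  let ?t = "\<lambda>i. of_bool (\<bar>z i\<bar> > K) * z i ^ 4"
  define x y where "x = A (\<lambda>i. (z i)\<^sup>2 - (c i)\<^sup>2)" and "y = (A z)\<^sup>2 - (A c)\<^sup>2"
  have x2: "x\<^sup>2 \<le> A ?t"
    unfolding x_def using clamp_tail_bounds(1)[OF K] by (intro order_trans[OF A_sq] A_mono) (simp add: c_def)
  define p q where "p = A (\<lambda>i. z i - c i)" and "q = A (\<lambda>i. z i + c i)"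
  have y: "y = p * q" by (simp add: y_def p_def q_def A_add A_diff algebra_simps power2_eq_square)
  have p4: "p ^ 4 \<le> A ?t"
    unfolding p_def using clamp_tail_bounds(2)[OF K] by (intro order_trans[OF A_4] A_mono) (simp add: c_def)
  have "q ^ 4 \<le> A (\<lambda>i. 16 * z i ^ 4)"
    unfolding q_def using clamp_tail_bounds(3)[OF K] by (intro order_trans[OF A_4] A_mono) (simp add: c_def)
  then have q4: "q ^ 4 \<le> 16 * A (\<lambda>i. z i ^ 4)" by (simp add: A_def sum_distrib_left)
  have "0 \<le> (p\<^sup>2 - \<eta> * q\<^sup>2)\<^sup>2 / \<eta>" using \<eta> by simp
  also have "\<dots> = p ^ 4 / \<eta> + \<eta> * q ^ 4 - 2 * y\<^sup>2"
    using \<eta> by (simp add: y field_simps power2_eq_square power4_eq_xxxx)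
  also have "\<dots> \<le> A ?t / \<eta> + \<eta> * (16 * A (\<lambda>i. z i ^ 4)) - 2 * y\<^sup>2"
    using \<eta> by (intro diff_mono add_mono divide_right_mono mult_left_mono p4 q4) auto
  finally have y2: "2 * y\<^sup>2 \<le> A ?t / \<eta> + 16 * \<eta> * A (\<lambda>i. z i ^ 4)" by simp
  have "(x - y)\<^sup>2 \<le> 2 * x\<^sup>2 + 2 * y\<^sup>2"
    using zero_le_power2[of "x + y"] by (simp add: power2_eq_square algebra_simps)
  also have "\<dots> \<le> (2 + 1 / \<eta>) * A ?t + 16 * \<eta> * A (\<lambda>i. z i ^ 4)"
    using x2 y2 by (simp add: algebra_simps)
  also have "x - y = (A (\<lambda>i. (z i)\<^sup>2) - (A z)\<^sup>2) - (A (\<lambda>i. (c i)\<^sup>2) - (A c)\<^sup>2)"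
    by (simp add: x_def y_def A_diff)
  finally show ?thesis by (simp add: A_def c_def)
qed

text \<open>Dominated convergence: clamping never increases the absolute value and is eventually the
  identity at each point.\<close>

lemma clamped_variance_tendsto:
  assumes Q: "prob_space Q" and [measurable]: "L \<in> borel_measurable Q" and L2: "integrable Q (\<lambda>q. (L q)\<^sup>2)"
  shows "(\<lambda>k::nat. (\<integral>q. (clamp_at (real k) (L q))\<^sup>2 \<partial>Q) - (\<integral>q. clamp_at (real k) (L q) \<partial>Q)\<^sup>2)
     \<longlonglongrightarrow> (\<integral>q. (L q)\<^sup>2 \<partial>Q) - (\<integral>q. L q \<partial>Q)\<^sup>2"
proof -
  interpret Q: prob_space Q by (rule Q)
  have L1: "integrable Q L" by (rule Q.square_integrable_imp_integrable) (use L2 in auto)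
  have cl: "(\<lambda>k. clamp_at (real k) z) \<longlonglongrightarrow> z" for z
  proof (rule tendsto_eventually)
    obtain k0 :: nat where "\<bar>z\<bar> < k0" using reals_Archimedean2 by blast
    then show "\<forall>\<^sub>F k in sequentially. clamp_at (real k) z = z"
      by (intro eventually_sequentiallyI[of k0]) (auto simp: clamp_at_def)
  qed
  have "(\<lambda>k::nat. (\<integral>q. (clamp_at (real k) (L q))\<^sup>2 \<partial>Q)) \<longlonglongrightarrow> (\<integral>q. (L q)\<^sup>2 \<partial>Q)"
    by (rule integral_dominated_convergence[where w = "\<lambda>q. (L q)\<^sup>2"])
      (auto intro!: L2 tendsto_power cl simp: abs_le_square_iff[symmetric] clamp_at_abs_le)
  moreover have "(\<lambda>k::nat. (\<integral>q. clamp_at (real k) (L q) \<partial>Q)) \<longlonglongrightarrow> (\<integral>q. L q \<partial>Q)"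
    by (rule integral_dominated_convergence[where w = "\<lambda>q. \<bar>L q\<bar>"])
      (auto intro!: L1 cl clamp_at_abs_le)
  ultimately show ?thesis by (intro tendsto_diff tendsto_power)
qed

lemma ennreal_tendsto_0I:
  fixes f :: "nat \<Rightarrow> ennreal"
  assumes "\<And>e::real. e > 0 \<Longrightarrow> \<forall>\<^sub>F n in sequentially. f n \<le> ennreal e"
  shows "f \<longlonglongrightarrow> 0"
proof (rule order_tendstoI)
  fix a :: ennreal assume "0 < a"
  then obtain b where b: "0 < b" "b < a" using dense by blast
  then obtain e where e: "b = ennreal e" "e > 0" by (cases b) (auto simp: top_unique)
  show "\<forall>\<^sub>F n in sequentially. f n < a"
    using assms[OF e(2)] by eventually_elim (use b e in auto)
qed simp

context prob_space
begin

text \<open>The error splits into truncating the \<open>\<zeta>\<close>, the fluctuation of the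
  clamped empirical variance around its limit, and truncating \<open>L\<close>. The first is
  controlled by uniform integrability, the last by the choice of \<open>K\<close>. The middle one is
  bounded for fixed \<open>K\<close>, so its \<open>L\<^sup>1\<close> convergence upgrades to
  \<open>L\<^sup>2\<close>.\<close>

lemma empirical_variance_tendsto:
  notes [simp del] = One_nat_def sum_of_bool_eq sum_mult_of_bool_eq sum_of_bool_mult_eq
  fixes \<zeta> :: "nat \<Rightarrow> nat \<Rightarrow> 'a \<Rightarrow> real" and Q :: "'q measure"
  assumes rv: "\<And>N i. N \<ge> 2 \<Longrightarrow> i \<in> {1..N} \<Longrightarrow> \<zeta> N i \<in> borel_measurable M"
    and Q: "prob_space Q" and L [measurable]: "L \<in> borel_measurable Q"
    and L2: "integrable Q (\<lambda>q. (L q)\<^sup>2)"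
    and tail: "\<And>u. (\<lambda>N. expectation (\<lambda>\<omega>. \<bar>(\<Sum>i=1..N. of_bool (\<zeta> N i \<omega> > u)) / N - measure Q {q \<in> space Q. L q > u}\<bar>)) \<longlonglongrightarrow> 0"
    and ui: "\<And>e. e > 0 \<Longrightarrow> \<exists>K>0. \<exists>N0. \<forall>N\<ge>N0. \<forall>i\<in>{1..N}.
        (\<integral>\<^sup>+\<omega>. ennreal (of_bool (\<bar>\<zeta> N i \<omega>\<bar> > K) * \<zeta> N i \<omega> ^ 4) \<partial>M) \<le> ennreal e"
  shows "(\<lambda>N. \<integral>\<^sup>+\<omega>. ennreal (((\<Sum>i=1..N. (\<zeta> N i \<omega>)\<^sup>2) / N - ((\<Sum>i=1..N. \<zeta> N i \<omega>) / N)\<^sup>2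
      - ((\<integral>q. (L q)\<^sup>2 \<partial>Q) - (\<integral>q. L q \<partial>Q)\<^sup>2))\<^sup>2) \<partial>M) \<longlonglongrightarrow> 0"
proof (rule ennreal_tendsto_0I)
  interpret Q: prob_space Q by (rule Q)
  let ?v = "\<lambda>N \<omega>. (\<Sum>i=1..N. (\<zeta> N i \<omega>)\<^sup>2) / N - ((\<Sum>i=1..N. \<zeta> N i \<omega>) / N)\<^sup>2"
  let ?V = "(\<integral>q. (L q)\<^sup>2 \<partial>Q) - (\<integral>q. L q \<partial>Q)\<^sup>2"
  fix e :: real assume "e > 0"
  obtain K1 N1 where K1: "K1 > 0" and N1: "\<And>N i. N \<ge> N1 \<Longrightarrow> i\<in>{1..N} \<Longrightarrow>
      (\<integral>\<^sup>+\<omega>. ennreal (of_bool (\<bar>\<zeta> N i \<omega>\<bar> > K1) * \<zeta> N i \<omega> ^ 4) \<partial>M) \<le> ennreal 1"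
    using ui[of 1] by fastforce
  \<comment> \<open>Bounds the expected mean of the fourth powers: \<open>K1 ^ 4\<close> for values
    up to \<open>K1\<close> and \<open>1\<close> for the tail beyond.\<close>
  define C where "C = K1 ^ 4 + 1"
  have "C > 0" unfolding C_def by (intro add_nonneg_pos) auto
  \<comment> \<open>Chosen so that the sum of all contributions at the end,
    \<open>3 * ((3 * \<eta> + 16 * \<eta> * C) + \<eta> + \<eta>)\<close>, is exactly
    \<open>e\<close>.\<close>
  define \<eta> where "\<eta> = e / (3 * (5 + 16 * C))"
  have \<eta>: "\<eta> > 0" using \<open>e > 0\<close> \<open>C > 0\<close> by (simp add: \<eta>_def)
  have \<eta>e: "3 * (\<eta> * (5 + 16 * C)) = e" using \<open>C > 0\<close> by (simp add: \<eta>_def field_simps)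
  \<comment> \<open>The tail mean is later multiplied by \<open>2 + 1 / \<eta>\<close>; the two
    entries of the minimum absorb the two summands of that factor.\<close>
  define \<delta> where "\<delta> = min (\<eta> / 2) (\<eta>\<^sup>2)"
  have \<delta>: "\<delta> > 0" using \<eta> by (simp add: \<delta>_def)
  obtain K2 N2 where K2: "K2 > 0" and N2: "\<And>N i. N \<ge> N2 \<Longrightarrow> i\<in>{1..N} \<Longrightarrow>
      (\<integral>\<^sup>+\<omega>. ennreal (of_bool (\<bar>\<zeta> N i \<omega>\<bar> > K2) * \<zeta> N i \<omega> ^ 4) \<partial>M) \<le> ennreal \<delta>"
    using ui[OF \<delta>] by fastforce
  define VK where "VK = (\<lambda>K. (\<integral>q. (clamp_at K (L q))\<^sup>2 \<partial>Q) - (\<integral>q. clamp_at K (L q) \<partial>Q)\<^sup>2)"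
  have "(\<lambda>k::nat. (VK (real k) - ?V)\<^sup>2) \<longlonglongrightarrow> (?V - ?V)\<^sup>2"
    unfolding VK_def by (intro tendsto_intros clamped_variance_tendsto Q L L2)
  then have "\<forall>\<^sub>F k in sequentially. (VK (real k) - ?V)\<^sup>2 < \<eta>"
    using \<eta> by (intro order_tendstoD(2)[of _ "(?V - ?V)\<^sup>2"]) auto
  moreover have "\<forall>\<^sub>F k in sequentially. K2 \<le> real k"
    using filterlim_real_sequentially unfolding filterlim_at_top by auto
  ultimately have "\<forall>\<^sub>F k in sequentially. (VK (real k) - ?V)\<^sup>2 < \<eta> \<and> K2 \<le> real k"
    by eventually_elim auto
  then obtain k0 :: nat where "(VK (real k0) - ?V)\<^sup>2 < \<eta> \<and> K2 \<le> real k0"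
    unfolding eventually_sequentially by blast
  \<comment> \<open>\<open>K\<close> has to be at least \<open>K2\<close> so that the tail beyond
    \<open>K\<close> is dominated by the tail beyond \<open>K2\<close>, and large enough that
    clamping \<open>L\<close> hardly changes its variance.\<close>
  then obtain K where KV: "(VK K - ?V)\<^sup>2 < \<eta>" and KK2: "K2 \<le> K" by blast
  have K: "K > 0" using KK2 K2 by simp
  define a where "a = (\<integral>q. clamp_at K (L q) \<partial>Q)"
  define b where "b = (\<integral>q. (clamp_at K (L q))\<^sup>2 \<partial>Q)"
  define s1 where "s1 = (\<lambda>N \<omega>. \<bar>(\<Sum>i=1..N. clamp_at K (\<zeta> N i \<omega>)) / N - a\<bar>)"
  define s2 where "s2 = (\<lambda>N \<omega>. \<bar>(\<Sum>i=1..N. (clamp_at K (\<zeta> N i \<omega>))\<^sup>2) / N - b\<bar>)"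
  have s1: "(\<lambda>N. expectation (s1 N)) \<longlonglongrightarrow> 0" unfolding s1_def a_def
    by (rule empirical_mean_clamp_tendsto[OF rv Q L tail K, where g = "\<lambda>x. x" and B = 1]) auto
  have s2: "(\<lambda>N. expectation (s2 N)) \<longlonglongrightarrow> 0" unfolding s2_def b_def
  proof (rule empirical_mean_clamp_tendsto[OF rv Q L tail K, where g = "\<lambda>x. x\<^sup>2" and B = "2 * K"])
    fix x y :: real assume "\<bar>x\<bar> \<le> K" "\<bar>y\<bar> \<le> K"
    then have "\<bar>x - y\<bar> * \<bar>x + y\<bar> \<le> \<bar>x - y\<bar> * (2 * K)" by (intro mult_left_mono) auto
    then show "\<bar>x\<^sup>2 - y\<^sup>2\<bar> \<le> 2 * K * \<bar>x - y\<bar>"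
      by (simp add: power2_eq_square square_diff_square_factored abs_mult mult_ac)
  qed (use K in auto)
  have "(\<lambda>N. 4 * K\<^sup>2 * (expectation (s2 N) + 2 * K * expectation (s1 N))) \<longlonglongrightarrow> 4 * K\<^sup>2 * (0 + 2 * K * 0)"
    by (intro tendsto_intros s1 s2)
  then have "\<forall>\<^sub>F N in sequentially. 4 * K\<^sup>2 * (expectation (s2 N) + 2 * K * expectation (s1 N)) < \<eta>"
    using \<eta> by (intro order_tendstoD(2)) auto
  moreover have "\<forall>\<^sub>F N in sequentially. N \<ge> max 2 (max N1 N2)" by (rule eventually_ge_at_top)
  ultimately show "\<forall>\<^sub>F N in sequentially. (\<integral>\<^sup>+\<omega>. ennreal ((?v N \<omega> - ?V)\<^sup>2) \<partial>M) \<le> ennreal e"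
  proof eventually_elim
    case (elim N)
    then have N: "N \<ge> 2" "N \<ge> N1" "N \<ge> N2" by auto
    note rvN [measurable] = rv[OF N(1)]
    define t1 where "t1 = (\<lambda>i \<omega>. of_bool (\<bar>\<zeta> N i \<omega>\<bar> > K1) * \<zeta> N i \<omega> ^ 4)"
    define t where "t = (\<lambda>i \<omega>. of_bool (\<bar>\<zeta> N i \<omega>\<bar> > K) * \<zeta> N i \<omega> ^ 4)"
    have tm [measurable]: "t1 i \<in> borel_measurable M" "t i \<in> borel_measurable M" if "i \<in> {1..N}" for i
      using that unfolding t1_def t_def of_bool_def by measurable
    have t0: "t1 i \<omega> \<ge> 0" "t i \<omega> \<ge> 0" for i \<omega> by (auto simp: t1_def t_def)
    have t1: "integrable M (t1 i) \<and> expectation (t1 i) \<le> 1" if i: "i \<in> {1..N}" for i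
    proof -
      have *: "(\<integral>\<^sup>+\<omega>. ennreal (t1 i \<omega>) \<partial>M) \<le> ennreal 1" using N1[OF N(2) i] by (simp add: t1_def)
      have int: "integrable M (t1 i)"
        using tm(1)[OF i] t0 * by (intro integrableI_nonneg) (auto simp: top_unique intro: le_less_trans)
      then show ?thesis using * t0 by (simp add: nn_integral_eq_integral)
    qed
    have t: "integrable M (t i) \<and> expectation (t i) \<le> \<delta>" if i: "i \<in> {1..N}" for i
    proof -
      have "(\<integral>\<^sup>+\<omega>. ennreal (t i \<omega>) \<partial>M) \<le> (\<integral>\<^sup>+\<omega>. ennreal (of_bool (\<bar>\<zeta> N i \<omega>\<bar> > K2) * \<zeta> N i \<omega> ^ 4) \<partial>M)"
        using KK2 by (intro nn_integral_mono) (auto simp: t_def)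
      also have "\<dots> \<le> ennreal \<delta>" using N2[OF N(3) i] .
      finally have *: "(\<integral>\<^sup>+\<omega>. ennreal (t i \<omega>) \<partial>M) \<le> ennreal \<delta>" .
      have int: "integrable M (t i)"
        using tm(2)[OF i] t0 * by (intro integrableI_nonneg) (auto simp: top_unique intro: le_less_trans)
      then show ?thesis using * t0 \<delta> by (simp add: nn_integral_eq_integral)
    qed
    define m where "m = (\<lambda>\<omega>. (\<Sum>i=1..N. t i \<omega>) / N)"
    define m1 where "m1 = (\<lambda>\<omega>. (\<Sum>i=1..N. t1 i \<omega>) / N)"
    have mi: "integrable M m" "integrable M m1" unfolding m_def m1_def
      using t t1 by (auto intro!: integrable_divide_zero Bochner_Integration.integrable_sum)
    have m1E: "expectation m1 \<le> 1"
    proof -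
      have "expectation m1 = (\<Sum>i=1..N. expectation (t1 i)) / N"
        unfolding m1_def using t1 by (subst integral_divide_zero, subst Bochner_Integration.integral_sum) auto
      also have "\<dots> \<le> (\<Sum>i=1..N. 1) / N" using t1 by (intro divide_right_mono sum_mono) auto
      also have "\<dots> = 1" using N by simp
      finally show ?thesis .
    qed
    have mE: "expectation m \<le> \<delta>"
    proof -
      have "expectation m = (\<Sum>i=1..N. expectation (t i)) / N"
        unfolding m_def using t by (subst integral_divide_zero, subst Bochner_Integration.integral_sum) auto
      also have "\<dots> \<le> (\<Sum>i=1..N. \<delta>) / N" using t by (intro divide_right_mono sum_mono) auto
      also have "\<dots> = \<delta>" using N by simp
      finally show ?thesis .
    qed
    have avgb: "\<bar>(\<Sum>i=1..N. f i) / N\<bar> \<le> B" if "\<And>i. \<bar>f i\<bar> \<le> B" for f :: "nat \<Rightarrow> real" and B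
    proof -
      have "\<bar>\<Sum>i=1..N. f i\<bar> \<le> (\<Sum>i=1..N. B)" using that by (intro order_trans[OF sum_abs] sum_mono) auto
      then show ?thesis using N by (simp add: field_simps)
    qed
    have c2: "\<bar>(clamp_at K x)\<^sup>2\<bar> \<le> K\<^sup>2" for x
      using clamp_at_bound[of K x] K by (simp add: abs_le_square_iff[symmetric])
    have si: "integrable M (s1 N)" "integrable M (s2 N)"
    proof -
      have "\<bar>s1 N \<omega>\<bar> \<le> K + \<bar>a\<bar>" for \<omega>
        using avgb[of "\<lambda>i. clamp_at K (\<zeta> N i \<omega>)" K, OF clamp_at_bound] K unfolding s1_def by linarith
      then show "integrable M (s1 N)"
        by (intro integrable_const_bound[where B = "K + \<bar>a\<bar>"]) (auto simp: s1_def)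
      have "\<bar>s2 N \<omega>\<bar> \<le> K\<^sup>2 + \<bar>b\<bar>" for \<omega>
        using avgb[of "\<lambda>i. (clamp_at K (\<zeta> N i \<omega>))\<^sup>2" "K\<^sup>2", OF c2] unfolding s2_def by linarith
      then show "integrable M (s2 N)"
        by (intro integrable_const_bound[where B = "K\<^sup>2 + \<bar>b\<bar>"]) (auto simp: s2_def)
    qed
    \<comment> \<open>An integrable pointwise majorant of the squared error. The factor
      \<open>3\<close> comes from squaring a sum of three errors.\<close>
    define R where "R = (\<lambda>\<omega>. 3 * (((2 + 1 / \<eta>) * m \<omega> + 16 * \<eta> * (K1 ^ 4 + m1 \<omega>))
        + 4 * K\<^sup>2 * (s2 N \<omega> + 2 * K * s1 N \<omega>) + \<eta>))"
    have Ri: "integrable M R" unfolding R_def using si mi by auto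
    have "expectation R = 3 * (((2 + 1 / \<eta>) * expectation m + 16 * \<eta> * (K1 ^ 4 + expectation m1))
        + 4 * K\<^sup>2 * (expectation (s2 N) + 2 * K * expectation (s1 N)) + \<eta>)"
      unfolding R_def using si mi by (simp add: prob_space)
    also have "\<dots> \<le> 3 * ((3 * \<eta> + 16 * \<eta> * (K1 ^ 4 + 1)) + \<eta> + \<eta>)"
    proof -
      have "(2 + 1 / \<eta>) * expectation m \<le> (2 + 1 / \<eta>) * \<delta>" using \<eta> mE by (intro mult_left_mono) auto
      also have "\<dots> = 2 * \<delta> + \<delta> / \<eta>" by (simp add: algebra_simps)
      also have "\<dots> \<le> 2 * (\<eta> / 2) + \<eta>\<^sup>2 / \<eta>" unfolding \<delta>_def using \<eta> by (intro add_mono mult_left_mono divide_right_mono) auto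
      also have "\<dots> = 2 * \<eta>" using \<eta> by (simp add: power2_eq_square)
      finally have 1: "(2 + 1 / \<eta>) * expectation m \<le> 3 * \<eta>" using \<eta> by simp
      have 2: "16 * \<eta> * (K1 ^ 4 + expectation m1) \<le> 16 * \<eta> * (K1 ^ 4 + 1)"
        using \<eta> m1E by (intro mult_left_mono) auto
      show ?thesis by (intro mult_left_mono add_mono[OF add_mono[OF add_mono[OF 1 2] less_imp_le[OF elim(1)]] order_refl]) simp
    qed
    also have "\<dots> = e" using \<eta>e by (simp add: C_def algebra_simps)
    finally have RE: "expectation R \<le> e" .
    have RV: "(?v N \<omega> - ?V)\<^sup>2 \<le> R \<omega>" for \<omega>
    proof -
      define v where "v = (\<Sum>i=1..N. (\<zeta> N i \<omega>)\<^sup>2) / N - ((\<Sum>i=1..N. \<zeta> N i \<omega>) / N)\<^sup>2"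
      define c1 where "c1 = (\<Sum>i=1..N. clamp_at K (\<zeta> N i \<omega>)) / N"
      define c2' where "c2' = (\<Sum>i=1..N. (clamp_at K (\<zeta> N i \<omega>))\<^sup>2) / N"
      have "(\<Sum>i=1..N. \<zeta> N i \<omega> ^ 4) / N \<le> (\<Sum>i=1..N. K1 ^ 4 + t1 i \<omega>) / N"
      proof (intro divide_right_mono sum_mono)
        fix i
        have "\<zeta> N i \<omega> ^ 4 \<le> K1 ^ 4" if "\<bar>\<zeta> N i \<omega>\<bar> \<le> K1"
          using power_mono[OF that, of 4] by simp
        moreover have "0 \<le> K1 ^ 4" using K1 by simp
        ultimately show "\<zeta> N i \<omega> ^ 4 \<le> K1 ^ 4 + t1 i \<omega>"
          unfolding t1_def by (cases "\<bar>\<zeta> N i \<omega>\<bar> > K1") auto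
      qed auto
      also have "\<dots> = K1 ^ 4 + m1 \<omega>" using N by (simp add: sum.distrib m1_def add_divide_distrib)
      finally have z4: "(\<Sum>i=1..N. \<zeta> N i \<omega> ^ 4) / N \<le> K1 ^ 4 + m1 \<omega>" .
      have "(v - (c2' - c1\<^sup>2))\<^sup>2 \<le> (2 + 1 / \<eta>) * m \<omega> + 16 * \<eta> * ((\<Sum>i=1..N. \<zeta> N i \<omega> ^ 4) / N)"
        unfolding v_def c1_def c2'_def m_def t_def using N K \<eta> by (intro variance_truncation_bound) auto
      also have "\<dots> \<le> (2 + 1 / \<eta>) * m \<omega> + 16 * \<eta> * (K1 ^ 4 + m1 \<omega>)"
        using z4 \<eta> by (intro add_left_mono mult_left_mono) auto
      finally have 1: "(v - (c2' - c1\<^sup>2))\<^sup>2 \<le> (2 + 1 / \<eta>) * m \<omega> + 16 * \<eta> * (K1 ^ 4 + m1 \<omega>)" .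
      have c1b: "\<bar>c1\<bar> \<le> K" unfolding c1_def using K by (intro avgb clamp_at_bound) auto
      have c2b: "\<bar>c2'\<bar> \<le> K\<^sup>2" unfolding c2'_def by (intro avgb c2)
      have ab: "\<bar>a\<bar> \<le> K"
      proof -
        have "\<bar>a\<bar> \<le> (\<integral>q. \<bar>clamp_at K (L q)\<bar> \<partial>Q)" unfolding a_def by (rule integral_abs_bound)
        also have "\<dots> \<le> (\<integral>q. K \<partial>Q)"
          using K clamp_at_bound[of K] by (intro integral_mono Q.integrable_const_bound[where B = K]) auto
        finally show ?thesis by (simp add: Q.prob_space)
      qed
      have bb: "\<bar>b\<bar> \<le> K\<^sup>2"
      proof -
        have "\<bar>b\<bar> \<le> (\<integral>q. \<bar>(clamp_at K (L q))\<^sup>2\<bar> \<partial>Q)" unfolding b_def by (rule integral_abs_bound)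
        also have "\<dots> \<le> (\<integral>q. K\<^sup>2 \<partial>Q)"
          using c2 by (intro integral_mono Q.integrable_const_bound[where B = "K\<^sup>2"]) auto
        finally show ?thesis by (simp add: Q.prob_space)
      qed
      let ?w = "(c2' - c1\<^sup>2) - (b - a\<^sup>2)"
      have "\<bar>c1\<^sup>2 - a\<^sup>2\<bar> = \<bar>c1 - a\<bar> * \<bar>c1 + a\<bar>" by (simp add: power2_eq_square square_diff_square_factored abs_mult mult.commute)
      also have "\<dots> \<le> \<bar>c1 - a\<bar> * (2 * K)" using c1b ab by (intro mult_left_mono) auto
      finally have "\<bar>?w\<bar> \<le> s2 N \<omega> + 2 * K * s1 N \<omega>"
        unfolding s1_def s2_def c1_def[symmetric] c2'_def[symmetric] by (simp add: mult_ac)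
      moreover have "\<bar>?w\<bar> \<le> 4 * K\<^sup>2"
      proof -
        have "c1\<^sup>2 \<le> K\<^sup>2" "a\<^sup>2 \<le> K\<^sup>2" using c1b ab K by (auto simp: abs_le_square_iff[symmetric])
        then show ?thesis using c2b bb zero_le_power2[of c1] zero_le_power2[of a] by linarith
      qed
      \<comment> \<open>One factor is bounded by a constant, the other by the quantity that is small
        in mean; this turns convergence in \<open>L\<^sup>1\<close> into convergence in
        \<open>L\<^sup>2\<close>.\<close>
      ultimately have "\<bar>?w\<bar> * \<bar>?w\<bar> \<le> 4 * K\<^sup>2 * (s2 N \<omega> + 2 * K * s1 N \<omega>)"
        by (intro mult_mono) auto
      then have 2: "?w\<^sup>2 \<le> 4 * K\<^sup>2 * (s2 N \<omega> + 2 * K * s1 N \<omega>)" by (simp add: power2_eq_square)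
      have 3: "((b - a\<^sup>2) - ?V)\<^sup>2 \<le> \<eta>" using KV unfolding VK_def a_def b_def by simp
      have three: "(x + y + z)\<^sup>2 \<le> 3 * (x\<^sup>2 + y\<^sup>2 + z\<^sup>2)" for x y z :: real
        using zero_le_power2[of "x - y"] zero_le_power2[of "y - z"] zero_le_power2[of "x - z"]
        by (simp add: power2_eq_square algebra_simps)
      have "(v - ?V)\<^sup>2 = ((v - (c2' - c1\<^sup>2)) + ?w + ((b - a\<^sup>2) - ?V))\<^sup>2"
        by (rule arg_cong[where f = "\<lambda>x. x\<^sup>2"]) simp
      also have "\<dots> \<le> 3 * ((v - (c2' - c1\<^sup>2))\<^sup>2 + ?w\<^sup>2 + ((b - a\<^sup>2) - ?V)\<^sup>2)" by (rule three)
      also have "\<dots> \<le> R \<omega>" unfolding R_def by (intro mult_left_mono add_mono 1 2 3) auto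
      finally show ?thesis unfolding v_def .
    qed
    have "(\<integral>\<^sup>+\<omega>. ennreal ((?v N \<omega> - ?V)\<^sup>2) \<partial>M)
        \<le> (\<integral>\<^sup>+\<omega>. ennreal (R \<omega>) \<partial>M)"
      by (intro nn_integral_mono ennreal_leI RV)
    also have "\<dots> = ennreal (expectation R)"
      using Ri order_trans[OF zero_le_power2 RV] by (intro nn_integral_eq_integral) auto
    also have "\<dots> \<le> ennreal e" using RE by (rule ennreal_leI)
    finally show ?case .
  qed
qed

end

section \<open>Lebesgue differentiation\<close>

text \<open>For open \<open>U\<close> containing \<open>A\<close>, the balls inside \<open>U\<close>
  on which \<open>\<mu>\<close> is at most \<open>\<nu>\<close> form a Vitali cover of
  \<open>A\<close>. A countable disjoint subfamily misses only a Lebesgue null set, which is null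
  for \<open>\<mu>\<close> by absolute continuity, so summing over it bounds
  \<open>emeasure \<mu> A\<close> by \<open>emeasure \<nu> U\<close>. Outer regularity of the finite
  measure \<open>\<nu>\<close> lets \<open>U\<close> shrink to \<open>A\<close>.\<close>

lemma emeasure_le_if_small_balls_le:
  fixes \<mu> \<nu> :: "'a::euclidean_space measure"
  assumes sets [measurable_cong, simp]: "sets \<mu> = sets borel" "sets \<nu> = sets borel"
    and ac: "absolutely_continuous lborel \<mu>"
    and fin: "emeasure \<nu> UNIV \<noteq> \<infinity>"
    and A [measurable]: "A \<in> sets borel"
    and balls: "\<And>x \<delta>. x \<in> A \<Longrightarrow> \<delta> > 0 \<Longrightarrow> \<exists>r. 0 < r \<and> r < \<delta> \<and> emeasure \<mu> (ball x r) \<le> emeasure \<nu> (ball x r)"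
  shows "emeasure \<mu> A \<le> emeasure \<nu> A"
proof -
  have sp: "space \<nu> = UNIV" using sets_eq_imp_space_eq[OF sets(2)] by simp
  have "emeasure \<nu> A = (INF U \<in> {U. A \<subseteq> U \<and> open U}. emeasure \<nu> U)"
    by (rule outer_regular) (use fin sp A in auto)
  moreover have "emeasure \<mu> A \<le> emeasure \<nu> U" if U: "A \<subseteq> U" "open U" for U
  proof -
    let ?K = "{(x, r). 0 < r \<and> ball x r \<subseteq> U \<and> emeasure \<mu> (ball x r) \<le> emeasure \<nu> (ball x r)}"
    obtain C where C: "countable C" "C \<subseteq> ?K"
       and dj: "pairwise (\<lambda>i j. disjnt (ball (fst i) (snd i)) (ball (fst j) (snd j))) C"
       and neg: "negligible (A - (\<Union>i \<in> C. ball (fst i) (snd i)))"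
    proof (rule Vitali_covering_theorem_balls[where S = A and a = fst and r = snd and K = ?K])
      fix x and d :: real assume x: "x \<in> A" "0 < d"
      obtain e where e: "e > 0" "ball x e \<subseteq> U" using U x by (meson openE subsetD)
      obtain r where r: "0 < r" "r < min d e" "emeasure \<mu> (ball x r) \<le> emeasure \<nu> (ball x r)"
        using balls[OF x(1), of "min d e"] x(2) e(1) by auto
      then have "ball x r \<subseteq> U" using e(2) by auto
      then show "\<exists>i. i \<in> ?K \<and> x \<in> ball (fst i) (snd i) \<and> snd i < d"
        using r by (intro exI[of _ "(x, r)"]) auto
    qed
    let ?B = "\<lambda>i. ball (fst i) (snd i)"
    have [measurable]: "(\<Union>i\<in>C. ?B i) \<in> sets borel" by (intro borel_open open_UN) auto
    have "A - (\<Union>i\<in>C. ?B i) \<in> null_sets lborel"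
      using neg unfolding negligible_iff_null_sets by (auto simp: null_sets_completion_iff)
    then have "emeasure \<mu> (A - (\<Union>i\<in>C. ?B i)) = 0"
      using ac unfolding absolutely_continuous_def by auto
    then have "emeasure \<mu> A \<le> emeasure \<mu> (\<Union>i\<in>C. ?B i)"
      using emeasure_Un_null_set[of "\<Union>i\<in>C. ?B i" \<mu> "A - (\<Union>i\<in>C. ?B i)"]
        emeasure_mono[of A "(\<Union>i\<in>C. ?B i) \<union> (A - (\<Union>i\<in>C. ?B i))" \<mu>] by (auto simp: null_sets_def)
    also have df: "disjoint_family_on ?B C"
      using dj unfolding disjoint_family_on_def pairwise_def disjnt_def by blast
    have "emeasure \<mu> (\<Union>i\<in>C. ?B i) = (\<integral>\<^sup>+i. emeasure \<mu> (?B i) \<partial>count_space C)"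
      by (intro emeasure_UN_countable C df) auto
    also have "\<dots> \<le> (\<integral>\<^sup>+i. emeasure \<nu> (?B i) \<partial>count_space C)"
      using C(2) by (intro nn_integral_mono) auto
    also have "\<dots> = emeasure \<nu> (\<Union>i\<in>C. ?B i)"
      by (intro emeasure_UN_countable[symmetric] C df) auto
    also have "\<dots> \<le> emeasure \<nu> U"
      using C(2) U(2) by (intro emeasure_mono UN_least) fastforce+
    finally show ?thesis .
  qed
  ultimately show ?thesis by (auto intro: INF_greatest)
qed

text \<open>Continuity from below gives a slightly smaller ball that still exceeds \<open>c\<close>,
  and every ball of radius \<open>r\<close> around a nearby centre contains it. Openness, rather
  than mere measurability, is wanted because the exceptional sets below are unions over uncountably
  many radii.\<close>

lemma open_emeasure_ball_greater:
  fixes \<mu> :: "'a::euclidean_space measure"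
  assumes sets [simp]: "sets \<mu> = sets borel"
  shows "open {x. emeasure \<mu> (ball x r) > c}"
proof (unfold open_contains_ball, safe)
  fix x assume x: "emeasure \<mu> (ball x r) > c"
  let ?B = "\<lambda>n::nat. ball x (r - 1 / Suc n)"
  have "(\<lambda>n. emeasure \<mu> (?B n)) \<longlonglongrightarrow> emeasure \<mu> (\<Union>n. ?B n)"
  proof (rule Lim_emeasure_incseq)
    show "incseq ?B" by (intro incseq_SucI subset_ball) (simp add: field_simps)
  qed auto
  also have "(\<Union>n. ?B n) = ball x r"
  proof (rule set_eqI)
    fix y
    have "dist x y < r \<longleftrightarrow> (\<exists>n::nat. dist x y < r - 1 / Suc n)"
    proof
      assume "dist x y < r"
      then obtain n where "1 / real (Suc n) < r - dist x y" using reals_Archimedean[of "r - dist x y"]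
        by (auto simp: inverse_eq_divide)
      then show "\<exists>n::nat. dist x y < r - 1 / Suc n" by (intro exI[of _ n]) linarith
    next
      assume "\<exists>n::nat. dist x y < r - 1 / Suc n"
      then obtain n :: nat where "dist x y < r - 1 / Suc n" by blast
      moreover have "0 < 1 / real (Suc n)" by simp
      ultimately show "dist x y < r" by linarith
    qed
    then show "y \<in> (\<Union>n. ?B n) \<longleftrightarrow> y \<in> ball x r" by simp
  qed
  finally have "\<forall>\<^sub>F n in sequentially. emeasure \<mu> (?B n) > c" using x by (rule order_tendstoD(1))
  then obtain n where n: "emeasure \<mu> (?B n) > c" unfolding eventually_sequentially by auto
  show "\<exists>e>0. ball x e \<subseteq> {x. emeasure \<mu> (ball x r) > c}"
  proof (intro exI[of _ "1 / real (Suc n)"] conjI subsetI CollectI)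
    fix y assume y: "y \<in> ball x (1 / real (Suc n))"
    have "?B n \<subseteq> ball y r"
    proof
      fix z assume "z \<in> ?B n"
      then show "z \<in> ball y r" using y dist_triangle[of y z x] by (simp add: dist_commute)
    qed
    then have "emeasure \<mu> (?B n) \<le> emeasure \<mu> (ball y r)" by (intro emeasure_mono) auto
    then show "emeasure \<mu> (ball y r) > c" using n by simp
  qed simp
qed

text \<open>Dual to the previous lemma. A closed ball is the intersection of slightly larger closed
  balls, so continuity from above applies, which is where finiteness enters.\<close>

lemma open_emeasure_ball_less:
  fixes \<mu> :: "'a::euclidean_space measure"
  assumes sets [simp]: "sets \<mu> = sets borel" and fin: "emeasure \<mu> UNIV \<noteq> \<infinity>"
  shows "open {x. emeasure \<mu> (cball x r) < c}"
proof (unfold open_contains_ball, safe)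
  fix x assume x: "emeasure \<mu> (cball x r) < c"
  let ?B = "\<lambda>n::nat. cball x (r + 1 / Suc n)"
  have fin': "emeasure \<mu> S \<noteq> \<infinity>" for S using fin emeasure_space[of \<mu> S] sets_eq_imp_space_eq[OF sets]
    by (auto simp: top_unique)
  have "(\<lambda>n. emeasure \<mu> (?B n)) \<longlonglongrightarrow> emeasure \<mu> (\<Inter>n. ?B n)"
  proof (rule Lim_emeasure_decseq)
    show "decseq ?B" by (intro decseq_SucI subset_cball) (simp add: field_simps)
  qed (use fin' in auto)
  also have "(\<Inter>n. ?B n) = cball x r"
  proof (rule set_eqI)
    fix y
    have "dist x y \<le> r \<longleftrightarrow> (\<forall>n::nat. dist x y \<le> r + 1 / Suc n)"
    proof
      assume *: "\<forall>n::nat. dist x y \<le> r + 1 / Suc n"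
      show "dist x y \<le> r"
      proof (rule ccontr)
        assume "\<not> dist x y \<le> r"
        then obtain n where "1 / real (Suc n) < dist x y - r" using reals_Archimedean[of "dist x y - r"]
          by (auto simp: inverse_eq_divide)
        then show False using *[rule_format, of n] by linarith
      qed
    next
      assume *: "dist x y \<le> r"
      show "\<forall>n::nat. dist x y \<le> r + 1 / Suc n"
      proof
        fix n :: nat
        have "0 < 1 / real (Suc n)" by simp
        then show "dist x y \<le> r + 1 / Suc n" using * by linarith
      qed
    qed
    then show "y \<in> (\<Inter>n. ?B n) \<longleftrightarrow> y \<in> cball x r" by simp
  qed
  finally have "\<forall>\<^sub>F n in sequentially. emeasure \<mu> (?B n) < c" using x by (rule order_tendstoD(2))
  then obtain n where n: "emeasure \<mu> (?B n) < c" unfolding eventually_sequentially by auto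
  show "\<exists>e>0. ball x e \<subseteq> {x. emeasure \<mu> (cball x r) < c}"
  proof (intro exI[of _ "1 / real (Suc n)"] conjI subsetI CollectI)
    fix y assume y: "y \<in> ball x (1 / real (Suc n))"
    have "cball y r \<subseteq> ?B n"
    proof
      fix z assume "z \<in> cball y r"
      then show "z \<in> ?B n" using y dist_triangle[of x z y] by (simp add: dist_commute)
    qed
    then have "emeasure \<mu> (cball y r) \<le> emeasure \<mu> (?B n)" by (intro emeasure_mono) auto
    then show "emeasure \<mu> (cball y r) < c" using n by simp
  qed simp
qed

text \<open>Spheres are Lebesgue null. This reconciles the open balls of differentiation and of
  \<open>I_fun\<close> with closed balls, whose complements are the events
  \<open>dist x y > r\<close>.\<close>

lemma emeasure_ball_eq_cball:
  fixes \<mu> :: "'a::euclidean_space measure"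
  assumes sets [simp]: "sets \<mu> = sets borel" and ac: "absolutely_continuous lborel \<mu>"
  shows "emeasure \<mu> (ball x r) = emeasure \<mu> (cball x r)"
proof -
  have "sphere x r \<in> null_sets lborel"
    using negligible_sphere[of x r] unfolding negligible_iff_null_sets by (auto simp: null_sets_completion_iff)
  then have "sphere x r \<in> null_sets \<mu>" using ac by (auto simp: absolutely_continuous_def)
  moreover have "cball x r = ball x r \<union> sphere x r" by auto
  ultimately show ?thesis by (simp add: emeasure_Un_null_set)
qed

context
  fixes f :: "'a::euclidean_space \<Rightarrow> real"
  assumes f_meas [measurable]: "f \<in> borel_measurable borel" and f_nonneg: "\<And>x. f x \<ge> 0"
    and f_fin: "(\<integral>\<^sup>+x. ennreal (f x) \<partial>lborel) \<noteq> \<infinity>"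
begin

abbreviation (input) "\<D> \<equiv> density lborel (\<lambda>x. ennreal (f x))"

lemma density_facts:
  shows "sets \<D> = sets borel" "absolutely_continuous lborel \<D>" "emeasure \<D> UNIV \<noteq> \<infinity>"
  using f_fin by (auto intro!: absolutely_continuousI_density simp: emeasure_density)

text \<open>Let \<open>A\<close> consist of points with \<open>f x < b\<close> around which
  arbitrarily small balls have average above \<open>a\<close>. Comparison on small balls yields that
  \<open>a\<close> times the volume of \<open>A\<close> is at most its mass, which is at most
  \<open>b\<close> times its volume; since \<open>b < a\<close>, a set of finite volume must then be
  null. Intersecting with \<open>ball 0 k\<close> provides the finite volume.\<close>

lemma ball_density_upper:
  assumes ab: "0 < b" "b < a"
  shows "AE x in lborel. f x < b \<longrightarrow>
     (\<exists>\<delta>>0. \<forall>r. 0 < r \<and> r < \<delta> \<longrightarrow> emeasure \<D> (ball x r) \<le> ennreal a * emeasure lborel (ball x r))"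
proof -
  \<comment> \<open>A countable intersection of open sets, hence Borel even though \<open>r\<close>
    ranges over an interval.\<close>
  let ?S = "(\<Inter>n::nat. \<Union>r\<in>{0<..<1 / Suc n}. {x. emeasure \<D> (ball x r) > ennreal a * ennreal (unit_ball_vol (DIM('a)) * r ^ DIM('a))})"
  have S [measurable]: "?S \<in> sets borel"
    by (intro sets.countable_INT'' borel_open open_UN ballI open_emeasure_ball_greater) auto
  have null: "emeasure lborel A = 0"
    if A_def: "A = {x. f x < b} \<inter> ball 0 k \<inter> ?S"
    for A k
  proof -
    have A [measurable]: "A \<in> sets borel" unfolding A_def by measurable
    have Ab: "f x \<le> b" if "x \<in> A" for x using that unfolding A_def by simp
    have da: "emeasure (density lborel (\<lambda>_. ennreal a)) B = ennreal a * emeasure lborel B"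
      if "B \<in> sets borel" for B :: "'a set"
      using that by (simp add: emeasure_density nn_integral_cmult)
    have "emeasure (density lborel (\<lambda>_. ennreal a)) A \<le> emeasure \<D> A"
    proof (rule emeasure_le_if_small_balls_le)
      show "absolutely_continuous lborel (density lborel (\<lambda>_. ennreal a))"
        by (rule absolutely_continuousI_density) auto
      show "emeasure \<D> UNIV \<noteq> \<infinity>" by (rule density_facts)
      fix x and \<delta> :: real assume x: "x \<in> A" "\<delta> > 0"
      obtain n where n: "1 / real (Suc n) < \<delta>" using reals_Archimedean[OF x(2)] by (auto simp: inverse_eq_divide)
      obtain r where r: "0 < r" "r < 1 / real (Suc n)" "emeasure \<D> (ball x r) > ennreal a * ennreal (unit_ball_vol (DIM('a)) * r ^ DIM('a))"
        using IntD2[OF x(1)[unfolded A_def], unfolded INT_iff, rule_format, of n] unfolding UN_iff by auto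
      then show "\<exists>r>0. r < \<delta> \<and> emeasure (density lborel (\<lambda>_. ennreal a)) (ball x r) \<le> emeasure \<D> (ball x r)"
        using n by (intro exI[of _ r]) (auto simp: da emeasure_ball)
    qed auto
    then have "ennreal a * emeasure lborel A \<le> emeasure \<D> A"
      by (simp add: da)
    also have "\<dots> \<le> (\<integral>\<^sup>+x. ennreal b * indicator A x \<partial>lborel)"
      by (subst emeasure_density) (auto intro!: nn_integral_mono simp: Ab ennreal_leI split: split_indicator)
    also have "\<dots> = ennreal b * emeasure lborel A" by (simp add: nn_integral_cmult)
    finally have *: "ennreal a * emeasure lborel A \<le> ennreal b * emeasure lborel A" .
    have "emeasure lborel A \<le> emeasure lborel (ball (0::'a) k)" unfolding A_def by (intro emeasure_mono) auto
    also have "\<dots> < \<infinity>" by (rule emeasure_lborel_ball_finite)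
    finally obtain l where l: "emeasure lborel A = ennreal l" "l \<ge> 0" by (cases "emeasure lborel A") auto
    then have "a * l \<le> b * l" using * ab by (simp flip: ennreal_mult')
    then show ?thesis using l ab by (simp add: mult_le_cancel_right)
  qed
  have "AE x in lborel. \<forall>k::nat. x \<notin> {x. f x < b} \<inter> ball 0 (real k) \<inter> ?S"
    (is "AE x in lborel. \<forall>k. x \<notin> ?A k")
  proof (subst AE_all_countable, rule allI, rule AE_not_in)
    fix k
    have "?A k \<in> sets lborel" by measurable
    then show "?A k \<in> null_sets lborel" using null[OF refl, of "real k"] by (auto simp: null_sets_def)
  qed
  then show ?thesis
  proof (rule AE_mp, intro AE_I2 impI)
    fix x assume x: "\<forall>k. x \<notin> ?A k" and fx: "f x < b"
    obtain k :: nat where "norm x < k" using reals_Archimedean2 by blast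
    then have "x \<notin> ?S"
      using x[rule_format, of k] fx by (simp del: INT_iff UN_iff)
    then obtain n :: nat where "x \<notin> (\<Union>r\<in>{0<..<1 / Suc n}. {x. emeasure \<D> (ball x r) > ennreal a * ennreal (unit_ball_vol (DIM('a)) * r ^ DIM('a))})"
      unfolding INT_iff by blast
    then show "\<exists>\<delta>>0. \<forall>r. 0 < r \<and> r < \<delta> \<longrightarrow> emeasure \<D> (ball x r) \<le> ennreal a * emeasure lborel (ball x r)"
      by (intro exI[of _ "1 / real (Suc n)"]) (auto simp: emeasure_ball not_less)
  qed
qed

text \<open>The same comparison with the two measures exchanged. Lebesgue measure now stands on the
  dominating side, which has to be finite.\<close>

lemma ball_density_lower:
  assumes ab: "0 < b" "b < a"
  shows "AE x in lborel. a < f x \<longrightarrow>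
     (\<exists>\<delta>>0. \<forall>r. 0 < r \<and> r < \<delta> \<longrightarrow> emeasure \<D> (ball x r) \<ge> ennreal b * emeasure lborel (ball x r))"
proof -
  let ?S = "(\<Inter>n::nat. \<Union>r\<in>{0<..<1 / Suc n}. {x. emeasure \<D> (cball x r) < ennreal b * ennreal (unit_ball_vol (DIM('a)) * r ^ DIM('a))})"
  have S [measurable]: "?S \<in> sets borel"
    using density_facts by (intro sets.countable_INT'' borel_open open_UN ballI open_emeasure_ball_less) auto
  have null: "emeasure lborel A = 0"
    if A_def: "A = {x. a < f x} \<inter> ball 0 k \<inter> ?S"
    for A k
  proof -
    have A [measurable]: "A \<in> sets borel" unfolding A_def by measurable
    have Ab: "f x \<ge> a" if "x \<in> A" for x using that unfolding A_def by simp
    have bm: "ball (0::'a) k \<in> sets borel" by simp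
    \<comment> \<open>Restricting to \<open>ball 0 k\<close> makes this measure finite; balls around
      \<open>x\<close> of radius below \<open>k - norm x\<close> do not notice the
      restriction.\<close>
    let ?\<nu> = "density lborel (\<lambda>x::'a. ennreal b * indicator (ball 0 k) x)"
    have num [measurable]: "(\<lambda>x::'a. ennreal b * indicator (ball 0 k) x) \<in> borel_measurable borel"
      by (intro borel_measurable_times_ennreal borel_measurable_const borel_measurable_indicator) simp
    have \<nu>: "emeasure ?\<nu> B = ennreal b * emeasure lborel (B \<inter> ball 0 k)" if "B \<in> sets borel" for B
    proof -
      have "emeasure ?\<nu> B = (\<integral>\<^sup>+x. ennreal b * indicator (B \<inter> ball 0 k) x \<partial>lborel)"
        using that num by (subst emeasure_density) (auto intro!: nn_integral_cong split: split_indicator)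
      then show ?thesis using sets.Int[OF that bm] by (simp add: nn_integral_cmult_indicator)
    qed
    have fink: "emeasure lborel (ball (0::'a) k) < \<infinity>" by (rule emeasure_lborel_ball_finite)
    have "emeasure \<D> A \<le> emeasure ?\<nu> A"
    proof (rule emeasure_le_if_small_balls_le)
      show "absolutely_continuous lborel \<D>" by (rule density_facts)
      show "emeasure ?\<nu> UNIV \<noteq> \<infinity>" using fink by (subst \<nu>) (auto simp: ennreal_mult_eq_top_iff)
      fix x and \<delta> :: real assume x: "x \<in> A" "\<delta> > 0"
      have xk: "k - norm x > 0" using x by (auto simp: A_def)
      obtain n where n: "1 / real (Suc n) < min \<delta> (k - norm x)" using reals_Archimedean[of "min \<delta> (k - norm x)"] x xk by (auto simp: inverse_eq_divide)
      obtain r where r: "0 < r" "r < 1 / real (Suc n)" "emeasure \<D> (cball x r) < ennreal b * ennreal (unit_ball_vol (DIM('a)) * r ^ DIM('a))"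
        using IntD2[OF x(1)[unfolded A_def], unfolded INT_iff, rule_format, of n] unfolding UN_iff by auto
      have "ball x r \<subseteq> ball 0 k"
      proof
        fix z assume "z \<in> ball x r"
        then show "z \<in> ball 0 k" using norm_triangle_ineq[of x "z - x"] r n by (auto simp: dist_norm norm_minus_commute)
      qed
      then have "ball x r \<inter> ball 0 k = ball x r" by auto
      then show "\<exists>r>0. r < \<delta> \<and> emeasure \<D> (ball x r) \<le> emeasure ?\<nu> (ball x r)"
        using r n by (intro exI[of _ r]) (auto simp: \<nu> emeasure_ball emeasure_ball_eq_cball density_facts)
    qed auto
    also have "\<dots> = ennreal b * emeasure lborel A" 
    proof -
      have "A \<inter> ball 0 k = A" unfolding A_def by blast
      then show ?thesis by (simp add: \<nu>[OF A])
    qed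
    finally have "emeasure \<D> A \<le> ennreal b * emeasure lborel A" .
    moreover have "ennreal a * emeasure lborel A \<le> emeasure \<D> A"
    proof -
      have "ennreal a * emeasure lborel A = (\<integral>\<^sup>+x. ennreal a * indicator A x \<partial>lborel)" by (simp add: nn_integral_cmult)
      also have "\<dots> \<le> emeasure \<D> A"
        by (subst emeasure_density) (auto intro!: nn_integral_mono simp: Ab ennreal_leI split: split_indicator)
      finally show ?thesis .
    qed
    ultimately have *: "ennreal a * emeasure lborel A \<le> ennreal b * emeasure lborel A" by (rule order_trans[rotated])
    have "emeasure lborel A \<le> emeasure lborel (ball (0::'a) k)" unfolding A_def by (intro emeasure_mono) auto
    also have "\<dots> < \<infinity>" by (rule fink)
    finally obtain l where l: "emeasure lborel A = ennreal l" "l \<ge> 0" by (cases "emeasure lborel A") auto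
    then have "a * l \<le> b * l" using * ab by (simp flip: ennreal_mult')
    then show ?thesis using l ab by (simp add: mult_le_cancel_right)
  qed
  have "AE x in lborel. \<forall>k::nat. x \<notin> {x. a < f x} \<inter> ball 0 (real k) \<inter> ?S"
    (is "AE x in lborel. \<forall>k. x \<notin> ?A k")
  proof (subst AE_all_countable, rule allI, rule AE_not_in)
    fix k
    have "?A k \<in> sets lborel" by measurable
    then show "?A k \<in> null_sets lborel" using null[OF refl, of "real k"] by (auto simp: null_sets_def)
  qed
  then show ?thesis
  proof (rule AE_mp, intro AE_I2 impI)
    fix x assume x: "\<forall>k. x \<notin> ?A k" and fx: "a < f x"
    obtain k :: nat where "norm x < k" using reals_Archimedean2 by blast
    then have "x \<notin> ?S"
      using x[rule_format, of k] fx by (simp del: INT_iff UN_iff)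
    then obtain n :: nat where "x \<notin> (\<Union>r\<in>{0<..<1 / Suc n}. {x. emeasure \<D> (cball x r) < ennreal b * ennreal (unit_ball_vol (DIM('a)) * r ^ DIM('a))})"
      unfolding INT_iff by blast
    then show "\<exists>\<delta>>0. \<forall>r. 0 < r \<and> r < \<delta> \<longrightarrow> emeasure \<D> (ball x r) \<ge> ennreal b * emeasure lborel (ball x r)"
      by (intro exI[of _ "1 / real (Suc n)"]) (auto simp: emeasure_ball not_less emeasure_ball_eq_cball density_facts)
  qed
qed

text \<open>Only rational thresholds are used, so countably many null sets are discarded. A rational
  pair strictly between \<open>f x\<close> and a given bound \<open>c\<close> then yields the
  limit.\<close>

theorem lebesgue_differentiation:
  "AE x in lborel. ((\<lambda>r. measure \<D> (ball x r) / measure lborel (ball x r)) \<longlongrightarrow> f x) (at_right 0)"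
proof -
  have "AE x in lborel. \<forall>b\<in>\<rat>. \<forall>a\<in>\<rat>. 0 < b \<longrightarrow> b < a \<longrightarrow> (f x < b \<longrightarrow>
     (\<exists>\<delta>>0. \<forall>r. 0 < r \<and> r < \<delta> \<longrightarrow> emeasure \<D> (ball x r) \<le> ennreal a * emeasure lborel (ball x r)))"
    by (intro AE_ball_countable[THEN iffD2] countable_rat ballI AE_impI ball_density_upper)
  moreover have "AE x in lborel. \<forall>b\<in>\<rat>. \<forall>a\<in>\<rat>. 0 < b \<longrightarrow> b < a \<longrightarrow> (a < f x \<longrightarrow>
     (\<exists>\<delta>>0. \<forall>r. 0 < r \<and> r < \<delta> \<longrightarrow> emeasure \<D> (ball x r) \<ge> ennreal b * emeasure lborel (ball x r)))"
    by (intro AE_ball_countable[THEN iffD2] countable_rat ballI AE_impI ball_density_lower)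
  ultimately show ?thesis
  proof eventually_elim
    case (elim x)
    have finD: "emeasure \<D> S \<noteq> \<infinity>" for S
      using density_facts(3) emeasure_space[of \<D> S] by (auto simp: top_unique)
    have D: "emeasure \<D> (ball x r) = ennreal (measure \<D> (ball x r))" for r
      using finD by (simp add: emeasure_eq_ennreal_measure)
    have lb: "emeasure lborel (ball x r) = ennreal (measure lborel (ball x r))" for r
      using emeasure_lborel_ball_finite[of x r] by (intro emeasure_eq_ennreal_measure) auto
    have lpos: "measure lborel (ball x r) > 0" if "r > 0" for r
      using that by (simp add: measure_def emeasure_ball)
    show ?case
    proof (rule order_tendstoI)
      fix c assume c: "f x < c"
      obtain a where a: "a \<in> \<rat>" "f x < a" "a < c" using Rats_dense_in_real[OF c] by blast
      obtain b where b: "b \<in> \<rat>" "f x < b" "b < a" using Rats_dense_in_real[OF a(2)] by blast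
      have b0: "0 < b" using b f_nonneg[of x] by linarith
      obtain \<delta> where \<delta>: "\<delta> > 0" "\<And>r. 0 < r \<Longrightarrow> r < \<delta> \<Longrightarrow> emeasure \<D> (ball x r) \<le> ennreal a * emeasure lborel (ball x r)"
        using elim(1) a b b0 by meson
      have "measure \<D> (ball x r) / measure lborel (ball x r) < c" if r: "0 < r" "r < \<delta>" for r
      proof -
        have "measure \<D> (ball x r) \<le> a * measure lborel (ball x r)"
          using \<delta>(2)[OF r] b0 b unfolding D lb by (simp flip: ennreal_mult')
        then show ?thesis using lpos[OF r(1)] a by (smt (verit) divide_le_eq)
      qed
      then show "\<forall>\<^sub>F r in at_right 0. measure \<D> (ball x r) / measure lborel (ball x r) < c"
        using \<delta>(1) unfolding eventually_at_right_field by (intro exI[of _ \<delta>]) auto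
    next
      fix c assume c: "c < f x"
      show "\<forall>\<^sub>F r in at_right 0. c < measure \<D> (ball x r) / measure lborel (ball x r)"
      \<comment> \<open>The family of thresholds is restricted to \<open>0 < b\<close>; for negative
        \<open>c\<close> nonnegativity of the quotient suffices.\<close>
      proof (cases "c < 0")
        case True
        have "c < measure \<D> (ball x r) / measure lborel (ball x r)" for r
          by (rule less_le_trans[OF True]) auto
        then show ?thesis by simp
      next
        case False
        obtain b where b: "b \<in> \<rat>" "c < b" "b < f x" using Rats_dense_in_real[OF c] by blast
        obtain a where a: "a \<in> \<rat>" "b < a" "a < f x" using Rats_dense_in_real[OF b(3)] by blast
        have b0: "0 < b" using b False by linarith
        obtain \<delta> where \<delta>: "\<delta> > 0" "\<And>r. 0 < r \<Longrightarrow> r < \<delta> \<Longrightarrow> emeasure \<D> (ball x r) \<ge> ennreal b * emeasure lborel (ball x r)"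
          using elim(2) a b b0 by meson
        have "c < measure \<D> (ball x r) / measure lborel (ball x r)" if r: "0 < r" "r < \<delta>" for r
        proof -
          have "measure \<D> (ball x r) \<ge> b * measure lborel (ball x r)"
            using \<delta>(2)[OF r] b0 unfolding D lb by (simp flip: ennreal_mult')
          then show ?thesis using lpos[OF r(1)] b by (smt (verit) le_divide_eq)
        qed
        then show ?thesis
          using \<delta>(1) unfolding eventually_at_right_field by (intro exI[of _ \<delta>]) auto
      qed
    qed
  qed
qed

end

section \<open>Logarithmic moments of the exponential distribution\<close>

abbreviation std_exp :: "real measure" where
  "std_exp \<equiv> density lborel (exponential_density 1)"

lemma std_exp_powr:
  assumes s: "s > -1"
  shows "integrable std_exp (\<lambda>t. t powr s)" "(\<integral>t. t powr s \<partial>std_exp) = Gamma (1 + s)"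
proof -
  have "(\<integral>\<^sup>+t. ennreal (t powr s) \<partial>std_exp) = (\<integral>\<^sup>+t. ennreal (exponential_density 1 t) * ennreal (t powr s) \<partial>lborel)"
    by (subst nn_integral_density) auto
  also have "\<dots> = (\<integral>\<^sup>+t. ennreal (indicator {0..} t * t powr (1 + s - 1) / exp t) \<partial>lborel)"
    by (intro nn_integral_cong)
      (auto simp: exponential_density_def exp_minus field_simps split: split_indicator simp flip: ennreal_mult')
  also have "\<dots> = ennreal (Gamma (1 + s))"
    using s by (intro Gamma_conv_nn_integral_real[symmetric]) auto
  finally have *: "(\<integral>\<^sup>+t. ennreal (t powr s) \<partial>std_exp) = ennreal (Gamma (1 + s))" .
  then show int: "integrable std_exp (\<lambda>t. t powr s)"
    by (intro integrableI_nonneg) auto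
  show "(\<integral>t. t powr s \<partial>std_exp) = Gamma (1 + s)"
    using * int s by (simp add: nn_integral_eq_integral Gamma_real_nonneg)
qed

lemma std_exp_AE_pos: "AE t in std_exp. t > 0"
proof -
  have "AE t::real in lborel. t \<noteq> 0" by (rule AE_lborel_singleton)
  then show ?thesis
    by (subst AE_density) (auto simp: exponential_density_def elim!: eventually_mono)
qed

lemma Polygamma_1_1: "Polygamma 1 (1::real) = pi\<^sup>2 / 6"
proof -
  have "Polygamma 1 (1::real) = (\<Sum>k. inverse ((1 + real k)\<^sup>2))"
    by (simp add: Polygamma_def numeral_2_eq_2)
  also have "\<dots> = (\<Sum>k. 1 / (real k + 1)\<^sup>2)" by (simp add: inverse_eq_divide add.commute)
  also have "\<dots> = pi\<^sup>2 / 6" using inverse_squares_sums by (simp add: sums_iff add.commute)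
  finally show ?thesis .
qed

text \<open>The limit is the second derivative of \<open>Gamma\<close> at \<open>1\<close>, namely
  \<open>(Digamma 1)\<^sup>2 + Polygamma 1 1\<close>. One application of l'Hopital turns the
  symmetric second difference into a symmetric difference quotient of the first derivative.\<close>

lemma Gamma_second_difference:
  "((\<lambda>h. (Gamma (1 + h) + Gamma (1 - h) - 2) / h\<^sup>2) \<longlongrightarrow> euler_mascheroni\<^sup>2 + pi\<^sup>2 / 6) (at_right (0::real))"
proof -
  define G' where "G' = (\<lambda>x::real. Gamma x * Digamma x)"
  have G: "(Gamma has_field_derivative G' x) (at x)" if "x > 0" for x :: real
    using that unfolding G'_def by (auto intro!: derivative_eq_intros)
  have "(G' has_field_derivative (Gamma 1 * Digamma 1) * Digamma 1 + Polygamma 1 1 * Gamma 1) (at (1::real))"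
    unfolding G'_def by (rule derivative_eq_intros refl | simp)+
  then have G2: "(G' has_field_derivative (euler_mascheroni\<^sup>2 + pi\<^sup>2 / 6)) (at 1)"
    by (simp add: Polygamma_1_1[unfolded One_nat_def] power2_eq_square)
  have q1: "((\<lambda>h. (G' (1 + h) - G' 1) / h) \<longlongrightarrow> euler_mascheroni\<^sup>2 + pi\<^sup>2 / 6) (at_right 0)"
    using G2 unfolding DERIV_def by (rule tendsto_mono[rotated]) (simp add: at_le)
  have "((\<lambda>h. G' (1 - h)) has_field_derivative (euler_mascheroni\<^sup>2 + pi\<^sup>2 / 6) * (-1)) (at 0)"
    by (rule DERIV_chain2[where f = G' and g = "\<lambda>h. 1 - h"]) (use G2 in \<open>auto intro!: derivative_eq_intros\<close>)
  then have q2: "((\<lambda>h. (G' (1 - h) - G' 1) / h) \<longlongrightarrow> - (euler_mascheroni\<^sup>2 + pi\<^sup>2 / 6)) (at_right 0)"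
    by (intro tendsto_mono[OF at_le[of "{0<..}" UNIV]]) (simp_all add: DERIV_def)
  have "((\<lambda>h. ((G' (1 + h) - G' 1) / h - (G' (1 - h) - G' 1) / h) / 2) \<longlongrightarrow>
      ((euler_mascheroni\<^sup>2 + pi\<^sup>2 / 6) - - (euler_mascheroni\<^sup>2 + pi\<^sup>2 / 6)) / 2) (at_right 0)"
    by (intro tendsto_intros q1 q2) auto
  then have q: "((\<lambda>h. (G' (1 + h) - G' (1 - h)) / (2 * h)) \<longlongrightarrow> euler_mascheroni\<^sup>2 + pi\<^sup>2 / 6) (at_right 0)"
    by (simp add: diff_divide_distrib[symmetric] mult.commute add_divide_distrib)
  show ?thesis
  proof (rule lhopital_right_0[OF _ _ _ _ _ _ q])
    have "((\<lambda>h. Gamma (1 + h) + Gamma (1 - h) - 2) \<longlongrightarrow> Gamma (1 + 0) + Gamma (1 - 0) - 2) (at_right (0::real))"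
      by (intro tendsto_intros) auto
    then show "((\<lambda>h. Gamma (1 + h) + Gamma (1 - h) - 2) \<longlongrightarrow> 0) (at_right (0::real))" by simp
    show "((\<lambda>h::real. h\<^sup>2) \<longlongrightarrow> 0) (at_right 0)" by (rule tendsto_eq_intros refl | simp)+
    show "\<forall>\<^sub>F x::real in at_right 0. x\<^sup>2 \<noteq> 0" "\<forall>\<^sub>F x::real in at_right 0. 2 * x \<noteq> 0"
      by (auto simp: eventually_at_right_field intro: exI[of _ 1])
    show "\<forall>\<^sub>F x in at_right 0. ((\<lambda>h. Gamma (1 + h) + Gamma (1 - h) - 2) has_real_derivative G' (1 + x) - G' (1 - x)) (at x)"
      unfolding eventually_at_right_field
    proof (intro exI[of _ 1] conjI allI impI)
      fix x :: real assume x: "0 < x" "x < 1"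
      have a: "((\<lambda>h. Gamma (1 + h)) has_field_derivative G' (1 + x) * 1) (at x)"
        by (rule DERIV_chain2[where f = Gamma and g = "\<lambda>h. 1 + h"]) (use x in \<open>auto intro!: G derivative_eq_intros\<close>)
      have b: "((\<lambda>h. Gamma (1 - h)) has_field_derivative G' (1 - x) * (-1)) (at x)"
        by (rule DERIV_chain2[where f = Gamma and g = "\<lambda>h. 1 - h"]) (use x in \<open>auto intro!: G derivative_eq_intros\<close>)
      show "((\<lambda>h. Gamma (1 + h) + Gamma (1 - h) - 2) has_real_derivative G' (1 + x) - G' (1 - x)) (at x)"
        using DERIV_diff[OF DERIV_add[OF a b] DERIV_const[of 2]] by simp
    qed simp
    show "\<forall>\<^sub>F x::real in at_right 0. ((\<lambda>h. h\<^sup>2) has_real_derivative 2 * x) (at x)"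
      by (auto intro!: always_eventually derivative_eq_intros)
  qed
qed

lemma Gamma_first_difference:
  "((\<lambda>h. (Gamma (1 + h) - 1) / h) \<longlongrightarrow> - euler_mascheroni) (at_right (0::real))"
proof -
  have "(Gamma has_field_derivative Gamma 1 * Digamma 1) (at (1::real))"
    by (auto intro!: derivative_eq_intros)
  then have "((\<lambda>h. (Gamma (1 + h) - 1) / h) \<longlongrightarrow> - euler_mascheroni) (at (0::real))"
    by (simp add: DERIV_def)
  then show ?thesis by (rule tendsto_mono[rotated]) (simp add: at_le)
qed

lemma abs_exp_minus_1_le: "\<bar>exp y - 1\<bar> \<le> \<bar>y\<bar> * exp \<bar>y\<bar>" for y :: real
proof (cases "y \<ge> 0")
  case True
  have "exp y * (1 + - y) \<le> exp y * exp (- y)" by (intro mult_left_mono exp_ge_add_one_self) auto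
  then show ?thesis using True by (simp add: algebra_simps exp_minus)
next
  case False
  have "1 - exp y \<le> - y" using exp_ge_add_one_self[of y] by linarith
  also have "\<dots> \<le> (- y) * exp (- y)" using False by (simp add: mult_le_cancel_left1)
  finally show ?thesis using False by simp
qed

lemma second_difference_exp_le: "exp y + exp (- y) - 2 \<le> y\<^sup>2 * exp \<bar>y\<bar>" for y :: real
proof -
  have "exp y + exp (- y) - 2 = (exp y - 1) * (1 - exp (- y))"
    by (simp add: algebra_simps exp_minus)
  also have "\<dots> = exp (- y) * (exp y - 1)\<^sup>2" by (simp add: power2_eq_square algebra_simps exp_minus)
  finally have a: "exp y + exp (- y) - 2 = exp (- y) * (exp y - 1)\<^sup>2" .
  have *: "exp z + exp (- z) - 2 \<le> z\<^sup>2 * exp z" if "z \<ge> 0" for z :: real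
  proof -
    have "exp z + exp (- z) - 2 = exp z * (1 - exp (- z))\<^sup>2"
      by (simp add: power2_eq_square field_simps exp_minus)
    also have "\<dots> \<le> exp z * z\<^sup>2"
      using exp_ge_add_one_self[of "- z"] that by (intro mult_left_mono power_mono) auto
    finally show ?thesis by (simp add: mult.commute)
  qed
  show ?thesis using *[of y] *[of "- y"] by (cases "y \<ge> 0") auto
qed

text \<open>Absorbs powers of the logarithm into a small exponential. Together with difference steps
  of size at most \<open>1 / 4\<close>, the total exponent stays at \<open>1 / 2\<close>, where the
  moments of the exponential law are finite in both directions.\<close>

lemma abs_le_exp_quarter: "\<bar>w\<bar> \<le> 4 * exp (\<bar>w\<bar> / 4)" "w\<^sup>2 \<le> 64 * exp (\<bar>w\<bar> / 4)" for w :: real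
proof -
  show "\<bar>w\<bar> \<le> 4 * exp (\<bar>w\<bar> / 4)" using exp_ge_add_one_self[of "\<bar>w\<bar> / 4"] by linarith
  have "(\<bar>w\<bar> / 8)\<^sup>2 \<le> (exp (\<bar>w\<bar> / 8))\<^sup>2" using exp_ge_add_one_self[of "\<bar>w\<bar> / 8"] by (intro power_mono) linarith+
  also have "(exp (\<bar>w\<bar> / 8))\<^sup>2 = exp (\<bar>w\<bar> / 4)" by (simp add: power2_eq_square flip: exp_add)
  finally show "w\<^sup>2 \<le> 64 * exp (\<bar>w\<bar> / 4)" by (simp add: power_divide)
qed

text \<open>
  The moments are the first two derivatives at \<open>1\<close> of \<open>Gamma (1 + h) = E (T powr h)\<close>, read off from
  difference quotients in \<open>h\<close> by dominated convergence.
\<close>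

lemma std_exp_ln_moments:
  shows "integrable std_exp (\<lambda>t. ln t)" "(\<integral>t. ln t \<partial>std_exp) = - euler_mascheroni"
    and "integrable std_exp (\<lambda>t. (ln t)\<^sup>2)" "(\<integral>t. (ln t)\<^sup>2 \<partial>std_exp) = euler_mascheroni\<^sup>2 + pi\<^sup>2 / 6"
proof -
  define h where "h = (\<lambda>n::nat. 1 / (real n + 4))"
  have h: "0 < h n" "h n \<le> 1 / 4" for n by (auto simp: h_def field_simps)
  have h0: "h \<longlonglongrightarrow> 0" unfolding h_def
    by (rule real_tendsto_divide_at_top[OF tendsto_const])
      (rule filterlim_at_top_mono[OF filterlim_real_sequentially], auto)
  have hr: "filterlim h (at_right 0) sequentially"
    using h h0 by (auto simp: filterlim_at intro!: always_eventually less_imp_neq[symmetric])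
  have h': "filterlim h (at 0) sequentially" using hr by (rule filterlim_mono) (auto simp: at_le)
  \<comment> \<open>Two powers, since \<open>\<bar>ln t\<bar>\<close> may come from large or from
    small \<open>t\<close>; both exponents exceed \<open>-1\<close>, so \<open>W\<close> is
    integrable.\<close>
  define W where "W = (\<lambda>t::real. t powr (1/2) + t powr (- 1/2))"
  have Wi: "integrable std_exp W" unfolding W_def
    by (intro Bochner_Integration.integrable_add std_exp_powr) auto
  have W: "exp (\<bar>ln t\<bar> / 2) \<le> W t" if "t > 0" for t
    using that by (auto simp: W_def powr_def abs_if)
  have pe: "t powr s = exp (s * ln t)" if "t > 0" for t s :: real using that by (simp add: powr_def)
  have d1: "\<bar>(t powr h n - 1) / h n\<bar> \<le> 4 * W t" if t: "t > 0" for t n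
  proof -
    have "\<bar>t powr h n - 1\<bar> \<le> \<bar>h n * ln t\<bar> * exp \<bar>h n * ln t\<bar>"
      unfolding pe[OF t] by (rule abs_exp_minus_1_le)
    then have "\<bar>(t powr h n - 1) / h n\<bar> \<le> \<bar>ln t\<bar> * exp (h n * \<bar>ln t\<bar>)"
      using h[of n] by (simp add: abs_mult field_simps)
    also have "\<dots> \<le> (4 * exp (\<bar>ln t\<bar> / 4)) * exp (\<bar>ln t\<bar> / 4)"
      using h[of n] mult_right_mono[OF h(2)[of n], of "\<bar>ln t\<bar>"] by (intro mult_mono abs_le_exp_quarter) auto
    also have "\<dots> = 4 * exp (\<bar>ln t\<bar> / 2)" by (simp flip: exp_add)
    also have "\<dots> \<le> 4 * W t" using W[OF t] by simp
    finally show ?thesis .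
  qed
  have l1: "(\<lambda>n. (t powr h n - 1) / h n) \<longlonglongrightarrow> ln t" if t: "t > 0" for t
  proof -
    have "((\<lambda>s. exp (s * ln t)) has_real_derivative ln t) (at 0)" by (auto intro!: derivative_eq_intros)
    then have "((\<lambda>k. (exp (k * ln t) - 1) / k) \<longlongrightarrow> ln t) (at 0)" by (simp add: DERIV_def)
    from filterlim_compose[OF this h'] show ?thesis by (simp add: pe[OF t])
  qed
  have d2: "\<bar>(t powr h n + t powr (- h n) - 2) / (h n)\<^sup>2\<bar> \<le> 64 * W t" if t: "t > 0" for t n
  proof -
    have nn: "0 \<le> exp y + exp (- y) - 2" for y :: real
    proof -
      have "exp y + exp (- y) - 2 = exp (- y) * (exp y - 1)\<^sup>2"
        by (simp add: power2_eq_square algebra_simps exp_minus)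
      then show ?thesis by simp
    qed
    have "t powr h n + t powr (- h n) - 2 \<le> (h n * ln t)\<^sup>2 * exp \<bar>h n * ln t\<bar>"
      unfolding pe[OF t] using second_difference_exp_le[of "h n * ln t"] by simp
    then have "(t powr h n + t powr (- h n) - 2) / (h n)\<^sup>2 \<le> (ln t)\<^sup>2 * exp (h n * \<bar>ln t\<bar>)"
      using h[of n] by (simp add: abs_mult field_simps power_mult_distrib)
    also have "\<dots> \<le> (64 * exp (\<bar>ln t\<bar> / 4)) * exp (\<bar>ln t\<bar> / 4)"
      using h[of n] mult_right_mono[OF h(2)[of n], of "\<bar>ln t\<bar>"] by (intro mult_mono abs_le_exp_quarter) auto
    also have "\<dots> = 64 * exp (\<bar>ln t\<bar> / 2)" by (simp flip: exp_add)
    also have "\<dots> \<le> 64 * W t" using W[OF t] by simp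
    finally have "(t powr h n + t powr (- h n) - 2) / (h n)\<^sup>2 \<le> 64 * W t" .
    moreover have "0 \<le> (t powr h n + t powr (- h n) - 2) / (h n)\<^sup>2"
      using nn[of "h n * ln t"] by (intro divide_nonneg_nonneg) (auto simp: pe[OF t])
    ultimately show ?thesis by simp
  qed
  have l2: "(\<lambda>n. (t powr h n + t powr (- h n) - 2) / (h n)\<^sup>2) \<longlonglongrightarrow> (ln t)\<^sup>2" if t: "t > 0" for t
  proof -
    have a: "((\<lambda>s. exp (s * (c::real))) has_real_derivative c) (at 0)" for c by (auto intro!: derivative_eq_intros)
    have b: "(\<lambda>n. (exp (h n * c) - 1) / h n) \<longlonglongrightarrow> c" for c
      using filterlim_compose[OF a[of c, unfolded DERIV_def] h'] by simp
    \<comment> \<open>The identity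
      \<open>exp y + exp (- y) - 2 = exp (- y) * (exp y - 1)\<^sup>2\<close> reduces the second
      difference to the square of a first difference quotient.\<close>
    have "(\<lambda>n. exp (- (h n * ln t)) * ((exp (h n * ln t) - 1) / h n)\<^sup>2) \<longlonglongrightarrow> exp (- (0 * ln t)) * (ln t)\<^sup>2"
      by (intro tendsto_intros b h0)
    moreover have "exp (- (h n * ln t)) * ((exp (h n * ln t) - 1) / h n)\<^sup>2 = (t powr h n + t powr (- h n) - 2) / (h n)\<^sup>2" for n
      by (simp add: pe[OF t] power2_eq_square algebra_simps exp_minus add_divide_distrib diff_divide_distrib)
    ultimately show ?thesis by simp
  qed
  have i1: "integrable std_exp (\<lambda>t. ln t)"
    by (rule integrable_dominated_convergence[where w = "\<lambda>t. 4 * W t" and s = "\<lambda>n t. (t powr h n - 1) / h n"]; use std_exp_AE_pos Wi in \<open>auto elim!: eventually_mono intro: l1 d1[unfolded abs_divide]\<close>)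
  have i1': "(\<lambda>n. \<integral>t. (t powr h n - 1) / h n \<partial>std_exp) \<longlonglongrightarrow> (\<integral>t. ln t \<partial>std_exp)"
    by (rule integral_dominated_convergence[where w = "\<lambda>t. 4 * W t"]; use std_exp_AE_pos Wi in \<open>auto elim!: eventually_mono intro: l1 d1[unfolded abs_divide]\<close>)
  have i2: "integrable std_exp (\<lambda>t. (ln t)\<^sup>2)"
    by (rule integrable_dominated_convergence[where w = "\<lambda>t. 64 * W t" and s = "\<lambda>n t. (t powr h n + t powr (- h n) - 2) / (h n)\<^sup>2"]; use std_exp_AE_pos Wi in \<open>auto elim!: eventually_mono intro: l2 d2[unfolded abs_divide power2_abs abs_power2]\<close>)
  have i2': "(\<lambda>n. \<integral>t. (t powr h n + t powr (- h n) - 2) / (h n)\<^sup>2 \<partial>std_exp) \<longlonglongrightarrow> (\<integral>t. (ln t)\<^sup>2 \<partial>std_exp)"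
    by (rule integral_dominated_convergence[where w = "\<lambda>t. 64 * W t"]; use std_exp_AE_pos Wi in \<open>auto elim!: eventually_mono intro: l2 d2[unfolded abs_divide power2_abs abs_power2]\<close>)
  interpret prob_space std_exp by (rule prob_space_exponential_density) simp
  have hm: "h n > -1" "- h n > - 1" for n using h[of n] by auto
  note ip = std_exp_powr(1)[OF hm(1)] std_exp_powr(1)[OF hm(2)]
  have "(\<integral>t. (t powr h n - 1) / h n \<partial>std_exp) = (Gamma (1 + h n) - 1) / h n" for n
    using ip std_exp_powr(2)[OF hm(1)] prob_space by simp
  note i1'[unfolded this]
  moreover have "(\<lambda>n. (Gamma (1 + h n) - 1) / h n) \<longlonglongrightarrow> - euler_mascheroni"
    using filterlim_compose[OF Gamma_first_difference hr] .
  ultimately show "(\<integral>t. ln t \<partial>std_exp) = - euler_mascheroni" by (rule LIMSEQ_unique)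
  have "(\<integral>t. (t powr h n + t powr (- h n) - 2) / (h n)\<^sup>2 \<partial>std_exp) = (Gamma (1 + h n) + Gamma (1 - h n) - 2) / (h n)\<^sup>2" for n
    using ip std_exp_powr(2)[OF hm(1)] std_exp_powr(2)[OF hm(2)] prob_space by simp
  note i2'[unfolded this]
  moreover have "(\<lambda>n. (Gamma (1 + h n) + Gamma (1 - h n) - 2) / (h n)\<^sup>2) \<longlonglongrightarrow> euler_mascheroni\<^sup>2 + pi\<^sup>2 / 6"
    using filterlim_compose[OF Gamma_second_difference hr] .
  ultimately show "(\<integral>t. (ln t)\<^sup>2 \<partial>std_exp) = euler_mascheroni\<^sup>2 + pi\<^sup>2 / 6" by (rule LIMSEQ_unique)
  show "integrable std_exp (\<lambda>t. ln t)" "integrable std_exp (\<lambda>t. (ln t)\<^sup>2)" by (fact i1 i2)+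
qed

lemma std_exp_tail: "a \<ge> 0 \<Longrightarrow> emeasure std_exp {a<..} = ennreal (exp (- a))"
proof -
  assume a: "a \<ge> 0"
  interpret prob_space std_exp by (rule prob_space_exponential_density) simp
  have "distributed std_exp lborel (\<lambda>x. x) (exponential_density 1)"
    by (auto simp: distributed_def distr_id2 intro!: distr_id2)
  from exponential_distributedD_gt[OF this a] show ?thesis
    by (simp add: emeasure_eq_measure greaterThan_def)
qed

text \<open>Realises the limit law on a concrete product space. For fixed \<open>x\<close>, with
  \<open>c = ln (f x)\<close>, the variable \<open>ln t + euler_mascheroni - c\<close> has mean
  \<open>- c\<close> and second moment \<open>pi\<^sup>2 / 6 + c\<^sup>2\<close>; Fubini then gives
  the variance. The tail comes from the exponential tail at
  \<open>f x * exp (u - euler_mascheroni)\<close>.\<close>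

lemma gumbel_mixture:
  fixes D :: "'a::euclidean_space measure" and f :: "'a \<Rightarrow> real"
  defines "L \<equiv> \<lambda>(x, t). ln t + euler_mascheroni - ln (f x)"
  assumes D: "prob_space D" and sets [measurable_cong]: "sets D = sets borel"
    and f [measurable]: "f \<in> borel_measurable borel" and fpos: "AE x in D. f x > 0"
    and ln2: "integrable D (\<lambda>x. (ln (f x))\<^sup>2)"
  shows "prob_space (D \<Otimes>\<^sub>M std_exp)" "L \<in> borel_measurable (D \<Otimes>\<^sub>M std_exp)"
    and "integrable (D \<Otimes>\<^sub>M std_exp) (\<lambda>q. (L q)\<^sup>2)"
    and "(\<integral>q. (L q)\<^sup>2 \<partial>(D \<Otimes>\<^sub>M std_exp)) - (\<integral>q. L q \<partial>(D \<Otimes>\<^sub>M std_exp))\<^sup>2 =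
           pi\<^sup>2 / 6 + ((\<integral>x. (ln (f x))\<^sup>2 \<partial>D) - (\<integral>x. ln (f x) \<partial>D)\<^sup>2)"
    and "measure (D \<Otimes>\<^sub>M std_exp) {q \<in> space (D \<Otimes>\<^sub>M std_exp). L q > u} =
           (\<integral>x. exp (- (f x * exp (u - euler_mascheroni))) \<partial>D)"
proof -
  interpret D: prob_space D by (rule D)
  interpret E: prob_space std_exp by (rule prob_space_exponential_density) simp
  interpret P: pair_prob_space D std_exp ..
  show "prob_space (D \<Otimes>\<^sub>M std_exp)" by unfold_locales
  show L [measurable]: "L \<in> borel_measurable (D \<Otimes>\<^sub>M std_exp)" unfolding L_def by measurable
  have lnf: "integrable D (\<lambda>x. ln (f x))" by (rule D.square_integrable_imp_integrable) (use ln2 in auto)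
  note [simp] = std_exp_ln_moments
  have i2: "integrable std_exp (\<lambda>t. (ln t + euler_mascheroni - c)\<^sup>2)"
    and e2: "(\<integral>t. (ln t + euler_mascheroni - c)\<^sup>2 \<partial>std_exp) = pi\<^sup>2 / 6 + c\<^sup>2" for c
  proof -
    have *: "(ln t + euler_mascheroni - c)\<^sup>2 = (ln t)\<^sup>2 + 2 * (euler_mascheroni - c) * ln t + (euler_mascheroni - c)\<^sup>2" for t
      by (simp add: power2_eq_square algebra_simps)
    show "integrable std_exp (\<lambda>t. (ln t + euler_mascheroni - c)\<^sup>2)" unfolding * by simp
    have "(\<integral>t. (ln t + euler_mascheroni - c)\<^sup>2 \<partial>std_exp)
        = (euler_mascheroni\<^sup>2 + pi\<^sup>2 / 6) + 2 * (euler_mascheroni - c) * (- euler_mascheroni) + (euler_mascheroni - c)\<^sup>2"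
      unfolding * using E.prob_space by simp
    then show "(\<integral>t. (ln t + euler_mascheroni - c)\<^sup>2 \<partial>std_exp) = pi\<^sup>2 / 6 + c\<^sup>2"
      by (simp add: power2_eq_square algebra_simps)
  qed
  show I2: "integrable (D \<Otimes>\<^sub>M std_exp) (\<lambda>q. (L q)\<^sup>2)"
  proof (rule P.Fubini_integrable)
    show "integrable D (\<lambda>x. \<integral>y. norm ((L (x, y))\<^sup>2) \<partial>std_exp)"
      using ln2 by (simp add: L_def e2)
    show "AE x in D. integrable std_exp (\<lambda>y. (L (x, y))\<^sup>2)" using i2 by (simp add: L_def)
  qed simp
  have I1: "integrable (D \<Otimes>\<^sub>M std_exp) L" by (rule P.square_integrable_imp_integrable) (use I2 in auto)
  have "(\<integral>q. (L q)\<^sup>2 \<partial>(D \<Otimes>\<^sub>M std_exp)) = (\<integral>x. \<integral>y. (L (x, y))\<^sup>2 \<partial>std_exp \<partial>D)"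
    using P.integral_fst'[OF I2] by simp
  also have "\<dots> = pi\<^sup>2 / 6 + (\<integral>x. (ln (f x))\<^sup>2 \<partial>D)"
    using ln2 D.prob_space by (simp add: L_def e2)
  finally have A: "(\<integral>q. (L q)\<^sup>2 \<partial>(D \<Otimes>\<^sub>M std_exp)) = pi\<^sup>2 / 6 + (\<integral>x. (ln (f x))\<^sup>2 \<partial>D)" .
  have "(\<integral>q. L q \<partial>(D \<Otimes>\<^sub>M std_exp)) = (\<integral>x. \<integral>y. L (x, y) \<partial>std_exp \<partial>D)"
    using P.integral_fst'[OF I1] by simp
  also have "\<dots> = - (\<integral>x. ln (f x) \<partial>D)"
    using lnf D.prob_space E.prob_space by (simp add: L_def)
  finally have B: "(\<integral>q. L q \<partial>(D \<Otimes>\<^sub>M std_exp)) = - (\<integral>x. ln (f x) \<partial>D)" .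
  show "(\<integral>q. (L q)\<^sup>2 \<partial>(D \<Otimes>\<^sub>M std_exp)) - (\<integral>q. L q \<partial>(D \<Otimes>\<^sub>M std_exp))\<^sup>2 =
           pi\<^sup>2 / 6 + ((\<integral>x. (ln (f x))\<^sup>2 \<partial>D) - (\<integral>x. ln (f x) \<partial>D)\<^sup>2)"
    by (simp add: A B)
  let ?S = "{q \<in> space (D \<Otimes>\<^sub>M std_exp). L q > u}"
  have S: "?S \<in> sets (D \<Otimes>\<^sub>M std_exp)" by measurable
  have "emeasure (D \<Otimes>\<^sub>M std_exp) ?S = (\<integral>\<^sup>+x. emeasure std_exp (Pair x -` ?S) \<partial>D)"
    by (rule E.emeasure_pair_measure_alt[OF S])
  also have "\<dots> = (\<integral>\<^sup>+x. ennreal (exp (- (f x * exp (u - euler_mascheroni)))) \<partial>D)"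
  proof (rule nn_integral_cong_AE, use fpos in eventually_elim)
    case (elim x)
    have spD: "space D = UNIV" using sets_eq_imp_space_eq[OF sets] by simp
    have iff: "ln t + euler_mascheroni - ln (f x) > u \<longleftrightarrow> t > f x * exp (u - euler_mascheroni)" if "t > 0" for t
    proof -
      have "ln t + euler_mascheroni - ln (f x) > u \<longleftrightarrow> ln t > ln (f x * exp (u - euler_mascheroni))"
        using elim by (simp add: ln_mult algebra_simps)
      also have "\<dots> \<longleftrightarrow> t > f x * exp (u - euler_mascheroni)" using that elim by (subst ln_less_cancel_iff) auto
      finally show ?thesis .
    qed
    have "emeasure std_exp (Pair x -` ?S) = emeasure std_exp {f x * exp (u - euler_mascheroni)<..}"
    proof (rule emeasure_eq_AE)
      show "AE t in std_exp. (t \<in> Pair x -` ?S) = (t \<in> {f x * exp (u - euler_mascheroni)<..})"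
        using std_exp_AE_pos by eventually_elim (auto simp: space_pair_measure spD L_def iff)
      show "Pair x -` ?S \<in> sets std_exp" using S by (rule sets_Pair1)
    qed auto
    also have "\<dots> = ennreal (exp (- (f x * exp (u - euler_mascheroni))))"
      using elim by (intro std_exp_tail) auto
    finally show ?case .
  qed
  also have "\<dots> = ennreal (\<integral>x. exp (- (f x * exp (u - euler_mascheroni))) \<partial>D)"
  proof (rule nn_integral_eq_integral)
    show "integrable D (\<lambda>x. exp (- (f x * exp (u - euler_mascheroni))))"
      by (rule D.integrable_const_bound[where B = 1]) (use fpos in \<open>auto elim!: eventually_mono\<close>)
  qed simp
  finally show "measure (D \<Otimes>\<^sub>M std_exp) ?S = (\<integral>x. exp (- (f x * exp (u - euler_mascheroni))) \<partial>D)"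
    by (simp add: measure_def integral_nonneg_AE)
qed

section \<open>Nearest neighbours in an i.i.d. sample\<close>

locale iid_sample = prob_space P for P :: "'w measure" +
  fixes Xs :: "nat \<Rightarrow> 'w \<Rightarrow> 'a::euclidean_space" and D :: "'a measure"
  assumes D_prob: "prob_space D" and sets_D [measurable_cong, simp]: "sets D = sets borel"
    and indep: "indep_vars (\<lambda>_. borel) Xs {1..}"
    and law: "\<And>i. i \<ge> 1 \<Longrightarrow> distr P borel (Xs i) = D"
begin

sublocale D: prob_space D by (rule D_prob)

lemma Xs_measurable [measurable]: "i \<ge> 1 \<Longrightarrow> Xs i \<in> borel_measurable P"
  using indep unfolding indep_vars_def by auto

lemma space_D [simp]: "space D = UNIV"
  using sets_eq_imp_space_eq[OF sets_D] by simp

lemma distr_sample: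
  assumes "N \<ge> 1"
  shows "distr P (\<Pi>\<^sub>M i\<in>{1..N}. borel) (\<lambda>\<omega>. \<lambda>i\<in>{1..N}. Xs i \<omega>) = (\<Pi>\<^sub>M i\<in>{1..N}. D)"
proof -
  have "indep_vars (\<lambda>_. borel) Xs {1..N}" using indep by (rule indep_vars_subset) auto
  then have "distr P (\<Pi>\<^sub>M i\<in>{1..N}. borel) (\<lambda>\<omega>. \<lambda>i\<in>{1..N}. Xs i \<omega>) = (\<Pi>\<^sub>M i\<in>{1..N}. distr P borel (Xs i))"
    using assms by (subst (asm) indep_vars_iff_distr_eq_PiM') auto
  also have "\<dots> = (\<Pi>\<^sub>M i\<in>{1..N}. D)" by (intro PiM_cong) (auto simp: law)
  finally show ?thesis .
qed

text \<open>Given two of the points, the remaining \<open>N - 2\<close> are independent with law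
  \<open>D\<close>, so the product integrates factor by factor. The weight \<open>h\<close> allows
  one formula to serve for void probabilities as well as for moments of the distance between the two
  chosen points.\<close>

lemma nn_integral_two_point:
  fixes h :: "'a \<Rightarrow> 'a \<Rightarrow> ennreal" and \<phi> :: "'a \<Rightarrow> 'a \<Rightarrow> 'a \<Rightarrow> ennreal"
  assumes ij: "i \<in> {1..N}" "j \<in> {1..N}" "i \<noteq> j"
    and h [measurable]: "case_prod h \<in> borel_measurable (borel \<Otimes>\<^sub>M borel)"
    and \<phi> [measurable]: "(\<lambda>(x, y, z). \<phi> x y z) \<in> borel_measurable (borel \<Otimes>\<^sub>M borel \<Otimes>\<^sub>M borel)"
  shows "(\<integral>\<^sup>+\<omega>. h (Xs i \<omega>) (Xs j \<omega>) * (\<Prod>k\<in>{1..N} - {i, j}. \<phi> (Xs i \<omega>) (Xs j \<omega>) (Xs k \<omega>)) \<partial>P)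
     = (\<integral>\<^sup>+x. \<integral>\<^sup>+y. h x y * (\<integral>\<^sup>+z. \<phi> x y z \<partial>D) ^ (N - 2) \<partial>D \<partial>D)"
proof -
  interpret PD: product_sigma_finite "\<lambda>_::nat. D"
    by standard
  define S where "S = {1..N} - {i, j}"
  have S: "finite S" "i \<notin> insert j S" "j \<notin> S" "insert i (insert j S) = {1..N}" "card S = N - 2"
    using ij by (auto simp: S_def card_Diff_subset)
  let ?DjS = "\<Pi>\<^sub>M i\<in>insert j S. D"
  let ?B = "\<Pi>\<^sub>M i\<in>{1..N}. borel :: 'a measure"
  let ?G = "\<lambda>x y. h x y * (\<integral>\<^sup>+z. \<phi> x y z \<partial>D) ^ (N - 2)"
  let ?F = "\<lambda>x. h (x i) (x j) * (\<Prod>k\<in>S. \<phi> (x i) (x j) (x k))"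
  have N: "N \<ge> 1" using ij by auto
  have comp: "(\<lambda>x. x k) \<in> borel_measurable ?B" if "k \<in> {1..N}" for k
    using that by (rule measurable_component_singleton)
  have Sk: "k \<in> {1..N}" if "k \<in> S" for k using that by (simp add: S_def)
  note [measurable] = comp[OF ij(1)] comp[OF ij(2)] comp[OF Sk]
  have hF: "(\<lambda>x. h (x i) (x j)) \<in> borel_measurable ?B"
    using measurable_compose[OF measurable_Pair[OF comp[OF ij(1)] comp[OF ij(2)]] h] by simp
  have pF: "(\<lambda>x. \<phi> (x i) (x j) (x k)) \<in> borel_measurable ?B" if "k \<in> S" for k
    using measurable_compose[OF measurable_Pair[OF comp[OF ij(1)] measurable_Pair[OF comp[OF ij(2)] comp[OF Sk[OF that]]]] \<phi>] by simp
  have F: "?F \<in> borel_measurable ?B"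
    by (intro borel_measurable_times_ennreal hF borel_measurable_prod_ennreal pF)
  have T: "(\<lambda>\<omega>. \<lambda>i\<in>{1..N}. Xs i \<omega>) \<in> measurable P ?B"
    by (intro measurable_restrict Xs_measurable) auto
  have F': "?F \<in> borel_measurable (\<Pi>\<^sub>M i\<in>{1..N}. D)"
    using F by (simp cong: measurable_cong_sets sets_PiM_cong)
  have "(\<integral>\<^sup>+\<omega>. h (Xs i \<omega>) (Xs j \<omega>) * (\<Prod>k\<in>{1..N} - {i, j}. \<phi> (Xs i \<omega>) (Xs j \<omega>) (Xs k \<omega>)) \<partial>P)
     = (\<integral>\<^sup>+\<omega>. ?F (\<lambda>i\<in>{1..N}. Xs i \<omega>) \<partial>P)"
    using ij by (intro nn_integral_cong arg_cong2[where f = "(*)"] prod.cong) (auto simp: S_def)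
  also have "\<dots> = (\<integral>\<^sup>+x. ?F x \<partial>distr P ?B (\<lambda>\<omega>. \<lambda>i\<in>{1..N}. Xs i \<omega>))"
    by (rule nn_integral_distr[symmetric, OF T]) (use F in simp)
  also have "\<dots> = (\<integral>\<^sup>+x. ?F x \<partial>(\<Pi>\<^sub>M i\<in>{1..N}. D))" by (simp only: distr_sample[OF N])
  also have "\<dots> = (\<integral>\<^sup>+x. \<integral>\<^sup>+w. ?F (w(i := x)) \<partial>?DjS \<partial>D)"
    using PD.product_nn_integral_insert_rev[of "insert j S" i ?F] F' S by auto
  also have "\<dots> = (\<integral>\<^sup>+x. \<integral>\<^sup>+y. ?G x y \<partial>D \<partial>D)"
  proof (rule nn_integral_cong)
    fix x
    have "(\<lambda>w. w(i := x)) \<in> measurable ?DjS (\<Pi>\<^sub>M i\<in>insert i (insert j S). D)"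
      by (rule measurable_fun_upd[where J = "insert j S"]) auto
    then have Fx: "(\<lambda>w. ?F (w(i := x))) \<in> borel_measurable ?DjS"
      using F' unfolding S(4) by (rule measurable_compose)
    have "(\<integral>\<^sup>+w. ?F (w(i := x)) \<partial>?DjS) =
        (\<integral>\<^sup>+y. \<integral>\<^sup>+w. ?F ((w(j := y))(i := x)) \<partial>(\<Pi>\<^sub>M i\<in>S. D) \<partial>D)"
      using S Fx by (intro PD.product_nn_integral_insert_rev) auto
    also have "\<dots> = (\<integral>\<^sup>+y. ?G x y \<partial>D)"
    proof (rule nn_integral_cong)
      fix y
      have pz: "\<phi> x y \<in> borel_measurable D"
        using measurable_compose[OF measurable_Pair[OF measurable_const[of x] measurable_Pair[OF measurable_const[of y] measurable_ident]] \<phi>]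
        by (simp cong: measurable_cong_sets)
      have "(\<integral>\<^sup>+w. ?F ((w(j := y))(i := x)) \<partial>(\<Pi>\<^sub>M i\<in>S. D)) = (\<integral>\<^sup>+w. h x y * (\<Prod>k\<in>S. \<phi> x y (w k)) \<partial>(\<Pi>\<^sub>M i\<in>S. D))"
        using ij S by (intro nn_integral_cong arg_cong2[where f = "(*)"] prod.cong) auto
      also have "\<dots> = h x y * (\<integral>\<^sup>+w. (\<Prod>k\<in>S. \<phi> x y (w k)) \<partial>(\<Pi>\<^sub>M i\<in>S. D))"
        using pz by (intro nn_integral_cmult borel_measurable_prod_ennreal) (auto intro: measurable_compose[OF measurable_component_singleton])
      also have "\<dots> = ?G x y"
        using S pz by (subst PD.product_nn_integral_prod) auto
      finally show "(\<integral>\<^sup>+w. ?F ((w(j := y))(i := x)) \<partial>(\<Pi>\<^sub>M i\<in>S. D)) = ?G x y" .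
    qed
    finally show "(\<integral>\<^sup>+w. ?F (w(i := x)) \<partial>?DjS) = (\<integral>\<^sup>+y. ?G x y \<partial>D)" .
  qed
  finally show ?thesis .
qed

end

section \<open>Elementary estimates for nearest-neighbour events\<close>

lemma nn_dist_greater_iff:
  assumes "N \<ge> 2" "i \<in> {1..N}"
  shows "nn_dist N x i > r \<longleftrightarrow> (\<forall>j\<in>{1..N} - {i}. dist (x i) (x j) > r)"
proof -
  have "{1..N} - {i} \<noteq> {}"
  proof
    assume "{1..N} - {i} = {}"
    then have "{1..N} \<subseteq> {i}" by blast
    from subsetD[OF this, of 1] subsetD[OF this, of 2] show False using assms by auto
  qed
  then show ?thesis unfolding nn_dist_def by (subst Min_gr_iff) auto
qed

lemma nn_dist_le:
  assumes "j \<in> {1..N}" "j \<noteq> i"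
  shows "nn_dist N x i \<le> dist (x i) (x j)"
  using assms unfolding nn_dist_def by (intro Min_le) auto

text \<open>Write the power as \<open>exp (e n - m n * p n)\<close>. The Taylor remainder of the
  logarithm makes \<open>e n\<close> of order \<open>m n * (p n)\<^sup>2\<close>, which vanishes
  because \<open>m n * p n\<close> is bounded and \<open>p n\<close> tends to
  \<open>0\<close>.\<close>

lemma power_one_minus_tendsto:
  fixes p :: "nat \<Rightarrow> real"
  assumes p: "\<And>n. 0 \<le> p n" "p \<longlonglongrightarrow> 0" and lim: "(\<lambda>n. real (m n) * p n) \<longlonglongrightarrow> l"
  shows "(\<lambda>n. (1 - p n) ^ m n) \<longlonglongrightarrow> exp (- l)"
proof -
  define e where "e = (\<lambda>n. real (m n) * (ln (1 - p n) + p n))"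
  have half: "\<forall>\<^sub>F n in sequentially. p n < 1 / 2" by (rule order_tendstoD(2)[OF p(2)]) simp
  have "(\<lambda>n. 2 * (real (m n) * p n) * p n) \<longlonglongrightarrow> 2 * l * 0" by (intro tendsto_intros lim p)
  moreover have "\<forall>\<^sub>F n in sequentially. norm (e n) \<le> 2 * (real (m n) * p n) * p n"
    using half
  proof eventually_elim
    case (elim n)
    have "\<bar>ln (1 + - p n) - - p n\<bar> \<le> 2 * (- p n)\<^sup>2"
      by (rule abs_ln_one_plus_x_minus_x_bound) (use elim p(1)[of n] in auto)
    then have "\<bar>ln (1 - p n) + p n\<bar> \<le> 2 * (p n)\<^sup>2" by simp
    then have "real (m n) * \<bar>ln (1 - p n) + p n\<bar> \<le> real (m n) * (2 * (p n)\<^sup>2)" by (intro mult_left_mono) auto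
    then show ?case by (simp add: e_def abs_mult power2_eq_square mult_ac)
  qed
  ultimately have "e \<longlonglongrightarrow> 0"
    by (intro Lim_null_comparison[where f = e]) simp_all
  then have "(\<lambda>n. exp (e n - real (m n) * p n)) \<longlonglongrightarrow> exp (0 - l)" by (intro tendsto_intros lim)
  moreover have "\<forall>\<^sub>F n in sequentially. exp (e n - real (m n) * p n) = (1 - p n) ^ m n"
    using half
  proof eventually_elim
    case (elim n)
    have "exp (e n - real (m n) * p n) = exp (real (m n) * ln (1 - p n))" by (simp add: e_def algebra_simps)
    also have "\<dots> = (1 - p n) ^ m n" using elim by (subst exp_of_nat_mult) simp
    finally show ?case .
  qed
  ultimately show ?thesis using tendsto_cong by force
qed

text \<open>Raise \<open>s / \<epsilon> \<le> exp (s / \<epsilon>)\<close> to the power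
  \<open>\<epsilon>\<close>. This converts exponentially small void probabilities into negative
  powers of ball masses, the quantities that \<open>T_fun\<close> controls.\<close>

lemma exp_neg_le_powr:
  fixes s \<epsilon> :: real
  assumes "s > 0" "\<epsilon> > 0"
  shows "exp (- s) \<le> \<epsilon> powr \<epsilon> * s powr (- \<epsilon>)"
proof -
  have "s / \<epsilon> \<le> exp (s / \<epsilon>)" using exp_ge_add_one_self[of "s / \<epsilon>"] by linarith
  then have "(s / \<epsilon>) powr \<epsilon> \<le> exp (s / \<epsilon>) powr \<epsilon>" using assms by (intro powr_mono2) auto
  also have "\<dots> = exp s" using assms by (simp add: powr_def)
  finally have "s powr \<epsilon> / \<epsilon> powr \<epsilon> \<le> exp s" using assms by (simp add: powr_divide)
  then show ?thesis using assms by (simp add: exp_minus powr_minus field_simps)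
qed

lemma one_minus_power_le_powr:
  fixes p \<epsilon> :: real
  assumes "0 < p" "p \<le> 1" "\<epsilon> > 0" "n > 0"
  shows "(1 - p) ^ n \<le> \<epsilon> powr \<epsilon> * (real n * p) powr (- \<epsilon>)"
proof -
  have "(1 - p) ^ n \<le> exp (- p) ^ n"
    using assms exp_ge_add_one_self[of "- p"] by (intro power_mono) auto
  also have "\<dots> = exp (- (real n * p))" by (simp add: exp_of_nat_mult[symmetric])
  also have "\<dots> \<le> \<epsilon> powr \<epsilon> * (real n * p) powr (- \<epsilon>)" using assms by (intro exp_neg_le_powr) auto
  finally show ?thesis .
qed

text \<open>Interpolates between the trivial bound \<open>1\<close> and Bernoulli's bound
  \<open>n * p\<close>: the power \<open>\<delta>\<close> of \<open>n * p\<close> lies above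
  whichever of the two applies because \<open>\<delta> \<le> 1\<close>. It produces the positive
  powers of ball masses that \<open>Q_fun\<close> controls.\<close>

lemma one_minus_one_minus_power_le_powr:
  fixes p \<delta> :: real
  assumes "0 \<le> p" "p \<le> 1" "0 < \<delta>" "\<delta> \<le> 1" "n > 0"
  shows "1 - (1 - p) ^ n \<le> (real n * p) powr \<delta>"
proof (cases "real n * p \<ge> 1")
  case True
  have "1 - (1 - p) ^ n \<le> 1" using assms by simp
  also have "\<dots> \<le> (real n * p) powr \<delta>" using True assms by (intro ge_one_powr_ge_zero) auto
  finally show ?thesis .
next
  case False
  have "1 - (1 - p) ^ n \<le> real n * p"
    using Bernoulli_inequality[of "- p" n] assms by simp
  also have "\<dots> \<le> (real n * p) powr \<delta>"
  proof (cases "p = 0")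
    case False
    then have "(real n * p) powr 1 \<le> (real n * p) powr \<delta>"
      using assms \<open>\<not> real n * p \<ge> 1\<close> by (intro powr_mono') auto
    then show ?thesis using assms by simp
  qed simp
  finally show ?thesis .
qed

section \<open>Exact void probabilities around one and two sample points\<close>

context iid_sample
begin

text \<open>Closed balls, because the complement is then exactly the event that another point has
  distance greater than \<open>r\<close>.\<close>

definition pball :: "real \<Rightarrow> 'a \<Rightarrow> real" where
  "pball r x = measure D (cball x r)"

abbreviation (input) "pball2 r x y \<equiv> measure D (cball x r \<union> cball y r)"

lemma pball_bounds [simp]: "0 \<le> pball r x" "pball r x \<le> 1"
  by (auto simp: pball_def)

lemma pball_measurable [measurable]: "pball r \<in> borel_measurable borel"
proof -
  let ?S = "{z \<in> space (borel \<Otimes>\<^sub>M borel). dist (fst z) (snd z) \<le> r} :: ('a \<times> 'a) set"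
  have "(\<lambda>x. emeasure D (Pair x -` ?S)) \<in> borel_measurable borel"
    by (rule D.measurable_emeasure_Pair) measurable
  moreover have "Pair x -` ?S = cball x r" for x
    by (auto simp: space_pair_measure)
  ultimately have "(\<lambda>x. emeasure D (cball x r)) \<in> borel_measurable borel" by (simp only:)
  then show ?thesis unfolding pball_def[abs_def] measure_def by (rule measurable_compose) simp
qed

lemma nn_integral_outside:
  "(\<integral>\<^sup>+z. ennreal (of_bool (dist x z > r)) \<partial>D) = ennreal (1 - pball r x)"
proof -
  have "(\<integral>\<^sup>+z. ennreal (of_bool (dist x z > r)) \<partial>D) = (\<integral>\<^sup>+z. indicator (space D - cball x r) z \<partial>D)"
    by (intro nn_integral_cong) (auto split: split_indicator)
  also have "\<dots> = emeasure D (space D - cball x r)" by (intro nn_integral_indicator) auto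
  also have "\<dots> = ennreal (1 - pball r x)"
    by (subst D.emeasure_eq_measure, subst D.prob_compl) (auto simp: pball_def)
  finally show ?thesis .
qed

text \<open>The point \<open>X\<^sub>j\<close> is kept out of the void condition so that it can
  carry a weight: an indicator gives the void probability, a power of the log distance gives the
  moment bound for isolated points.\<close>

lemma nn_integral_nn_dist:
  assumes N: "N \<ge> 2" "i \<in> {1..N}" "j \<in> {1..N}" "i \<noteq> j"
    and h [measurable]: "case_prod h \<in> borel_measurable (borel \<Otimes>\<^sub>M borel)"
  shows "(\<integral>\<^sup>+\<omega>. h (Xs i \<omega>) (Xs j \<omega>) * of_bool (\<forall>k\<in>{1..N} - {i, j}. dist (Xs i \<omega>) (Xs k \<omega>) > r) \<partial>P)
     = (\<integral>\<^sup>+x. (\<integral>\<^sup>+y. h x y \<partial>D) * ennreal ((1 - pball r x) ^ (N - 2)) \<partial>D)"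
proof -
  have [simp]: "of_bool (\<forall>k\<in>S. Q k) = (\<Prod>k\<in>S. ennreal (of_bool (Q k)))" if "finite S" for S :: "nat set" and Q
    using that by (induction S rule: finite_induct) auto
  have hx: "h x \<in> borel_measurable D" for x
    using measurable_compose[OF measurable_Pair[OF measurable_const[of x] measurable_ident] h]
    by (simp cong: measurable_cong_sets)
  have "(\<integral>\<^sup>+\<omega>. h (Xs i \<omega>) (Xs j \<omega>) * of_bool (\<forall>k\<in>{1..N} - {i, j}. dist (Xs i \<omega>) (Xs k \<omega>) > r) \<partial>P)
     = (\<integral>\<^sup>+\<omega>. h (Xs i \<omega>) (Xs j \<omega>) * (\<Prod>k\<in>{1..N} - {i, j}. ennreal (of_bool (dist (Xs i \<omega>) (Xs k \<omega>) > r))) \<partial>P)"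
    by simp
  also have "\<dots> = (\<integral>\<^sup>+x. \<integral>\<^sup>+y. h x y * (\<integral>\<^sup>+z. ennreal (of_bool (dist x z > r)) \<partial>D) ^ (N - 2) \<partial>D \<partial>D)"
    by (rule nn_integral_two_point[where \<phi> = "\<lambda>x y z. ennreal (of_bool (dist x z > r))", OF N(2-4) h])
      (unfold of_bool_def, measurable)
  also have "\<dots> = (\<integral>\<^sup>+x. (\<integral>\<^sup>+y. h x y \<partial>D) * ennreal ((1 - pball r x) ^ (N - 2)) \<partial>D)"
    using hx by (simp add: nn_integral_outside ennreal_power nn_integral_multc)
  finally show ?thesis .
qed

lemma prob_nn_dist_greater:
  assumes N: "N \<ge> 2" "i \<in> {1..N}"
  shows "emeasure P {\<omega> \<in> space P. \<forall>k\<in>{1..N} - {i}. dist (Xs i \<omega>) (Xs k \<omega>) > r}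
     = (\<integral>\<^sup>+x. ennreal ((1 - pball r x) ^ (N - 1)) \<partial>D)"
proof -
  obtain j where j: "j \<in> {1..N}" "i \<noteq> j"
    using N by (cases "i = 1") (auto intro: that[of 1] that[of 2])
  have [measurable]: "Xs i \<in> borel_measurable P" "\<And>k. k \<in> {1..N} - {i} \<Longrightarrow> Xs k \<in> borel_measurable P"
    using N by auto
  have m: "{\<omega> \<in> space P. \<forall>k\<in>{1..N} - {i}. dist (Xs i \<omega>) (Xs k \<omega>) > r} \<in> sets P"
    using N by measurable
  have "emeasure P {\<omega> \<in> space P. \<forall>k\<in>{1..N} - {i}. dist (Xs i \<omega>) (Xs k \<omega>) > r}
    = (\<integral>\<^sup>+\<omega>. indicator {\<omega> \<in> space P. \<forall>k\<in>{1..N} - {i}. dist (Xs i \<omega>) (Xs k \<omega>) > r} \<omega> \<partial>P)"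
    using m by simp
  \<comment> \<open>The condition on \<open>X\<^sub>j\<close> becomes the weight; its integral
    supplies the factor that raises the exponent from \<open>N - 2\<close> to
    \<open>N - 1\<close>.\<close>
  also have "\<dots> = (\<integral>\<^sup>+\<omega>. ennreal (of_bool (dist (Xs i \<omega>) (Xs j \<omega>) > r)) * of_bool (\<forall>k\<in>{1..N} - {i, j}. dist (Xs i \<omega>) (Xs k \<omega>) > r) \<partial>P)"
    using j by (intro nn_integral_cong) (auto split: split_indicator)
  also have "\<dots> = (\<integral>\<^sup>+x. (\<integral>\<^sup>+y. ennreal (of_bool (dist x y > r)) \<partial>D) * ennreal ((1 - pball r x) ^ (N - 2)) \<partial>D)"
    by (rule nn_integral_nn_dist[where h = "\<lambda>x y. ennreal (of_bool (dist x y > r))", OF N j])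
      (unfold of_bool_def, measurable)
  also have "\<dots> = (\<integral>\<^sup>+x. ennreal ((1 - pball r x) ^ (N - 1)) \<partial>D)"
  proof -
    have "N - 1 = Suc (N - 2)" using N by simp
    then show ?thesis by (simp add: nn_integral_outside ennreal_mult[symmetric])
  qed
  finally show ?thesis .
qed

text \<open>The two chosen points must avoid each other, which gives the indicator, and each of the
  other \<open>N - 2\<close> points must avoid both balls, which gives the power.\<close>

lemma prob_two_nn_dist_greater:
  assumes N: "N \<ge> 2" "i \<in> {1..N}" "j \<in> {1..N}" "i \<noteq> j"
  shows "emeasure P {\<omega> \<in> space P. (\<forall>k\<in>{1..N} - {i}. dist (Xs i \<omega>) (Xs k \<omega>) > r) \<and> (\<forall>k\<in>{1..N} - {j}. dist (Xs j \<omega>) (Xs k \<omega>) > r)}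
     = (\<integral>\<^sup>+x. \<integral>\<^sup>+y. ennreal (of_bool (dist x y > r) * (1 - pball2 r x y) ^ (N - 2)) \<partial>D \<partial>D)"
proof -
  have [simp]: "(\<Prod>k\<in>S. ennreal (of_bool (Q k))) = of_bool (\<forall>k\<in>S. Q k)" if "finite S" for S :: "nat set" and Q
    using that by (induction S rule: finite_induct) auto
  have [measurable]: "Xs i \<in> borel_measurable P" "\<And>k. k \<in> {1..N} - {i} \<Longrightarrow> Xs k \<in> borel_measurable P"
    using N by auto
  have [measurable]: "Xs j \<in> borel_measurable P" "\<And>k. k \<in> {1..N} - {j} \<Longrightarrow> Xs k \<in> borel_measurable P"
    using N by auto
  let ?S = "{\<omega> \<in> space P. (\<forall>k\<in>{1..N} - {i}. dist (Xs i \<omega>) (Xs k \<omega>) > r) \<and> (\<forall>k\<in>{1..N} - {j}. dist (Xs j \<omega>) (Xs k \<omega>) > r)}"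
  have m: "?S \<in> sets P" using N by measurable
  have "emeasure P ?S = (\<integral>\<^sup>+\<omega>. indicator ?S \<omega> \<partial>P)" using m by simp
  also have "\<dots> = (\<integral>\<^sup>+\<omega>. ennreal (of_bool (dist (Xs i \<omega>) (Xs j \<omega>) > r)) *
      (\<Prod>k\<in>{1..N} - {i, j}. ennreal (of_bool (dist (Xs i \<omega>) (Xs k \<omega>) > r \<and> dist (Xs j \<omega>) (Xs k \<omega>) > r))) \<partial>P)"
    using N by (intro nn_integral_cong) (auto split: split_indicator simp: dist_commute)
  also have "\<dots> = (\<integral>\<^sup>+x. \<integral>\<^sup>+y. ennreal (of_bool (dist x y > r)) * (\<integral>\<^sup>+z. ennreal (of_bool (dist x z > r \<and> dist y z > r)) \<partial>D) ^ (N - 2) \<partial>D \<partial>D)"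
    by (rule nn_integral_two_point[where h = "\<lambda>x y. ennreal (of_bool (dist x y > r))"
          and \<phi> = "\<lambda>x y z. ennreal (of_bool (dist x z > r \<and> dist y z > r))", OF N(2-4)])
      (unfold of_bool_def, measurable)
  also have "\<dots> = (\<integral>\<^sup>+x. \<integral>\<^sup>+y. ennreal (of_bool (dist x y > r) * (1 - pball2 r x y) ^ (N - 2)) \<partial>D \<partial>D)"
  proof (intro nn_integral_cong)
    fix x y
    have "(\<integral>\<^sup>+z. ennreal (of_bool (dist x z > r \<and> dist y z > r)) \<partial>D) = (\<integral>\<^sup>+z. indicator (space D - (cball x r \<union> cball y r)) z \<partial>D)"
      by (intro nn_integral_cong) (auto split: split_indicator)
    also have "\<dots> = emeasure D (space D - (cball x r \<union> cball y r))" by (intro nn_integral_indicator) auto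
    also have "\<dots> = ennreal (1 - pball2 r x y)"
      by (subst D.emeasure_eq_measure, subst D.prob_compl) auto
    finally show "ennreal (of_bool (dist x y > r)) * (\<integral>\<^sup>+z. ennreal (of_bool (dist x z > r \<and> dist y z > r)) \<partial>D) ^ (N - 2)
       = ennreal (of_bool (dist x y > r) * (1 - pball2 r x y) ^ (N - 2))"
      by (simp add: ennreal_power ennreal_mult')
  qed
  finally show ?thesis .
qed

end

lemma zeta_stat_measurable:
  assumes "\<And>k. k \<in> {1..N} \<Longrightarrow> (\<lambda>\<omega>. X \<omega> k) \<in> borel_measurable M" "i \<in> {1..N}"
  shows "(\<lambda>\<omega>. nn_dist N (X \<omega>) i) \<in> borel_measurable M"
    and "(\<lambda>\<omega>. zeta_stat N (X \<omega>) i) \<in> borel_measurable M"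
proof -
  have [measurable]: "(\<lambda>\<omega>. X \<omega> k) \<in> borel_measurable M" if "k \<in> {1..N}" for k by (rule assms(1)[OF that])
  show [measurable]: "(\<lambda>\<omega>. nn_dist N (X \<omega>) i) \<in> borel_measurable M"
    unfolding nn_dist_def using assms(2) by (intro borel_measurable_Min) auto
  show "(\<lambda>\<omega>. zeta_stat N (X \<omega>) i) \<in> borel_measurable M"
    unfolding zeta_stat_def by measurable
qed

section \<open>Limit law of the statistics\<close>

text \<open>
  The parameter \<open>d\<close> stands for \<open>CARD('d)\<close>: constants depending on the dimension alone would
  otherwise need a type argument.
\<close>

locale density_sample = prob_space P for P :: "'w measure" +
  fixes Xs :: "nat \<Rightarrow> 'w \<Rightarrow> real^'d" and f :: "real^'d \<Rightarrow> real" and d :: nat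
  assumes d_def: "d = CARD('d)" and f_nonneg: "\<And>x. f x \<ge> 0" and f_measurable [measurable]: "f \<in> borel_measurable borel"
    and indep_Xs: "indep_vars (\<lambda>_. borel) Xs {1..}"
    and law_Xs: "\<And>i. i \<ge> 1 \<Longrightarrow> distr P borel (Xs i) = density lborel (\<lambda>x. ennreal (f x))"
begin

sublocale iid_sample P Xs "density lborel (\<lambda>x. ennreal (f x))"
proof (intro iid_sample.intro iid_sample_axioms.intro prob_space_axioms)
  have "Xs 1 \<in> borel_measurable P" using indep_Xs unfolding indep_vars_def by auto
  then show "prob_space (density lborel (\<lambda>x. ennreal (f x)))"
    using law_Xs[of 1, symmetric] prob_space_distr[of "Xs 1" borel] by simp
qed (use indep_Xs law_Xs in auto)

abbreviation "D \<equiv> density lborel (\<lambda>x. ennreal (f x))"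
abbreviation (input) "\<gamma> \<equiv> euler_mascheroni :: real"
abbreviation "void u x \<equiv> exp (- (f x * exp (u - \<gamma>)))"
abbreviation "V \<equiv> unit_ball_vol (real d)"

abbreviation "\<zeta> N i \<omega> \<equiv> zeta_stat N (\<lambda>k. Xs k \<omega>) i"
abbreviation "\<rho> N i \<omega> \<equiv> nn_dist N (\<lambda>k. Xs k \<omega>) i"

lemma f_integral: "(\<integral>\<^sup>+x. ennreal (f x) \<partial>lborel) \<noteq> \<infinity>"
proof -
  have "emeasure D (space D) = (\<integral>\<^sup>+x. ennreal (f x) \<partial>lborel)" by (simp add: emeasure_density)
  then show ?thesis using D.emeasure_space_1 by simp
qed

lemma D_abs_continuous: "absolutely_continuous lborel D"
  by (rule absolutely_continuousI_density) simp

lemma AE_D_pos: "AE x in D. f x > 0"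
  by (subst AE_density) auto

lemma AE_D_I: "AE x in lborel. Q x \<Longrightarrow> AE x in D. Q x"
  by (subst AE_density) auto

lemma zeta_measurable [measurable]:
  "i \<in> {1..N} \<Longrightarrow> \<rho> N i \<in> borel_measurable P"
  "i \<in> {1..N} \<Longrightarrow> \<zeta> N i \<in> borel_measurable P"
  by (rule zeta_stat_measurable; auto)+

text \<open>The distance at which the logarithm in \<open>zeta_stat\<close> takes the value
  \<open>u\<close>.\<close>

definition rad :: "nat \<Rightarrow> real \<Rightarrow> real" where
  "rad N u = root d (exp (u - \<gamma>) / (V * (real N - 1)))"

lemma V_pos: "V > 0" and d_pos: "d > 0"
  by (simp_all add: d_def)

lemma rad_pos: "N \<ge> 2 \<Longrightarrow> rad N u > 0"
  unfolding rad_def using d_pos by (intro real_root_gt_zero divide_pos_pos mult_pos_pos) auto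

lemma rad_power: "N \<ge> 2 \<Longrightarrow> rad N u ^ d = exp (u - \<gamma>) / (V * (real N - 1))"
  unfolding rad_def using d_pos by (intro real_root_pow_pos2 divide_nonneg_nonneg mult_nonneg_nonneg) auto

lemma rad_tendsto: "(\<lambda>N. rad N u) \<longlonglongrightarrow> 0"
proof -
  have "(\<lambda>N. exp (u - \<gamma>) / V * (1 / (real N - 1))) \<longlonglongrightarrow> exp (u - \<gamma>) / V * 0"
    by (intro tendsto_mult tendsto_const) real_asymp
  then have "(\<lambda>N. exp (u - \<gamma>) / (V * (real N - 1))) \<longlonglongrightarrow> 0" by simp
  from tendsto_real_root[OF this, of "d"] show ?thesis by (simp add: rad_def)
qed

text \<open>Positivity of the distance matters: \<open>ln 0 = 0\<close> gives coinciding points the value \<open>0\<close>.\<close>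

lemma zeta_greater_iff:
  assumes N: "N \<ge> 2" and pos: "nn_dist N x i > 0"
  shows "zeta_stat N (x :: nat \<Rightarrow> real^'d) i > u \<longleftrightarrow> nn_dist N x i > rad N u"
proof -
  let ?r = "nn_dist N x i"
  have n: "real N - 1 > 0" using N by simp
  have "zeta_stat N x i > u \<longleftrightarrow> ln (?r ^ d * V * exp \<gamma> * (real N - 1)) > ln (exp u)"
    by (simp add: zeta_stat_def d_def)
  also have "\<dots> \<longleftrightarrow> ?r ^ d * V * exp \<gamma> * (real N - 1) > exp u"
    using pos n by (subst ln_less_cancel_iff) auto
  also have "\<dots> \<longleftrightarrow> ?r ^ d > rad N u ^ d"
    using n by (simp add: rad_power[OF N] exp_diff field_simps)
  also have "\<dots> \<longleftrightarrow> ?r > rad N u"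
    using power_less_imp_less_base[of "rad N u" d ?r] power_strict_mono[of "rad N u" ?r d]
      rad_pos[OF N, of u] pos d_pos by auto
  finally show ?thesis .
qed

lemma pball_eq: "pball r x = measure D (ball x r)"
  unfolding pball_def measure_def using emeasure_ball_eq_cball[OF sets_D D_abs_continuous, of x r] by simp

text \<open>Balls of radius \<open>0\<close> carry no mass, so the void probability at radius
  \<open>0\<close> is \<open>1\<close>.\<close>

lemma AE_rho_pos:
  assumes "N \<ge> 2" "i \<in> {1..N}"
  shows "AE \<omega> in P. \<rho> N i \<omega> > 0"
proof -
  have "pball 0 x = 0" for x unfolding pball_eq by simp
  then have "emeasure P {\<omega> \<in> space P. \<forall>k\<in>{1..N} - {i}. dist (Xs i \<omega>) (Xs k \<omega>) > 0} = 1"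
    using prob_nn_dist_greater[OF assms, of 0] D.emeasure_space_1 by simp
  also have "{\<omega> \<in> space P. \<forall>k\<in>{1..N} - {i}. dist (Xs i \<omega>) (Xs k \<omega>) > 0} = {\<omega> \<in> space P. \<rho> N i \<omega> > 0}"
    using assms by (simp add: nn_dist_greater_iff)
  finally have "prob {\<omega> \<in> space P. \<rho> N i \<omega> > 0} = 1" by (simp add: measure_def)
  moreover have "{\<omega> \<in> space P. \<rho> N i \<omega> > 0} \<in> events" using assms by measurable
  ultimately have "AE \<omega> in P. \<omega> \<in> {\<omega> \<in> space P. \<rho> N i \<omega> > 0}" by (intro AE_prob_1)
  then show ?thesis by eventually_elim simp
qed

lemma prob_rho_greater:
  assumes "N \<ge> 2" "i \<in> {1..N}"
  shows "emeasure P {\<omega> \<in> space P. \<rho> N i \<omega> > r} = (\<integral>\<^sup>+x. ennreal ((1 - pball r x) ^ (N - 1)) \<partial>D)"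
  using prob_nn_dist_greater[OF assms, of r] assms by (simp add: nn_dist_greater_iff)

lemma prob_zeta_greater:
  assumes N: "N \<ge> 2" "i \<in> {1..N}"
  shows "emeasure P {\<omega> \<in> space P. \<zeta> N i \<omega> > u} = (\<integral>\<^sup>+x. ennreal ((1 - pball (rad N u) x) ^ (N - 1)) \<partial>D)"
proof -
  have "emeasure P {\<omega> \<in> space P. \<zeta> N i \<omega> > u} = emeasure P {\<omega> \<in> space P. \<rho> N i \<omega> > rad N u}"
  proof (rule emeasure_eq_AE)
    show "AE \<omega> in P. (\<omega> \<in> {\<omega> \<in> space P. \<zeta> N i \<omega> > u}) = (\<omega> \<in> {\<omega> \<in> space P. \<rho> N i \<omega> > rad N u})"
      using AE_rho_pos[OF N] by eventually_elim (simp add: zeta_greater_iff[OF N(1)])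
  qed (use N in measurable)
  then show ?thesis using prob_rho_greater[OF N] by simp
qed

lemma prob_two_zeta_greater:
  assumes N: "N \<ge> 2" "i \<in> {1..N}" "j \<in> {1..N}" "i \<noteq> j"
  shows "emeasure P {\<omega> \<in> space P. \<zeta> N i \<omega> > u \<and> \<zeta> N j \<omega> > u} =
    (\<integral>\<^sup>+x. \<integral>\<^sup>+y. ennreal (of_bool (dist x y > rad N u) * (1 - pball2 (rad N u) x y) ^ (N - 2)) \<partial>D \<partial>D)"
proof -
  have "emeasure P {\<omega> \<in> space P. \<zeta> N i \<omega> > u \<and> \<zeta> N j \<omega> > u} = emeasure P {\<omega> \<in> space P. \<rho> N i \<omega> > rad N u \<and> \<rho> N j \<omega> > rad N u}"
  proof (rule emeasure_eq_AE)
    show "AE \<omega> in P. (\<omega> \<in> {\<omega> \<in> space P. \<zeta> N i \<omega> > u \<and> \<zeta> N j \<omega> > u}) = (\<omega> \<in> {\<omega> \<in> space P. \<rho> N i \<omega> > rad N u \<and> \<rho> N j \<omega> > rad N u})"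
      using AE_rho_pos[OF N(1,2)] AE_rho_pos[OF N(1,3)] by eventually_elim (simp add: zeta_greater_iff[OF N(1)])
  qed (use N in measurable)
  then show ?thesis using prob_two_nn_dist_greater[OF N, of "rad N u"] N by (simp add: nn_dist_greater_iff)
qed

lemma pball_div_tendsto:
  "AE x in D. ((\<lambda>r. pball r x / (V * r ^ d)) \<longlongrightarrow> f x) (at_right 0)"
proof -
  have "AE x in D. ((\<lambda>r. measure D (ball x r) / measure lborel (ball x r)) \<longlongrightarrow> f x) (at_right 0)"
    using lebesgue_differentiation[OF f_measurable f_nonneg f_integral] by (rule AE_D_I)
  then show ?thesis
  proof eventually_elim
    case (elim x)
    have "\<forall>\<^sub>F r in at_right 0. measure D (ball x r) / measure lborel (ball x r) = pball r x / (V * r ^ d)"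
      unfolding eventually_at_right_field
      by (intro exI[of _ 1]) (simp add: pball_eq measure_def emeasure_ball d_def)
    then show ?case using elim by (rule Lim_transform_eventually[rotated])
  qed
qed

lemma rad_at_right: "filterlim (\<lambda>N. rad N u) (at_right 0) sequentially"
  unfolding filterlim_at
  using rad_tendsto rad_pos by (auto intro!: eventually_sequentiallyI[of 2] less_imp_neq[symmetric])

text \<open>The quantity is the expected number of other points in the critical ball around
  \<open>x\<close>. Its volume times \<open>N - 1\<close> is \<open>exp (u - \<gamma>)\<close>, so
  differentiation gives the limit.\<close>

lemma pball_rad_tendsto:
  "AE x in D. (\<lambda>N. real (N - 1) * pball (rad N u) x) \<longlonglongrightarrow> f x * exp (u - \<gamma>)"
  using pball_div_tendsto
proof eventually_elim
  case (elim x)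
  have "(\<lambda>N. pball (rad N u) x / (V * rad N u ^ d) * exp (u - \<gamma>)) \<longlonglongrightarrow> f x * exp (u - \<gamma>)"
    by (intro tendsto_intros filterlim_compose[OF elim rad_at_right])
  moreover have "\<forall>\<^sub>F N in sequentially. pball (rad N u) x / (V * rad N u ^ d) * exp (u - \<gamma>) = real (N - 1) * pball (rad N u) x"
  proof (rule eventually_sequentiallyI[of 2])
    fix N :: nat assume N: "N \<ge> 2"
    have "V \<noteq> 0" using V_pos by linarith
    then have "V * rad N u ^ d = exp (u - \<gamma>) / real (N - 1)"
      using N by (simp add: rad_power of_nat_diff)
    then show "pball (rad N u) x / (V * rad N u ^ d) * exp (u - \<gamma>) = real (N - 1) * pball (rad N u) x"
      by simp
  qed
  ultimately show ?case by (rule Lim_transform_eventually)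
qed

lemma pball_rad_tendsto_0:
  assumes "(\<lambda>N. real (N - 1) * pball (rad N u) x) \<longlonglongrightarrow> l"
  shows "(\<lambda>N. pball (rad N u) x) \<longlonglongrightarrow> 0" "(\<lambda>N. real (N - 2) * pball (rad N u) x) \<longlonglongrightarrow> l"
proof -
  have i: "(\<lambda>N. 1 / real (N - 1)) \<longlonglongrightarrow> 0" by real_asymp
  have "(\<lambda>N. real (N - 1) * pball (rad N u) x * (1 / real (N - 1))) \<longlonglongrightarrow> l * 0"
    by (intro tendsto_mult assms i)
  moreover have "\<forall>\<^sub>F N in sequentially. real (N - 1) * pball (rad N u) x * (1 / real (N - 1)) = pball (rad N u) x"
    by (rule eventually_sequentiallyI[of 2]) simp
  ultimately show 0: "(\<lambda>N. pball (rad N u) x) \<longlonglongrightarrow> 0" by (auto intro: Lim_transform_eventually)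
  have "(\<lambda>N. real (N - 1) * pball (rad N u) x - pball (rad N u) x) \<longlonglongrightarrow> l - 0"
    by (intro tendsto_diff assms 0)
  moreover have "\<forall>\<^sub>F N in sequentially. real (N - 1) * pball (rad N u) x - pball (rad N u) x = real (N - 2) * pball (rad N u) x"
    by (rule eventually_sequentiallyI[of 2]) (simp add: of_nat_diff algebra_simps)
  ultimately show "(\<lambda>N. real (N - 2) * pball (rad N u) x) \<longlonglongrightarrow> l" by (auto intro: Lim_transform_eventually)
qed

text \<open>The tail at \<open>u\<close> of the mixture built in
  \<open>gumbel_mixture\<close>.\<close>

definition tail :: "real \<Rightarrow> real" where
  "tail u = (\<integral>x. void u x \<partial>D)"

lemma tail_nn: "(\<integral>\<^sup>+x. ennreal (void u x) \<partial>D) = ennreal (tail u)"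
  unfolding tail_def
proof (rule nn_integral_eq_integral)
  show "integrable D (\<lambda>x. void u x)"
    by (rule D.integrable_const_bound[where B = 1]) (use f_nonneg in auto)
qed simp

lemma tail_bounds: "0 \<le> tail u" "tail u \<le> 1"
proof -
  show "0 \<le> tail u" unfolding tail_def by (intro integral_nonneg_AE) auto
  have "ennreal (tail u) \<le> (\<integral>\<^sup>+x. 1 \<partial>D)"
    unfolding tail_nn[symmetric] using f_nonneg by (intro nn_integral_mono) auto
  also have "\<dots> = 1" using D.emeasure_space_1 by simp
  finally show "tail u \<le> 1" by simp
qed

lemma prob_zeta_tendsto:
  "(\<lambda>N. enn2real (\<integral>\<^sup>+x. ennreal ((1 - pball (rad N u) x) ^ (N - 1)) \<partial>D)) \<longlonglongrightarrow> tail u"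
proof -
  have "(\<lambda>N. \<integral>\<^sup>+x. ennreal ((1 - pball (rad N u) x) ^ (N - 1)) \<partial>D) \<longlonglongrightarrow> (\<integral>\<^sup>+x. ennreal (void u x) \<partial>D)"
  proof (rule nn_integral_dominated_convergence[where w = "\<lambda>_. 1"])
    show "AE x in D. ennreal ((1 - pball (rad j u) x) ^ (j - 1)) \<le> 1" for j
      by (auto intro!: power_le_one)
    show "AE x in D. (\<lambda>N. ennreal ((1 - pball (rad N u) x) ^ (N - 1))) \<longlonglongrightarrow> ennreal (void u x)"
      using pball_rad_tendsto[of u]
      by eventually_elim (intro tendsto_ennrealI power_one_minus_tendsto pball_bounds pball_rad_tendsto_0)
  qed (use D.emeasure_space_1 in auto)
  then have "(\<lambda>N. \<integral>\<^sup>+x. ennreal ((1 - pball (rad N u) x) ^ (N - 1)) \<partial>D) \<longlonglongrightarrow> ennreal (tail u)" by (simp only: tail_nn)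
  then show ?thesis using tail_bounds by (intro tendsto_enn2real) auto
qed

text \<open>Almost every pair has \<open>x \<noteq> y\<close>; once the radius is below
  \<open>dist x y / 2\<close>, the mass of the union is the sum of the two masses, and the limit of
  the power splits into a product.\<close>

lemma prob_two_zeta_tendsto:
  "(\<lambda>N. enn2real (\<integral>\<^sup>+x. \<integral>\<^sup>+y. ennreal (of_bool (dist x y > rad N u) * (1 - pball2 (rad N u) x y) ^ (N - 2)) \<partial>D \<partial>D))
     \<longlonglongrightarrow> (tail u)\<^sup>2"
proof -
  let ?c = "exp (u - \<gamma>)" and ?r = "\<lambda>N. rad N u"
  define g where "g = (\<lambda>N x y. of_bool (dist x y > ?r N) * (1 - pball2 (?r N) x y) ^ (N - 2))"
  define e where "e = (\<lambda>x. exp (- (f x * ?c)))"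
  have g01: "0 \<le> g N x y" "g N x y \<le> 1" for N x y
    by (auto simp: g_def intro!: power_le_one)
  have e01: "0 \<le> e x" "e x \<le> 1" for x using f_nonneg by (auto simp: e_def)
  have [measurable]: "e \<in> borel_measurable borel" unfolding e_def by measurable
  have gm [measurable]: "case_prod (g N) \<in> borel_measurable (borel \<Otimes>\<^sub>M borel)" for N
  proof -
    let ?U = "\<lambda>q :: (real^'d) \<times> (real^'d). cball (fst q) (?r N) \<union> cball (snd q) (?r N)"
    have "(\<lambda>q. emeasure D (Pair q -` {w \<in> space ((borel \<Otimes>\<^sub>M borel) \<Otimes>\<^sub>M borel). dist (fst (fst w)) (snd w) \<le> ?r N \<or> dist (snd (fst w)) (snd w) \<le> ?r N}))
        \<in> borel_measurable (borel \<Otimes>\<^sub>M borel)" (is "(\<lambda>q. emeasure D (Pair q -` ?S)) \<in> _")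
      by (rule D.measurable_emeasure_Pair) measurable
    moreover have "Pair q -` ?S = ?U q" for q :: "(real^'d) \<times> (real^'d)"
      by (auto simp: space_pair_measure)
    ultimately have "(\<lambda>q. emeasure D (?U q)) \<in> borel_measurable (borel \<Otimes>\<^sub>M borel)"
      by (simp only:)
    then have [measurable]: "(\<lambda>q. measure D (?U q)) \<in> borel_measurable (borel \<Otimes>\<^sub>M borel)"
      unfolding measure_def by (rule measurable_compose) simp
    show ?thesis unfolding g_def split_beta of_bool_def by measurable
  qed
  have gx [measurable]: "(\<lambda>y. g N x y) \<in> borel_measurable D" for N x
    using measurable_compose[OF measurable_Pair[OF measurable_const[of x] measurable_ident] gm[of N]]
    by (simp cong: measurable_cong_sets)
  have lim: "AE x in D. AE y in D. (\<lambda>N. g N x y) \<longlonglongrightarrow> e x * e y"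
    using pball_rad_tendsto[of u]
  proof eventually_elim
    case (elim x)
    note x = this
    have "AE y in D. y \<noteq> x" by (intro AE_D_I AE_lborel_singleton)
    then show ?case using pball_rad_tendsto[of u]
    proof eventually_elim
      case (elim y)
      let ?p = "\<lambda>N. pball (?r N) x + pball (?r N) y"
      have "\<forall>\<^sub>F N in sequentially. ?r N < dist x y / 2"
        by (rule order_tendstoD(2)[OF rad_tendsto]) (use elim in auto)
      moreover have "\<forall>\<^sub>F N in sequentially. N \<ge> 2" by (rule eventually_ge_at_top)
      ultimately have ev: "\<forall>\<^sub>F N in sequentially. (1 - ?p N) ^ (N - 2) = g N x y"
      proof eventually_elim
        case (elim N)
        have "cball x (?r N) \<inter> cball y (?r N) = {}"
        proof (rule ccontr)
          assume "cball x (?r N) \<inter> cball y (?r N) \<noteq> {}"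
          then obtain z where "dist x z \<le> ?r N" "dist y z \<le> ?r N" by auto
          then show False using dist_triangle[of x y z] elim by (auto simp: dist_commute)
        qed
        then have "pball2 (?r N) x y = ?p N"
          unfolding pball_def by (intro D.finite_measure_Union) auto
        moreover have "?r N < dist x y" using elim rad_pos[of N u] by auto
        ultimately show ?case by (simp add: g_def)
      qed
      have "(\<lambda>N. (1 - ?p N) ^ (N - 2)) \<longlonglongrightarrow> exp (- (f x * ?c + f y * ?c))"
      proof (rule power_one_minus_tendsto)
        show "?p \<longlonglongrightarrow> 0"
          using tendsto_add[OF pball_rad_tendsto_0(1)[OF x] pball_rad_tendsto_0(1)[OF elim(2)]] by simp
        show "(\<lambda>N. real (N - 2) * ?p N) \<longlonglongrightarrow> f x * ?c + f y * ?c"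
          using tendsto_add[OF pball_rad_tendsto_0(2)[OF x] pball_rad_tendsto_0(2)[OF elim(2)]]
          by (simp add: distrib_left)
      qed simp
      also have "exp (- (f x * ?c + f y * ?c)) = e x * e y"
        by (simp add: e_def flip: exp_add)
      finally show ?case using ev by (rule Lim_transform_eventually)
    qed
  qed
  have eI: "(\<integral>\<^sup>+x. ennreal (e x) \<partial>D) = ennreal (tail u)" unfolding e_def by (rule tail_nn)
  \<comment> \<open>Dominated convergence with majorant \<open>1\<close>, for the outer integral and
    then, at almost every \<open>x\<close>, for the inner one.\<close>
  have "(\<lambda>N. \<integral>\<^sup>+x. \<integral>\<^sup>+y. ennreal (g N x y) \<partial>D \<partial>D) \<longlonglongrightarrow> (\<integral>\<^sup>+x. \<integral>\<^sup>+y. ennreal (e x * e y) \<partial>D \<partial>D)"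
  proof (rule nn_integral_dominated_convergence[where w = "\<lambda>_. 1"])
    have b: "(\<integral>\<^sup>+y. ennreal (g N x y) \<partial>D) \<le> 1" for N x
    proof -
      have "(\<integral>\<^sup>+y. ennreal (g N x y) \<partial>D) \<le> (\<integral>\<^sup>+y. 1 \<partial>D)" using g01 by (intro nn_integral_mono) auto
      then show ?thesis using D.emeasure_space_1 by simp
    qed
    then show "AE x in D. (\<integral>\<^sup>+y. ennreal (g j x y) \<partial>D) \<le> 1" for j by simp
    show "AE x in D. (\<lambda>N. \<integral>\<^sup>+y. ennreal (g N x y) \<partial>D) \<longlonglongrightarrow> (\<integral>\<^sup>+y. ennreal (e x * e y) \<partial>D)"
      using lim
    proof eventually_elim
      case (elim x)
      show ?case
      proof (rule nn_integral_dominated_convergence[where w = "\<lambda>_. 1"])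
        show "AE y in D. (\<lambda>N. ennreal (g N x y)) \<longlonglongrightarrow> ennreal (e x * e y)"
          using elim by eventually_elim (rule tendsto_ennrealI)
      qed (use D.emeasure_space_1 g01 in auto)
    qed
  qed (use D.emeasure_space_1 in auto)
  also have "(\<integral>\<^sup>+x. \<integral>\<^sup>+y. ennreal (e x * e y) \<partial>D \<partial>D) = ennreal ((tail u)\<^sup>2)"
    using e01 tail_bounds by (simp add: ennreal_mult eI nn_integral_cmult nn_integral_multc power2_eq_square)
  finally have "(\<lambda>N. \<integral>\<^sup>+x. \<integral>\<^sup>+y. ennreal (g N x y) \<partial>D \<partial>D) \<longlonglongrightarrow> ennreal ((tail u)\<^sup>2)" .
  then show ?thesis unfolding g_def by (intro tendsto_enn2real) auto
qed

lemma empirical_tail_zeta_tendsto: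
  "(\<lambda>N. expectation (\<lambda>\<omega>. \<bar>(\<Sum>i=1..N. of_bool (\<zeta> N i \<omega> > u)) / N - tail u\<bar>)) \<longlonglongrightarrow> 0"
proof (rule empirical_tail_tendsto[OF _ _ _ prob_zeta_tendsto prob_two_zeta_tendsto tail_bounds])
  fix N i j :: nat assume N: "2 \<le> N" "i \<in> {1..N}"
  show "\<zeta> N i \<in> borel_measurable P" using N by measurable
  show "\<P>(\<omega> in P. u < \<zeta> N i \<omega>) = enn2real (\<integral>\<^sup>+x. ennreal ((1 - pball (rad N u) x) ^ (N - 1)) \<partial>D)"
    unfolding measure_def prob_zeta_greater[OF N] ..
  show "\<P>(\<omega> in P. u < \<zeta> N i \<omega> \<and> u < \<zeta> N j \<omega>) =
     enn2real (\<integral>\<^sup>+x. \<integral>\<^sup>+y. ennreal (of_bool (dist x y > rad N u) * (1 - pball2 (rad N u) x y) ^ (N - 2)) \<partial>D \<partial>D)"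
    if "j \<in> {1..N}" "i \<noteq> j" for j
    unfolding measure_def[of P] prob_two_zeta_greater[OF N that] ..
qed

end

section \<open>Uniform integrability\<close>

lemma ennreal_powr_measurable [measurable]: "(\<lambda>a. ennreal_powr a p) \<in> borel_measurable borel"
  unfolding ennreal_powr_def by measurable

lemma le_ennreal_powr:
  assumes "0 \<le> q" "ennreal q \<le> a" "\<epsilon> > 0"
  shows "ennreal (q powr \<epsilon>) \<le> ennreal_powr a \<epsilon>"
proof (cases a)
  case (real r)
  then have "q \<le> r" using assms by simp
  then have "q powr \<epsilon> \<le> r powr \<epsilon>" using assms by (intro powr_mono2) auto
  then show ?thesis using real assms by (auto simp: ennreal_powr_def)
qed (use assms in \<open>auto simp: ennreal_powr_def\<close>)

lemma le_ennreal_powr_neg: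
  assumes "0 \<le> q" "a \<le> ennreal q" "\<epsilon> > 0"
  shows "(if q = 0 then \<infinity> else ennreal (q powr - \<epsilon>)) \<le> ennreal_powr a (- \<epsilon>)"
proof (cases a)
  case (real r)
  then have "r \<le> q" using assms by simp
  then have "q powr - \<epsilon> \<le> r powr - \<epsilon>" if "r > 0" using assms that by (intro powr_mono2') auto
  then show ?thesis using real assms by (auto simp: ennreal_powr_def)
qed (use assms in \<open>auto simp: ennreal_powr_def top_unique\<close>)

lemma power4_sum_le: "(a + b + c) ^ 4 \<le> 27 * (a ^ 4 + b ^ 4 + c ^ 4)" for a b c :: real
proof -
  have s: "(x + y + z)\<^sup>2 \<le> 3 * (x\<^sup>2 + y\<^sup>2 + z\<^sup>2)" for x y z :: real
    using zero_le_power2[of "x - y"] zero_le_power2[of "y - z"] zero_le_power2[of "x - z"]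
    by (simp add: power2_eq_square algebra_simps)
  have "((a + b + c)\<^sup>2)\<^sup>2 \<le> (3 * (a\<^sup>2 + b\<^sup>2 + c\<^sup>2))\<^sup>2" by (intro power_mono s) auto
  also have "\<dots> = 9 * (a\<^sup>2 + b\<^sup>2 + c\<^sup>2)\<^sup>2" by (subst power_mult_distrib) simp
  also have "\<dots> \<le> 9 * (3 * ((a\<^sup>2)\<^sup>2 + (b\<^sup>2)\<^sup>2 + (c\<^sup>2)\<^sup>2))" by (intro mult_left_mono s) auto
  finally show ?thesis by simp
qed

section \<open>Exponential tail bounds for a single statistic\<close>

context density_sample
begin

abbreviation "q r x \<equiv> pball r x / (V * r ^ d)"
text \<open>The value at \<open>0\<close> has to be infinite: on the reals
  \<open>0 powr - \<epsilon>\<close> is \<open>0\<close>, which would hide balls without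
  mass.\<close>

abbreviation "q_inv r \<epsilon> x \<equiv> if q r x = 0 then \<infinity> else ennreal (q r x powr - \<epsilon>)"

lemma V_neq_0 [simp]: "V \<noteq> 0"
  using V_pos by linarith

lemma q_nonneg: "r > 0 \<Longrightarrow> q r x \<ge> 0"
  using V_pos by (intro divide_nonneg_nonneg mult_nonneg_nonneg) auto

lemma I_fun_eq:
  assumes r: "r > 0"
  shows "I_fun f x r = ennreal (q r x)"
proof -
  have "(\<integral>\<^sup>+ y\<in>ball x r. ennreal (f y) \<partial>lborel) = emeasure D (ball x r)"
    by (simp add: emeasure_density)
  also have "\<dots> = ennreal (pball r x)" by (simp add: D.emeasure_eq_measure pball_eq)
  finally show ?thesis
    unfolding I_fun_def d_def[symmetric] using r V_pos by (simp add: divide_ennreal mult.commute)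
qed

text \<open>A fixed radius is dominated by the supremum in \<open>M_fun\<close>; the point is that
  the bound is uniform over all \<open>r\<close> up to \<open>R\<close>.\<close>

lemma nn_integral_q_powr_le:
  assumes r: "0 < r" "r \<le> R" and \<epsilon>: "\<epsilon> > 0"
  shows "(\<integral>\<^sup>+x. ennreal (q r x powr \<epsilon>) \<partial>D) \<le> Q_fun f \<epsilon> R"
proof -
  have "(\<integral>\<^sup>+x. ennreal (q r x powr \<epsilon>) \<partial>D) = (\<integral>\<^sup>+x. ennreal (f x) * ennreal (q r x powr \<epsilon>) \<partial>lborel)"
    by (rule nn_integral_density) auto
  also have "\<dots> \<le> Q_fun f \<epsilon> R"
    unfolding Q_fun_def
  proof (intro nn_integral_mono)
    fix x
    have "ennreal (q r x) \<le> M_fun f x R"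
      unfolding M_fun_def I_fun_eq[OF r(1), symmetric] using r by (intro SUP_upper) auto
    then have "ennreal (q r x powr \<epsilon>) \<le> ennreal_powr (M_fun f x R) \<epsilon>"
      using r \<epsilon> by (intro le_ennreal_powr q_nonneg) auto
    then show "ennreal (f x) * ennreal (q r x powr \<epsilon>) \<le> ennreal_powr (M_fun f x R) \<epsilon> * ennreal (f x)"
      by (subst mult.commute) (rule mult_right_mono, auto)
  qed
  finally show ?thesis .
qed

lemma nn_integral_q_powr_neg_le:
  assumes r: "0 < r" "r \<le> R" and \<epsilon>: "\<epsilon> > 0"
  shows "(\<integral>\<^sup>+x. q_inv r \<epsilon> x \<partial>D) \<le> T_fun f \<epsilon> R"
proof -
  have "(\<integral>\<^sup>+x. q_inv r \<epsilon> x \<partial>D) =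
      (\<integral>\<^sup>+x. ennreal (f x) * q_inv r \<epsilon> x \<partial>lborel)"
    by (rule nn_integral_density) measurable
  also have "\<dots> \<le> T_fun f \<epsilon> R"
    unfolding T_fun_def
  proof (intro nn_integral_mono)
    fix x
    have "m_fun f x R \<le> ennreal (q r x)"
      unfolding m_fun_def I_fun_eq[OF r(1), symmetric] using r by (intro INF_lower) auto
    then have "q_inv r \<epsilon> x \<le> ennreal_powr (m_fun f x R) (- \<epsilon>)"
      using r \<epsilon> by (intro le_ennreal_powr_neg q_nonneg) auto
    then show "ennreal (f x) * q_inv r \<epsilon> x \<le> ennreal_powr (m_fun f x R) (- \<epsilon>) * ennreal (f x)"
      by (subst mult.commute) (rule mult_right_mono, auto)
  qed
  finally show ?thesis .
qed

text \<open>A massless ball makes \<open>q_inv\<close> infinite, which finiteness of the integral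
  forbids almost everywhere.\<close>

lemma AE_pball_pos:
  assumes r: "0 < r" "r \<le> R" and \<epsilon>: "\<epsilon> > 0" and T: "T_fun f \<epsilon> R < \<infinity>"
  shows "AE x in D. pball r x > 0"
proof -
  have "(\<integral>\<^sup>+x. q_inv r \<epsilon> x \<partial>D) \<noteq> \<infinity>"
    using nn_integral_q_powr_neg_le[OF r \<epsilon>] T by (auto simp: top_unique)
  then have "AE x in D. q_inv r \<epsilon> x \<noteq> \<infinity>"
    by (intro nn_integral_PInf_AE) measurable
  then show ?thesis
  proof eventually_elim
    case (elim x)
    then have "pball r x \<noteq> 0" by (auto split: if_splits)
    then show ?case using pball_bounds(1)[of r x] by linarith
  qed
qed

lemma rad_le_iff:
  assumes N: "N \<ge> 2" and R: "R > 0"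
  shows "rad N u \<le> R \<longleftrightarrow> exp (u - \<gamma>) \<le> (real N - 1) * (V * R ^ d)"
proof -
  have "rad N u \<le> R \<longleftrightarrow> rad N u ^ d \<le> R ^ d"
    using rad_pos[OF N, of u] R d_pos power_mono[of "rad N u" R d] power_le_imp_le_base[of "rad N u" "d - 1" R] by auto
  also have "\<dots> \<longleftrightarrow> exp (u - \<gamma>) \<le> (real N - 1) * (V * R ^ d)"
    unfolding rad_power[OF N] using N V_pos by (subst pos_divide_le_eq) (auto simp: mult_ac)
  finally show ?thesis .
qed

lemma pball_rad:
  assumes N: "N \<ge> 2"
  shows "real (N - 1) * pball (rad N u) x = q (rad N u) x * exp (u - \<gamma>)"
proof -
  have "V \<noteq> 0" using V_pos by linarith
  then have "V * rad N u ^ d = exp (u - \<gamma>) / real (N - 1)"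
    using N by (simp add: rad_power of_nat_diff)
  then show ?thesis by simp
qed

text \<open>A very negative \<open>\<zeta>\<close> means that some point fell into a tiny ball, an
  event of conditional probability at most \<open>((N - 1) * p) powr \<delta>\<close> for a ball of
  mass \<open>p\<close>. As \<open>(N - 1) * p\<close> is the average density times
  \<open>exp (- u - \<gamma>)\<close>, the decay in \<open>u\<close> separates from a moment of that
  average. The interpolation bound forces \<open>\<delta> \<le> 1\<close>, hence the
  minimum.\<close>

lemma zeta_lower_tail:
  assumes \<epsilon>: "\<epsilon> > 0" and R: "R > 0" and Q: "Q_fun f \<epsilon> R < \<infinity>"
  obtains C u0 where "C \<ge> 0" "\<And>u N i. u \<ge> u0 \<Longrightarrow> N \<ge> 2 \<Longrightarrow> i \<in> {1..N} \<Longrightarrow>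
    emeasure P {\<omega> \<in> space P. \<zeta> N i \<omega> < - u} \<le> ennreal (C * exp (- (min 1 \<epsilon> * u)))"
proof -
  define \<delta> where "\<delta> = min 1 \<epsilon>"
  have \<delta>: "0 < \<delta>" "\<delta> \<le> 1" "\<delta> \<le> \<epsilon>" using \<epsilon> by (auto simp: \<delta>_def)
  obtain B where B: "Q_fun f \<epsilon> R = ennreal B" "B \<ge> 0" using Q by (cases "Q_fun f \<epsilon> R") auto
  \<comment> \<open>For \<open>u \<ge> u0\<close> the critical radius is at most \<open>R\<close>
    for every \<open>N \<ge> 2\<close>, so the moment bound applies uniformly.\<close>
  define u0 where "u0 = - \<gamma> - ln (V * R ^ d)"
  have VR: "V * R ^ d > 0" using V_pos R by simp
  show ?thesis
  proof (rule that[of "(1 + B) * exp (- (\<delta> * \<gamma>))" u0])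
    show "0 \<le> (1 + B) * exp (- (\<delta> * \<gamma>))" using B by simp
    fix u N i assume u: "u \<ge> u0" and N: "N \<ge> (2::nat)" "i \<in> {1..N}"
    let ?r = "rad N (- u)" and ?E = "exp (- (\<delta> * (u + \<gamma>)))"
    let ?hi = "{\<omega> \<in> space P. \<zeta> N i \<omega> > - u}" and ?lo = "{\<omega> \<in> space P. \<not> \<zeta> N i \<omega> > - u}"
    let ?p = "\<lambda>x. (1 - pball ?r x) ^ (N - 1)"
    have r: "0 < ?r" "?r \<le> R"
    proof -
      show "0 < ?r" using rad_pos[OF N(1)] .
      have "exp (- u - \<gamma>) \<le> exp (ln (V * R ^ d))" using u by (simp add: u0_def)
      also have "\<dots> = 1 * (V * R ^ d)" using VR by simp
      also have "\<dots> \<le> (real N - 1) * (V * R ^ d)" using N VR by (intro mult_right_mono) auto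
      finally show "?r \<le> R" using rad_le_iff[OF N(1) R] by simp
    qed
    have "emeasure P {\<omega> \<in> space P. \<zeta> N i \<omega> < - u} \<le> emeasure P ?lo"
      using N by (intro emeasure_mono) auto
    \<comment> \<open>Subtraction is avoided in the extended reals: both probabilities add up to
      \<open>1\<close>, and the common finite summand is cancelled.\<close>
    also have "\<dots> = (\<integral>\<^sup>+x. ennreal (1 - ?p x) \<partial>D)"
    proof -
      have "emeasure P ?hi + emeasure P ?lo
          = emeasure P (?hi \<union> ?lo)"
        using N by (intro plus_emeasure) auto
      also have "?hi \<union> ?lo = space P" by auto
      also have "emeasure P (space P) = (\<integral>\<^sup>+x. 1 \<partial>D)" using emeasure_space_1 D.emeasure_space_1 by simp
      also have "\<dots> = (\<integral>\<^sup>+x. ennreal (?p x) + ennreal (1 - ?p x) \<partial>D)"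
        by (intro nn_integral_cong) (subst ennreal_plus[symmetric], auto intro!: power_le_one)
      also have "\<dots> = (\<integral>\<^sup>+x. ennreal (?p x) \<partial>D) + (\<integral>\<^sup>+x. ennreal (1 - ?p x) \<partial>D)"
        by (intro nn_integral_add) auto
      finally have "emeasure P ?hi + emeasure P ?lo =
          emeasure P ?hi + (\<integral>\<^sup>+x. ennreal (1 - ?p x) \<partial>D)"
        unfolding prob_zeta_greater[OF N] .
      then show ?thesis by (rule ennreal_add_left_cancel[THEN iffD1, THEN disjE]) (auto simp: emeasure_eq_measure)
    qed
    also have "\<dots> \<le> (\<integral>\<^sup>+x. ennreal (?E) * (1 + ennreal (q ?r x powr \<epsilon>)) \<partial>D)"
    proof (intro nn_integral_mono)
      fix x
      have "1 - ?p x \<le> (real (N - 1) * pball ?r x) powr \<delta>"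
        using \<delta> N by (intro one_minus_one_minus_power_le_powr) auto
      also have "\<dots> = q ?r x powr \<delta> * exp (- u - \<gamma>) powr \<delta>"
        unfolding pball_rad[OF N(1)] by (subst powr_mult) (use q_nonneg[OF r(1)] in auto)
      also have "exp (- u - \<gamma>) powr \<delta> = ?E"
        by (simp add: powr_def algebra_simps)
      \<comment> \<open>The assumption concerns the exponent \<open>\<epsilon>\<close>, which may
        exceed \<open>\<delta>\<close>; adding \<open>1\<close> covers averages below
        \<open>1\<close>.\<close>
      also have "q ?r x powr \<delta> * ?E \<le> (1 + q ?r x powr \<epsilon>) * ?E"
      proof (rule mult_right_mono)
        show "q ?r x powr \<delta> \<le> 1 + q ?r x powr \<epsilon>"
        proof (cases "q ?r x \<le> 1")
          case True
          then have "q ?r x powr \<delta> \<le> 1" 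
            by (intro powr_le1) (use \<delta> in simp, simp only: abs_of_nonneg[OF q_nonneg[OF r(1)]])
          then show ?thesis by (simp add: add_increasing2)
        next
          case False
          then have "q ?r x powr \<delta> \<le> q ?r x powr \<epsilon>" using \<delta> by (intro powr_mono) auto
          then show ?thesis by simp
        qed
      qed simp
      finally have "1 - ?p x \<le> ?E * (1 + q ?r x powr \<epsilon>)"
        by (simp add: mult.commute)
      then have "ennreal (1 - ?p x) \<le> ennreal (?E * (1 + q ?r x powr \<epsilon>))"
        by (rule ennreal_leI)
      also have "\<dots> = ennreal (?E) * (1 + ennreal (q ?r x powr \<epsilon>))"
        by (simp add: ennreal_mult ennreal_plus flip: ennreal_1)
      finally show "ennreal (1 - ?p x) \<le> ennreal (?E) * (1 + ennreal (q ?r x powr \<epsilon>))" .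
    qed
    also have "\<dots> = ennreal (?E) * (1 + (\<integral>\<^sup>+x. ennreal (q ?r x powr \<epsilon>) \<partial>D))"
      using D.emeasure_space_1 by (simp add: nn_integral_cmult nn_integral_add)
    also have "\<dots> \<le> ennreal (?E) * (1 + ennreal B)"
      using nn_integral_q_powr_le[OF r \<epsilon>] B by (intro mult_left_mono add_left_mono) auto
    also have "\<dots> = ennreal (?E * (1 + B))"
      using B by (simp add: ennreal_mult ennreal_plus flip: ennreal_1)
    also have "?E * (1 + B) = (1 + B) * exp (- (\<delta> * \<gamma>)) * exp (- (min 1 \<epsilon> * u))"
      unfolding \<delta>_def[symmetric] by (simp add: algebra_simps exp_add[symmetric] exp_diff add_divide_distrib)
    finally show "emeasure P {\<omega> \<in> space P. \<zeta> N i \<omega> < - u} \<le>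
        ennreal ((1 + B) * exp (- (\<delta> * \<gamma>)) * exp (- (min 1 \<epsilon> * u)))" .
  qed
qed

text \<open>Separates the decay in \<open>n\<close> and \<open>r\<close> from the negative moment of
  the average density. At the critical radius it yields decay in \<open>u\<close>; at the fixed
  radius \<open>R\<close> it yields a rate in the sample size.\<close>

lemma nn_integral_one_minus_pball_power_le:
  assumes r: "0 < r" "r \<le> R" and \<epsilon>: "\<epsilon> > 0" and n: "n > 0" and T: "T_fun f \<epsilon> R < \<infinity>"
  shows "(\<integral>\<^sup>+x. ennreal ((1 - pball r x) ^ n) \<partial>D) \<le>
     ennreal (\<epsilon> powr \<epsilon> * (real n * (V * r ^ d)) powr - \<epsilon>) * T_fun f \<epsilon> R"
proof -
  have Vr: "V * r ^ d > 0" using V_pos r by simp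
  have "(\<integral>\<^sup>+x. ennreal ((1 - pball r x) ^ n) \<partial>D) \<le> (\<integral>\<^sup>+x. ennreal (\<epsilon> powr \<epsilon> * (real n * (V * r ^ d)) powr - \<epsilon>) *
      q_inv r \<epsilon> x \<partial>D)"
  proof (rule nn_integral_mono_AE, use AE_pball_pos[OF r \<epsilon> T] in eventually_elim)
    case (elim x)
    have q0: "q r x > 0" using elim Vr by simp
    have "(1 - pball r x) ^ n \<le> \<epsilon> powr \<epsilon> * (real n * pball r x) powr - \<epsilon>"
      using elim \<epsilon> n by (intro one_minus_power_le_powr) auto
    also have "real n * pball r x = (real n * (V * r ^ d)) * q r x"
      using r by simp
    also have "\<dots> powr - \<epsilon> = (real n * (V * r ^ d)) powr - \<epsilon> * q r x powr - \<epsilon>"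
      by (rule powr_mult)
    finally have "ennreal ((1 - pball r x) ^ n) \<le> ennreal (\<epsilon> powr \<epsilon> * (real n * (V * r ^ d)) powr - \<epsilon> * q r x powr - \<epsilon>)"
      by (intro ennreal_leI) (simp add: mult.assoc)
    also have "\<dots> = ennreal (\<epsilon> powr \<epsilon> * (real n * (V * r ^ d)) powr - \<epsilon>) * ennreal (q r x powr - \<epsilon>)"
      by (simp add: ennreal_mult')
    finally show ?case using q0 r by auto
  qed
  also have "\<dots> = ennreal (\<epsilon> powr \<epsilon> * (real n * (V * r ^ d)) powr - \<epsilon>) *
      (\<integral>\<^sup>+x. q_inv r \<epsilon> x \<partial>D)"
    by (rule nn_integral_cmult) measurable
  also have "\<dots> \<le> ennreal (\<epsilon> powr \<epsilon> * (real n * (V * r ^ d)) powr - \<epsilon>) * T_fun f \<epsilon> R"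
    by (intro mult_left_mono nn_integral_q_powr_neg_le r \<epsilon>) auto
  finally show ?thesis .
qed

text \<open>If the critical radius exceeds \<open>R\<close>, the event is null, because
  \<open>\<zeta> > u\<close> forces the distance above that radius. Otherwise the radius is
  admissible for \<open>T_fun\<close>, and \<open>(N - 1) * V * r ^ d\<close> equals
  \<open>exp (u - \<gamma>)\<close>.\<close>

lemma zeta_upper_tail:
  assumes \<epsilon>: "\<epsilon> > 0" and R: "R > 0" and T: "T_fun f \<epsilon> R < \<infinity>"
  obtains C where "C \<ge> 0" "\<And>u N i. u \<ge> 0 \<Longrightarrow> N \<ge> 2 \<Longrightarrow> i \<in> {1..N} \<Longrightarrow>
    emeasure P {\<omega> \<in> space P. \<zeta> N i \<omega> > u \<and> \<rho> N i \<omega> \<le> R} \<le> ennreal (C * exp (- (\<epsilon> * u)))"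
proof -
  obtain B where B: "T_fun f \<epsilon> R = ennreal B" "B \<ge> 0" using T by (cases "T_fun f \<epsilon> R") auto
  show ?thesis
  proof (rule that[of "\<epsilon> powr \<epsilon> * exp (\<epsilon> * \<gamma>) * B"])
    show "0 \<le> \<epsilon> powr \<epsilon> * exp (\<epsilon> * \<gamma>) * B" using B by simp
    fix u :: real and N i assume u: "u \<ge> 0" and N: "N \<ge> (2::nat)" "i \<in> {1..N}"
    let ?r = "rad N u"
    show "emeasure P {\<omega> \<in> space P. \<zeta> N i \<omega> > u \<and> \<rho> N i \<omega> \<le> R} \<le> ennreal (\<epsilon> powr \<epsilon> * exp (\<epsilon> * \<gamma>) * B * exp (- (\<epsilon> * u)))"
    proof (cases "?r \<le> R")
      case False
      have "AE \<omega> in P. \<not> (\<zeta> N i \<omega> > u \<and> \<rho> N i \<omega> \<le> R)"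
        using AE_rho_pos[OF N] by eventually_elim (use False in \<open>auto simp: zeta_greater_iff[OF N(1)]\<close>)
      then have "emeasure P {\<omega> \<in> space P. \<zeta> N i \<omega> > u \<and> \<rho> N i \<omega> \<le> R} = 0"
        using N by (subst (asm) AE_iff_measurable[OF _ refl]) auto
      then show ?thesis by simp
    next
      case True
      have r: "0 < ?r" using rad_pos[OF N(1)] .
      have "V * ?r ^ d = exp (u - \<gamma>) / real (N - 1)"
      proof -
        have "V \<noteq> 0" using V_pos by linarith
        then show ?thesis using N by (simp add: rad_power of_nat_diff)
      qed
      then have nV: "real (N - 1) * (V * ?r ^ d) = exp (u - \<gamma>)" using N by simp
      have "emeasure P {\<omega> \<in> space P. \<zeta> N i \<omega> > u \<and> \<rho> N i \<omega> \<le> R} \<le> emeasure P {\<omega> \<in> space P. \<zeta> N i \<omega> > u}"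
        using N by (intro emeasure_mono) auto
      also have "\<dots> = (\<integral>\<^sup>+x. ennreal ((1 - pball ?r x) ^ (N - 1)) \<partial>D)" by (rule prob_zeta_greater[OF N])
      also have "\<dots> \<le> ennreal (\<epsilon> powr \<epsilon> * (real (N - 1) * (V * ?r ^ d)) powr - \<epsilon>) * T_fun f \<epsilon> R"
        using N by (intro nn_integral_one_minus_pball_power_le r True \<epsilon> T) auto
      also have "\<dots> = ennreal (\<epsilon> powr \<epsilon> * exp (u - \<gamma>) powr - \<epsilon> * B)"
        unfolding nV B(1) using B(2) by (simp add: ennreal_mult')
      also have "exp (u - \<gamma>) powr - \<epsilon> = exp (\<epsilon> * \<gamma>) * exp (- (\<epsilon> * u))"
        by (simp add: powr_def algebra_simps flip: exp_add)
      finally show ?thesis by (simp add: mult_ac)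
    qed
  qed
qed

end

section \<open>From tail probabilities and log moments to fourth moments\<close>

lemma tails_to_fourth_moment:
  fixes z :: real and K :: nat and B :: bool
  shows "ennreal (of_bool (\<bar>z\<bar> > real K) * z ^ 4) \<le>
    (\<Sum>k. ennreal (real (k + K + 1) ^ 4) * (of_bool (z < - real (k + K)) + of_bool (z > real (k + K) \<and> B)))
     + ennreal (of_bool (z > 0 \<and> \<not> B) * z ^ 4)"
proof (cases "\<bar>z\<bar> > real K \<and> \<not> (z > 0 \<and> \<not> B)")
  case True
  \<comment> \<open>The unit layer containing \<open>\<bar>z\<bar>\<close>, open below and closed
    above; this single term of the series already dominates \<open>z ^ 4\<close>.\<close>
  define k where "k = nat \<lceil>\<bar>z\<bar>\<rceil> - 1 - K"
  have c: "real (nat \<lceil>\<bar>z\<bar>\<rceil>) \<ge> \<bar>z\<bar>" "real (nat \<lceil>\<bar>z\<bar>\<rceil>) < \<bar>z\<bar> + 1" by linarith+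
  then have "nat \<lceil>\<bar>z\<bar>\<rceil> > K" using True by linarith
  then have "nat \<lceil>\<bar>z\<bar>\<rceil> = k + K + 1" by (simp add: k_def)
  then have k: "\<bar>z\<bar> > real (k + K)" "\<bar>z\<bar> \<le> real (k + K + 1)" using c by auto
  let ?g = "\<lambda>k. ennreal (real (k + K + 1) ^ 4) * (of_bool (z < - real (k + K)) + of_bool (z > real (k + K) \<and> B))"
  have "\<bar>z\<bar> ^ 4 \<le> real (k + K + 1) ^ 4" using k by (intro power_mono) auto
  then have z4: "z ^ 4 \<le> real (k + K + 1) ^ 4" by simp
  have "z < - real (k + K) \<or> z > real (k + K) \<and> B"
  proof (cases "z > 0")
    case True
    then have "B" using \<open>\<bar>z\<bar> > real K \<and> \<not> (z > 0 \<and> \<not> B)\<close> by simp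
    then show ?thesis using k True by simp
  next
    case False
    then show ?thesis using k by linarith
  qed
  then have ind: "(1::ennreal) \<le> of_bool (z < - real (k + K)) + of_bool (z > real (k + K) \<and> B)" by auto
  have "ennreal (of_bool (\<bar>z\<bar> > real K) * z ^ 4) \<le> ennreal (real (k + K + 1) ^ 4) * 1"
    using z4 by (auto intro!: ennreal_leI)
  also have "\<dots> \<le> ?g k" by (intro mult_left_mono ind) auto
  also have "\<dots> = sum ?g {k}" by simp
  also have "\<dots> \<le> (\<Sum>k. ?g k)" by (intro sum_le_suminf) auto
  finally show ?thesis by (rule order_trans) (simp add: add_increasing2)
next
  case False
  show ?thesis
  proof (cases "\<bar>z\<bar> > real K")
    case True
    with False have "z > 0 \<and> \<not> B" by simp
    then show ?thesis using True by (simp add: add_increasing)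
  qed simp
qed

lemma ennreal_le_one_plus_powr: "a \<le> 1 + ennreal_powr a (1 + \<epsilon>)" if "\<epsilon> > 0"
proof (cases a)
  case (real r)
  show ?thesis
  proof (cases "r \<le> 1")
    case True
    then have "a \<le> 1" using real by simp
    then show ?thesis by (rule order_trans) simp
  next
    case False
    then have "r powr 1 \<le> r powr (1 + \<epsilon>)" using that by (intro powr_mono) auto
    then have "a \<le> ennreal_powr a (1 + \<epsilon>)" using real False that by (simp add: ennreal_powr_def ennreal_leI)
    then show ?thesis by (rule order_trans) simp
  qed
qed (use that in \<open>simp add: ennreal_powr_def\<close>)

lemma le_G_fun: "t \<le> exp 1 + G_fun t" if "t \<ge> 0"
proof (cases "t \<le> exp 1")
  case True
  have "G_fun t \<ge> 0" unfolding G_fun_def using that by auto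
  then show ?thesis using True by linarith
next
  case False
  then have t: "t > exp 1" by simp
  moreover have "exp 1 > (1::real)" by simp
  ultimately have "t > 1" by linarith
  have "ln t \<ge> 1" using t \<open>t > 1\<close> by (simp add: ln_ge_iff)
  then have "t * 1 \<le> t * ln t" using that by (intro mult_left_mono) auto
  then show ?thesis using \<open>t > 1\<close> by (simp add: G_fun_def add_increasing)
qed

lemma G_fun_measurable [measurable]: "G_fun \<in> borel_measurable borel"
  unfolding G_fun_def[abs_def] by measurable

section \<open>Points without a near neighbour\<close>

context density_sample
begin

definition W :: "real^'d \<Rightarrow> ennreal" where
  "W x = (\<integral>\<^sup>+y. ennreal (ln (dist x y) ^ 4) \<partial>D)"

lemma W_measurable [measurable]: "W \<in> borel_measurable borel"
  unfolding W_def by measurable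

text \<open>Two comparisons lead from the functional to a plain moment:
  \<open>t \<le> exp 1 + G_fun t\<close> inside and
  \<open>a \<le> 1 + ennreal_powr a (1 + \<epsilon>)\<close> outside. The resulting integrability
  makes \<open>W\<close> usable as a majorant.\<close>

lemma W_integrable:
  assumes \<epsilon>: "\<epsilon> > 0" and K: "K_fun f 4 \<epsilon> < \<infinity>"
  shows "(\<integral>\<^sup>+x. W x \<partial>D) < \<infinity>"
proof -
  let ?G = "\<lambda>x y :: real^'d. ennreal (G_fun \<bar>(ln (dist x y)) ^ 4\<bar>)" and ?l = "\<lambda>x y :: real^'d. ennreal (ln (dist x y) ^ 4)"
  define KK where "KK = (\<lambda>x. \<integral>\<^sup>+ y\<in>UNIV - {x}. ?G x y * ennreal (f y) \<partial>lborel)"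
  have ind: "indicator (UNIV - {x}) y = (if y = x then 0 else 1 :: ennreal)" for x y :: "real^'d" by (simp add: indicator_def)
  have [measurable]: "KK \<in> borel_measurable borel" unfolding KK_def ind by measurable
  have "W x \<le> ennreal (exp 1) + KK x" for x
  proof -
    have "W x = (\<integral>\<^sup>+y. ennreal (f y) * ?l x y \<partial>lborel)"
      unfolding W_def by (rule nn_integral_density) auto
    also have "\<dots> \<le> (\<integral>\<^sup>+y. ennreal (exp 1) * ennreal (f y) + ?G x y * ennreal (f y) * indicator (UNIV - {x}) y \<partial>lborel)"
    proof (rule nn_integral_mono)
      fix y
      have "?l x y \<le> ennreal (exp 1) + ?G x y * indicator (UNIV - {x}) y"
      \<comment> \<open>On the diagonal the left side is \<open>0\<close> since
        \<open>ln 0 = 0\<close>, in agreement with the point removed in \<open>KK\<close>.\<close>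
      proof (cases "y = x")
        case False
        have "G_fun \<bar>(ln (dist x y)) ^ 4\<bar> \<ge> 0" unfolding G_fun_def by auto
        moreover have "?l x y \<le> ennreal (exp 1 + G_fun \<bar>(ln (dist x y)) ^ 4\<bar>)"
          using le_G_fun[of "\<bar>(ln (dist x y)) ^ 4\<bar>"] by (intro ennreal_leI) simp
        ultimately have "?l x y \<le> ennreal (exp 1) + ?G x y"
          by (simp only: ennreal_plus exp_ge_zero)
        then show ?thesis using False by (simp add: indicator_def)
      qed simp
      then have "ennreal (f y) * ?l x y \<le> ennreal (f y) * (ennreal (exp 1) + ?G x y * indicator (UNIV - {x}) y)"
        by (rule mult_left_mono) simp
      then show "ennreal (f y) * ?l x y \<le> ennreal (exp 1) * ennreal (f y) + ?G x y * ennreal (f y) * indicator (UNIV - {x}) y"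
        by (simp add: distrib_left mult_ac)
    qed
    also have "\<dots> = ennreal (exp 1) * (\<integral>\<^sup>+y. ennreal (f y) \<partial>lborel) + KK x"
      unfolding KK_def by (subst nn_integral_add) (auto simp: nn_integral_cmult ind)
    also have "(\<integral>\<^sup>+y. ennreal (f y) \<partial>lborel) = 1"
      using D.emeasure_space_1 by (simp add: emeasure_density)
    finally show ?thesis by simp
  qed
  then have "(\<integral>\<^sup>+x. W x \<partial>D) \<le> (\<integral>\<^sup>+x. (ennreal (exp 1) + 1) + ennreal_powr (KK x) (1 + \<epsilon>) \<partial>D)"
    using ennreal_le_one_plus_powr[OF \<epsilon>]
    by (intro nn_integral_mono) (metis (no_types, lifting) add.assoc add_left_mono order_trans)
  also have "\<dots> = (ennreal (exp 1) + 1) + (\<integral>\<^sup>+x. ennreal_powr (KK x) (1 + \<epsilon>) \<partial>D)"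
    using D.emeasure_space_1 by (subst nn_integral_add) auto
  also have "(\<integral>\<^sup>+x. ennreal_powr (KK x) (1 + \<epsilon>) \<partial>D) = (\<integral>\<^sup>+x. ennreal (f x) * ennreal_powr (KK x) (1 + \<epsilon>) \<partial>lborel)"
    by (rule nn_integral_density) auto
  also have "\<dots> = K_fun f 4 \<epsilon>"
    unfolding K_fun_def KK_def by (simp add: mult.commute)
  finally show ?thesis using K by (auto simp: less_top[symmetric] top_unique)
qed

text \<open>The constant \<open>27\<close> is that of \<open>power4_sum_le\<close>, applied to the
  three summands \<open>d * ln \<rho>\<close>, \<open>ln (N - 1)\<close> and
  \<open>ln V + \<gamma>\<close> of \<open>\<zeta>\<close>.\<close>

definition far_bound :: "real \<Rightarrow> nat \<Rightarrow> ennreal" where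
  "far_bound R N = 27 * (\<integral>\<^sup>+x. (ennreal (real d ^ 4) * W x + ennreal (ln (real N - 1) ^ 4 + (ln V + \<gamma>) ^ 4))
      * ennreal ((1 - pball R x) ^ (N - 2)) \<partial>D)"

text \<open>
  One point \<open>X\<^sub>j\<close> is set aside to bound \<open>\<rho>\<^sub>i\<close> from above; the remaining \<open>N - 2\<close> points, all at distance
  more than \<open>R\<close>, contribute the small factor.
\<close>

lemma far_bound_le:
  assumes N: "N \<ge> 2" "i \<in> {1..N}" and R: "R > 0"
  shows "(\<integral>\<^sup>+\<omega>. ennreal (of_bool (\<zeta> N i \<omega> > 0 \<and> \<not> \<rho> N i \<omega> \<le> R) * \<zeta> N i \<omega> ^ 4) \<partial>P) \<le> far_bound R N"
proof -
  obtain j where j: "j \<in> {1..N}" "i \<noteq> j"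
    using N by (cases "i = 1") (auto intro: that[of 1] that[of 2])
  define c where "c = ln V + \<gamma>"
  let ?l = "ln (real N - 1) ^ 4 + c ^ 4" and ?far = "\<lambda>\<omega>. of_bool (\<forall>k\<in>{1..N} - {i, j}. dist (Xs i \<omega>) (Xs k \<omega>) > R)"
  define h where "h = (\<lambda>x y :: real^'d. ennreal (27 * (real d ^ 4 * ln (dist x y) ^ 4 + (?l))))"
  have "(\<integral>\<^sup>+\<omega>. ennreal (of_bool (\<zeta> N i \<omega> > 0 \<and> \<not> \<rho> N i \<omega> \<le> R) * \<zeta> N i \<omega> ^ 4) \<partial>P)
    \<le> (\<integral>\<^sup>+\<omega>. h (Xs i \<omega>) (Xs j \<omega>) * ?far \<omega> \<partial>P)"
  proof (rule nn_integral_mono)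
    fix \<omega>
    let ?\<rho> = "\<rho> N i \<omega>" and ?\<zeta> = "\<zeta> N i \<omega>" and ?D = "dist (Xs i \<omega>) (Xs j \<omega>)"
    show "ennreal (of_bool (?\<zeta> > 0 \<and> \<not> ?\<rho> \<le> R) * ?\<zeta> ^ 4)
      \<le> h (Xs i \<omega>) (Xs j \<omega>) * ?far \<omega>"
    proof (cases "?\<zeta> > 0 \<and> \<not> ?\<rho> \<le> R")
      case True
      have \<rho>: "?\<rho> > 0" "?\<rho> > R" using True R by auto
      have n: "real N - 1 \<ge> 1" using N by simp
      have D: "?\<rho> \<le> ?D" using j by (intro nn_dist_le) auto
      have "?\<zeta> = real d * ln ?\<rho> + ln (real N - 1) + c"
        unfolding zeta_stat_def d_def[symmetric] c_def using \<rho> n V_pos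
        by (simp add: ln_mult ln_realpow)
      also have "\<dots> \<le> real d * ln ?D + ln (real N - 1) + c"
        using D \<rho> less_le_trans[OF \<rho>(1) D] by (intro add_right_mono mult_left_mono) (simp_all add: ln_le_cancel_iff)
      \<comment> \<open>An upper bound may be raised to the fourth power only because
        \<open>?\<zeta>\<close> is positive here.\<close>
      finally have "?\<zeta> ^ 4 \<le> (real d * ln ?D + ln (real N - 1) + c) ^ 4" using True by (intro power_mono) auto
      also have "\<dots> \<le> 27 * ((real d * ln ?D) ^ 4 + ln (real N - 1) ^ 4 + c ^ 4)" by (rule power4_sum_le)
      finally have "ennreal (?\<zeta> ^ 4) \<le> h (Xs i \<omega>) (Xs j \<omega>)"
        unfolding h_def by (intro ennreal_leI) (simp add: power_mult_distrib)
      moreover have "\<forall>k\<in>{1..N} - {i, j}. dist (Xs i \<omega>) (Xs k \<omega>) > R"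
        using nn_dist_greater_iff[OF N, THEN iffD1, OF \<rho>(2)] by auto
      ultimately show ?thesis using True by simp
    qed auto
  qed
  also have "\<dots> = (\<integral>\<^sup>+x. (\<integral>\<^sup>+y. h x y \<partial>D) * ennreal ((1 - pball R x) ^ (N - 2)) \<partial>D)"
    by (rule nn_integral_nn_dist[OF N j]) (unfold h_def, measurable)
  also have "\<dots> = (\<integral>\<^sup>+x. 27 * ((ennreal (real d ^ 4) * W x + ennreal (?l))
      * ennreal ((1 - pball R x) ^ (N - 2))) \<partial>D)"
  proof (rule nn_integral_cong)
    fix x
    have "(\<integral>\<^sup>+y. h x y \<partial>D) = (\<integral>\<^sup>+y. 27 * (ennreal (real d ^ 4) * ennreal (ln (dist x y) ^ 4) + ennreal (?l)) \<partial>D)"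
      unfolding h_def by (intro nn_integral_cong) (simp add: ennreal_mult' ennreal_plus)
    also have "\<dots> = 27 * (ennreal (real d ^ 4) * W x + ennreal (?l))"
      unfolding W_def using D.emeasure_space_1 by (subst nn_integral_cmult, simp, subst nn_integral_add) (auto simp: nn_integral_cmult)
    finally show "(\<integral>\<^sup>+y. h x y \<partial>D) * ennreal ((1 - pball R x) ^ (N - 2)) = 27 * ((ennreal (real d ^ 4) * W x + ennreal (?l))
      * ennreal ((1 - pball R x) ^ (N - 2)))" by (simp only: mult.assoc)
  qed
  also have "\<dots> = far_bound R N"
    unfolding far_bound_def c_def by (rule nn_integral_cmult) measurable
  finally show ?thesis .
qed

text \<open>For the part with \<open>W\<close>, dominated convergence suffices, since the mass of a
  ball of radius \<open>R\<close> is almost surely positive. The logarithmic part grows with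
  \<open>N\<close> and needs a rate: the negative moment gives a factor of order
  \<open>N powr - \<epsilon>\<close>, which wins against \<open>ln (N - 1) ^ 4\<close>.\<close>

lemma far_bound_tendsto:
  assumes W: "(\<integral>\<^sup>+x. W x \<partial>D) < \<infinity>" and \<epsilon>: "\<epsilon> > 0" and R: "R > 0" and T: "T_fun f \<epsilon> R < \<infinity>"
  shows "far_bound R \<longlonglongrightarrow> 0"
proof -
  let ?I = "\<lambda>N. \<integral>\<^sup>+x. W x * ennreal ((1 - pball R x) ^ (N - 2)) \<partial>D"
  define c where "c = ln V + \<gamma>"
  obtain B where B: "T_fun f \<epsilon> R = ennreal B" "B \<ge> 0" using T by (cases "T_fun f \<epsilon> R") auto
  have VR: "V * R ^ d > 0" using V_pos R by simp
  have 1: "?I \<longlonglongrightarrow> (\<integral>\<^sup>+x. 0 \<partial>D)"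
  proof (rule nn_integral_dominated_convergence[where w = W])
    show "AE x in D. W x * ennreal ((1 - pball R x) ^ (j - 2)) \<le> W x" for j
    proof (rule AE_I2)
      fix x
      have "W x * ennreal ((1 - pball R x) ^ (j - 2)) \<le> W x * 1"
        by (intro mult_left_mono) (auto intro!: power_le_one)
      then show "W x * ennreal ((1 - pball R x) ^ (j - 2)) \<le> W x" by simp
    qed
    have "AE x in D. W x \<noteq> \<infinity>" using W by (intro nn_integral_PInf_AE) auto
    then show "AE x in D. (\<lambda>N. W x * ennreal ((1 - pball R x) ^ (N - 2))) \<longlonglongrightarrow> 0"
      using AE_pball_pos[OF R order_refl \<epsilon> T]
    proof eventually_elim
      case (elim x)
      have "(\<lambda>n. (1 - pball R x) ^ n) \<longlonglongrightarrow> 0"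
        using elim pball_bounds[of R x] by (intro LIMSEQ_realpow_zero) (auto simp: less_eq_real_def)
      moreover have "filterlim (\<lambda>N::nat. N - 2) at_top at_top" by (rule filterlim_minus_const_nat_at_top)
      ultimately have "(\<lambda>N. (1 - pball R x) ^ (N - 2)) \<longlonglongrightarrow> 0" by (rule filterlim_compose)
      then have "(\<lambda>N. ennreal ((1 - pball R x) ^ (N - 2))) \<longlonglongrightarrow> ennreal 0" by (rule tendsto_ennrealI)
      then have "(\<lambda>N. W x * ennreal ((1 - pball R x) ^ (N - 2))) \<longlonglongrightarrow> W x * ennreal 0"
        using elim by (intro ennreal_tendsto_cmult) (auto simp: less_top)
      then show ?case by simp
    qed
  qed (use W in auto)
  define b where "b = (\<lambda>N. (ln (real N - 1) ^ 4 + c ^ 4) * (\<epsilon> powr \<epsilon> * (real (N - 2) * (V * R ^ d)) powr - \<epsilon> * B))"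
  have "b \<longlonglongrightarrow> 0"
  proof -
    have "(\<lambda>N. (ln (real N - 1) ^ 4 + c ^ 4) * (real (N - 2)) powr - \<epsilon>) \<longlonglongrightarrow> 0"
      using \<epsilon> by real_asymp
    then have "(\<lambda>N. (\<epsilon> powr \<epsilon> * (V * R ^ d) powr - \<epsilon> * B) * ((ln (real N - 1) ^ 4 + c ^ 4) * (real (N - 2)) powr - \<epsilon>)) \<longlonglongrightarrow> (\<epsilon> powr \<epsilon> * (V * R ^ d) powr - \<epsilon> * B) * 0"
      by (intro tendsto_mult tendsto_const)
    then show ?thesis unfolding b_def by (simp add: powr_mult mult_ac)
  qed
  then have b: "(\<lambda>N. ennreal (b N)) \<longlonglongrightarrow> 0" using tendsto_ennrealI[of b 0] by simp
  have "(\<lambda>N. 27 * (ennreal (real d ^ 4) * ?I N + ennreal (b N))) \<longlonglongrightarrow>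
      27 * (ennreal (real d ^ 4) * (\<integral>\<^sup>+x. 0 \<partial>D) + 0)"
    by (intro ennreal_tendsto_cmult tendsto_add 1 b) (auto simp: less_top[symmetric])
  then have lim: "(\<lambda>N. 27 * (ennreal (real d ^ 4) * ?I N + ennreal (b N))) \<longlonglongrightarrow> 0"
    by simp
  have "\<forall>\<^sub>F N in sequentially. far_bound R N \<le> 27 * (ennreal (real d ^ 4) * ?I N + ennreal (b N))"
  \<comment> \<open>From \<open>3\<close> on, the exponent \<open>N - 2\<close> is positive, as the
    power bound requires.\<close>
  proof (rule eventually_sequentiallyI[of 3])
    fix N :: nat assume N: "N \<ge> 3"
    let ?e = "ennreal (ln (real N - 1) ^ 4 + c ^ 4)"
    have "far_bound R N = 27 * (\<integral>\<^sup>+x. ennreal (real d ^ 4) * (W x * ennreal ((1 - pball R x) ^ (N - 2))) + ?e * ennreal ((1 - pball R x) ^ (N - 2)) \<partial>D)"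
      unfolding far_bound_def c_def by (simp add: distrib_right mult.assoc)
    also have "\<dots> = 27 * (ennreal (real d ^ 4) * ?I N + ?e * (\<integral>\<^sup>+x. ennreal ((1 - pball R x) ^ (N - 2)) \<partial>D))"
      by (subst nn_integral_add) (auto simp: nn_integral_cmult)
    also have "?e * (\<integral>\<^sup>+x. ennreal ((1 - pball R x) ^ (N - 2)) \<partial>D) \<le> ?e * (ennreal (\<epsilon> powr \<epsilon> * (real (N - 2) * (V * R ^ d)) powr - \<epsilon>) * T_fun f \<epsilon> R)"
      using N by (intro mult_left_mono nn_integral_one_minus_pball_power_le R \<epsilon> T) auto
    also have "\<dots> = ennreal (b N)" unfolding B(1) b_def using B(2) by (simp add: ennreal_mult')
    finally show "far_bound R N \<le> 27 * (ennreal (real d ^ 4) * ?I N + ennreal (b N))"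
      by (simp add: mult_left_mono add_left_mono)
  qed
  then show ?thesis by (rule tendsto_sandwich[OF _ _ tendsto_const lim, rotated]) simp
qed

text \<open>Half of \<open>e\<close> goes to the unit layers, bounded by the remainder of a
  convergent series with exponentially decaying terms, and half to the points without a neighbour
  within \<open>R2\<close>, which is available only for large \<open>N\<close>.\<close>

lemma zeta_fourth_moment_uniformly_integrable:
  assumes W: "(\<integral>\<^sup>+x. W x \<partial>D) < \<infinity>"
    and Q: "\<epsilon>1 > 0" "R1 > 0" "Q_fun f \<epsilon>1 R1 < \<infinity>" and T: "\<epsilon>2 > 0" "R2 > 0" "T_fun f \<epsilon>2 R2 < \<infinity>"
    and e: "e > 0"
  shows "\<exists>K>0. \<exists>N0. \<forall>N\<ge>N0. \<forall>i\<in>{1..N}.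
        (\<integral>\<^sup>+\<omega>. ennreal (of_bool (\<bar>\<zeta> N i \<omega>\<bar> > K) * \<zeta> N i \<omega> ^ 4) \<partial>P) \<le> ennreal e"
proof -
  obtain C1 u0 where C1: "C1 \<ge> 0" "\<And>u N i. u \<ge> u0 \<Longrightarrow> N \<ge> 2 \<Longrightarrow> i \<in> {1..N} \<Longrightarrow>
    emeasure P {\<omega> \<in> space P. \<zeta> N i \<omega> < - u} \<le> ennreal (C1 * exp (- (min 1 \<epsilon>1 * u)))"
    by (rule zeta_lower_tail[OF Q]) blast
  obtain C2 where C2: "C2 \<ge> 0" "\<And>u N i. u \<ge> 0 \<Longrightarrow> N \<ge> 2 \<Longrightarrow> i \<in> {1..N} \<Longrightarrow>
    emeasure P {\<omega> \<in> space P. \<zeta> N i \<omega> > u \<and> \<rho> N i \<omega> \<le> R2} \<le> ennreal (C2 * exp (- (\<epsilon>2 * u)))"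
    by (rule zeta_upper_tail[OF T]) blast
  \<comment> \<open>The slower of the decay rates of the two tails, so that one series dominates
    both.\<close>
  define c where "c = min (min 1 \<epsilon>1) \<epsilon>2"
  have c: "c > 0" "c \<le> min 1 \<epsilon>1" "c \<le> \<epsilon>2" using Q T by (auto simp: c_def)
  define s where "s = (\<lambda>k::nat. real (k + 1) ^ 4 * ((C1 + C2) * exp (- (c * real k))))"
  have s0: "s k \<ge> 0" for k using C1 C2 by (simp add: s_def)
  have sums: "summable s"
  proof (rule summable_comparison_test_bigo)
    show "summable (\<lambda>k. norm (1 / real k ^ 2))" using inverse_power_summable[of 2, where 'a = real] by (simp add: inverse_eq_divide)
    have "(\<lambda>k. real (k + 1) ^ 4 * exp (- (c * real k))) \<in> O(\<lambda>k. 1 / real k ^ 2)" using c(1) by real_asymp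
    then have "(\<lambda>k. (C1 + C2) * (real (k + 1) ^ 4 * exp (- (c * real k)))) \<in> O(\<lambda>k. 1 / real k ^ 2)"
      by (rule landau_o.big.mult_in_1[OF _ , rotated, THEN iffD1[OF refl]] | simp)+
    then show "s \<in> O(\<lambda>k. 1 / real k ^ 2)" by (simp add: s_def mult_ac)
  qed
  obtain K0 where K0: "\<And>n. n \<ge> K0 \<Longrightarrow> norm (\<Sum>k. s (k + n)) < e / 2"
    using suminf_exist_split[OF half_gt_zero[OF e] sums] by blast
  \<comment> \<open>\<open>K0\<close> makes the remainder small, \<open>u0\<close> is where the
    lower tail bound starts, and \<open>1\<close> keeps the level positive.\<close>
  define K where "K = max (max K0 (nat \<lceil>u0\<rceil>)) 1"
  have K: "K \<ge> K0" "real K \<ge> u0" "K \<ge> 1" unfolding K_def by (auto, linarith)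
  have "\<forall>\<^sub>F N in sequentially. far_bound R2 N < ennreal (e / 2)"
    using e by (intro order_tendstoD(2)[OF far_bound_tendsto[OF W T]]) auto
  then obtain N1 where N1: "\<And>N. N \<ge> N1 \<Longrightarrow> far_bound R2 N < ennreal (e / 2)"
    unfolding eventually_sequentially by blast
  show ?thesis
  proof (intro exI conjI allI impI ballI)
    show "real K > 0" using K by simp
    fix N i assume N': "N \<ge> max N1 2" and i: "i \<in> {1..N}"
    then have N: "N \<ge> N1" "N \<ge> 2" by auto
    note [measurable] = zeta_measurable[OF i]
    let ?w = "\<lambda>k. ennreal (real (k + K + 1) ^ 4)"
    let ?far = "\<lambda>\<omega>. of_bool (\<zeta> N i \<omega> > 0 \<and> \<not> \<rho> N i \<omega> \<le> R2) * \<zeta> N i \<omega> ^ 4"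
    let ?L = "\<lambda>k \<omega>. of_bool (\<zeta> N i \<omega> < - real (k + K)) + of_bool (\<zeta> N i \<omega> > real (k + K) \<and> \<rho> N i \<omega> \<le> R2) :: ennreal"
    have Lm: "?L k \<in> borel_measurable P" for k unfolding of_bool_def by measurable
    have Lk: "(\<integral>\<^sup>+\<omega>. ?w k * ?L k \<omega> \<partial>P) \<le> ennreal (s (k + K))" for k
    proof -
      have u: "real (k + K) \<ge> u0" "real (k + K) \<ge> 0" using K by auto
      have "(\<integral>\<^sup>+\<omega>. ?L k \<omega> \<partial>P) = (\<integral>\<^sup>+\<omega>. indicator {\<omega> \<in> space P. \<zeta> N i \<omega> < - real (k + K)} \<omega>
          + indicator {\<omega> \<in> space P. \<zeta> N i \<omega> > real (k + K) \<and> \<rho> N i \<omega> \<le> R2} \<omega> \<partial>P)"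
        by (intro nn_integral_cong) (auto split: split_indicator)
      also have "\<dots> = emeasure P {\<omega> \<in> space P. \<zeta> N i \<omega> < - real (k + K)} + emeasure P {\<omega> \<in> space P. \<zeta> N i \<omega> > real (k + K) \<and> \<rho> N i \<omega> \<le> R2}"
        by (subst nn_integral_add) auto
      also have "\<dots> \<le> ennreal (C1 * exp (- (min 1 \<epsilon>1 * real (k + K)))) + ennreal (C2 * exp (- (\<epsilon>2 * real (k + K))))"
        by (intro add_mono C1(2) C2(2) u N i)
      also have "\<dots> = ennreal (C1 * exp (- (min 1 \<epsilon>1 * real (k + K))) + C2 * exp (- (\<epsilon>2 * real (k + K))))"
        using C1 C2 by simp
      also have "\<dots> \<le> ennreal ((C1 + C2) * exp (- (c * real (k + K))))"
        unfolding distrib_right using C1(1) C2(1) c u by (intro ennreal_leI add_mono mult_left_mono) (auto intro: mult_right_mono)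
      finally have "?w k * (\<integral>\<^sup>+\<omega>. ?L k \<omega> \<partial>P) \<le> ?w k * ennreal ((C1 + C2) * exp (- (c * real (k + K))))"
        by (rule mult_left_mono) simp
      also have "\<dots> = ennreal (s (k + K))" using C1(1) C2(1) by (subst ennreal_mult[symmetric]) (auto simp: s_def)
      finally show ?thesis using Lm[of k] by (simp add: nn_integral_cmult)
    qed
    have "(\<integral>\<^sup>+\<omega>. ennreal (of_bool (\<bar>\<zeta> N i \<omega>\<bar> > real K) * \<zeta> N i \<omega> ^ 4) \<partial>P)
      \<le> (\<integral>\<^sup>+\<omega>. (\<Sum>k. ?w k * ?L k \<omega>) + ennreal (?far \<omega>) \<partial>P)"
      by (intro nn_integral_mono tails_to_fourth_moment)
    also have "\<dots> = (\<integral>\<^sup>+\<omega>. (\<Sum>k. ?w k * ?L k \<omega>) \<partial>P)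
        + (\<integral>\<^sup>+\<omega>. ennreal (?far \<omega>) \<partial>P)"
      using Lm by (intro nn_integral_add borel_measurable_suminf_order borel_measurable_times_ennreal) (auto simp: of_bool_def)
    also have "(\<integral>\<^sup>+\<omega>. (\<Sum>k. ?w k * ?L k \<omega>) \<partial>P) = (\<Sum>k. \<integral>\<^sup>+\<omega>. ?w k * ?L k \<omega> \<partial>P)"
      using Lm by (intro nn_integral_suminf borel_measurable_times_ennreal) auto
    also have "\<dots> \<le> (\<Sum>k. ennreal (s (k + K)))" by (intro suminf_le Lk) auto
    also have "\<dots> = ennreal (\<Sum>k. s (k + K))"
      using s0 sums by (intro suminf_ennreal2) (auto simp: summable_iff_shift)
    also have "\<dots> \<le> ennreal (e / 2)" using K0[OF K(1)] by (intro ennreal_leI) auto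
    also have "(\<integral>\<^sup>+\<omega>. ennreal (?far \<omega>) \<partial>P) \<le> ennreal (e / 2)"
      using far_bound_le[OF N(2) i T(2)] N1[OF N(1)] by simp
    also have "ennreal (e / 2) + ennreal (e / 2) = ennreal e" using e by (subst ennreal_plus[symmetric]) auto
    finally show "(\<integral>\<^sup>+\<omega>. ennreal (of_bool (\<bar>\<zeta> N i \<omega>\<bar> > real K) * \<zeta> N i \<omega> ^ 4) \<partial>P) \<le> ennreal e"
      by (simp add: add_mono)
  qed
qed

text \<open>The square of the logarithm is dominated by a positive and a negative power of
  \<open>f\<close>. Their moments are inherited from ball averages by Fatou's lemma, along radii
  tending to \<open>0\<close> that stay within both \<open>R1\<close> and \<open>R2\<close>.\<close>

lemma ln_density_square_integrable:
  assumes Q: "\<epsilon>1 > 0" "R1 > 0" "Q_fun f \<epsilon>1 R1 < \<infinity>" and T: "\<epsilon>2 > 0" "R2 > 0" "T_fun f \<epsilon>2 R2 < \<infinity>"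
  shows "integrable D (\<lambda>x. (ln (f x))\<^sup>2)"
proof -
  define r where "r = (\<lambda>n::nat. min R1 R2 / (real n + 1))"
  have r: "0 < r n" "r n \<le> R1" "r n \<le> R2" for n
  proof -
    have "r n \<le> min R1 R2 / 1" unfolding r_def using Q T by (intro divide_left_mono) auto
    then show "r n \<le> R1" "r n \<le> R2" by auto
    show "0 < r n" unfolding r_def using Q T by simp
  qed
  have "r \<longlonglongrightarrow> 0" unfolding r_def by real_asymp
  then have rr: "filterlim r (at_right 0) sequentially"
    unfolding filterlim_at using r(1) by (auto intro!: always_eventually less_imp_neq[symmetric])
  have q: "AE x in D. (\<lambda>n. q (r n) x) \<longlonglongrightarrow> f x"
    using pball_div_tendsto by eventually_elim (rule filterlim_compose[OF _ rr])
  have A: "(\<integral>\<^sup>+x. ennreal (f x powr \<epsilon>1) \<partial>D) < \<infinity>"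
  proof -
    have "(\<integral>\<^sup>+x. ennreal (f x powr \<epsilon>1) \<partial>D) \<le> (\<integral>\<^sup>+x. liminf (\<lambda>n. ennreal (q (r n) x powr \<epsilon>1)) \<partial>D)"
    proof (rule nn_integral_mono_AE, use q AE_D_pos in eventually_elim)
      case (elim x)
      then have "(\<lambda>n. ennreal (q (r n) x powr \<epsilon>1)) \<longlonglongrightarrow> ennreal (f x powr \<epsilon>1)"
        by (intro tendsto_ennrealI tendsto_powr tendsto_const) auto
      from lim_imp_Liminf[OF _ this] show ?case by simp
    qed
    also have "\<dots> \<le> liminf (\<lambda>n. \<integral>\<^sup>+x. ennreal (q (r n) x powr \<epsilon>1) \<partial>D)"
      by (intro nn_integral_liminf) auto
    also have "\<dots> \<le> liminf (\<lambda>n. Q_fun f \<epsilon>1 R1)"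
      by (intro Liminf_mono always_eventually allI nn_integral_q_powr_le r Q)
    also have "\<dots> = Q_fun f \<epsilon>1 R1" by (simp add: Liminf_const)
    finally show ?thesis using Q by simp
  qed
  have B: "(\<integral>\<^sup>+x. ennreal (f x powr - \<epsilon>2) \<partial>D) < \<infinity>"
  proof -
    have "(\<integral>\<^sup>+x. ennreal (f x powr - \<epsilon>2) \<partial>D) \<le> (\<integral>\<^sup>+x. liminf (\<lambda>n. q_inv (r n) \<epsilon>2 x) \<partial>D)"
    proof (rule nn_integral_mono_AE, use q AE_D_pos in eventually_elim)
      case (elim x)
      then have "(\<lambda>n. ennreal (q (r n) x powr - \<epsilon>2)) \<longlonglongrightarrow> ennreal (f x powr - \<epsilon>2)"
        by (intro tendsto_ennrealI tendsto_powr tendsto_const) auto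
      \<comment> \<open>The limit \<open>f x\<close> is positive, so the infinite branch of
        \<open>q_inv\<close> is eventually irrelevant.\<close>
      moreover have "\<forall>\<^sub>F n in sequentially. q (r n) x > 0" using elim by (intro order_tendstoD(1))
      then have "\<forall>\<^sub>F n in sequentially. ennreal (q (r n) x powr - \<epsilon>2) = q_inv (r n) \<epsilon>2 x"
        by eventually_elim (rule if_not_P[symmetric], rule less_imp_neq[symmetric])
      ultimately have "(\<lambda>n. q_inv (r n) \<epsilon>2 x) \<longlonglongrightarrow> ennreal (f x powr - \<epsilon>2)"
        by (rule Lim_transform_eventually)
      then have "liminf (\<lambda>n. q_inv (r n) \<epsilon>2 x) = ennreal (f x powr - \<epsilon>2)"
        by (intro lim_imp_Liminf) auto
      then show ?case by simp
    qed
    also have "\<dots> \<le> liminf (\<lambda>n. \<integral>\<^sup>+x. q_inv (r n) \<epsilon>2 x \<partial>D)"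
      by (intro nn_integral_liminf) measurable
    also have "\<dots> \<le> liminf (\<lambda>n. T_fun f \<epsilon>2 R2)"
      by (intro Liminf_mono always_eventually allI nn_integral_q_powr_neg_le r T)
    also have "\<dots> = T_fun f \<epsilon>2 R2" by (simp add: Liminf_const)
    finally show ?thesis using T by simp
  qed
  have up: "(ln t)\<^sup>2 \<le> 4 / \<epsilon>\<^sup>2 * t powr \<epsilon>" if "t \<ge> 1" "\<epsilon> > 0" for t \<epsilon> :: real
  proof -
    have "ln t \<le> t powr (\<epsilon> / 2) / (\<epsilon> / 2)" using that by (intro ln_powr_bound) auto
    then have "(ln t)\<^sup>2 \<le> (t powr (\<epsilon> / 2) / (\<epsilon> / 2))\<^sup>2" using that by (intro power_mono) auto
    also have "\<dots> = 4 / \<epsilon>\<^sup>2 * (t powr (\<epsilon> / 2) * t powr (\<epsilon> / 2))" by (simp add: power2_eq_square field_simps)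
    also have "t powr (\<epsilon> / 2) * t powr (\<epsilon> / 2) = t powr \<epsilon>" by (simp flip: powr_add)
    finally show ?thesis .
  qed
  have bound: "(ln t)\<^sup>2 \<le> 4 / \<epsilon>1\<^sup>2 * t powr \<epsilon>1 + 4 / \<epsilon>2\<^sup>2 * t powr - \<epsilon>2" if "t > 0" for t
  proof (cases "t \<ge> 1")
    case True
    then show ?thesis using up[OF True Q(1)] by (simp add: add_increasing2)
  next
    case False
    have "(ln (1 / t))\<^sup>2 \<le> 4 / \<epsilon>2\<^sup>2 * (1 / t) powr \<epsilon>2" using False that by (intro up T) auto
    then have "(ln t)\<^sup>2 \<le> 4 / \<epsilon>2\<^sup>2 * t powr - \<epsilon>2" using that by (simp add: ln_div powr_divide powr_minus_divide)
    then show ?thesis by (simp add: add_increasing)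
  qed
  have "integrable D (\<lambda>x. 4 / \<epsilon>1\<^sup>2 * f x powr \<epsilon>1 + 4 / \<epsilon>2\<^sup>2 * f x powr - \<epsilon>2)"
    using A B by (intro Bochner_Integration.integrable_add integrable_mult_right integrableI_nonneg) auto
  then show ?thesis
  proof (rule Bochner_Integration.integrable_bound)
    show "AE x in D. norm ((ln (f x))\<^sup>2) \<le> norm (4 / \<epsilon>1\<^sup>2 * f x powr \<epsilon>1 + 4 / \<epsilon>2\<^sup>2 * f x powr - \<epsilon>2)"
      using AE_D_pos by eventually_elim (use bound in force)
  qed simp
qed

section \<open>Consistency\<close>

lemma varentropy_eq: "varentropy f = (\<integral>x. (ln (f x))\<^sup>2 \<partial>D) - (\<integral>x. ln (f x) \<partial>D)\<^sup>2"
proof -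
  have "(LINT x:support_set f|lborel. f x * g (f x)) = (\<integral>x. g (f x) \<partial>D)" if [measurable]: "g \<in> borel_measurable borel" for g :: "real \<Rightarrow> real"
  proof -
    have "(\<integral>x. g (f x) \<partial>D) = (\<integral>x. f x *\<^sub>R g (f x) \<partial>lborel)"
      using f_nonneg by (intro integral_density) auto
    also have "\<dots> = (LINT x:support_set f|lborel. f x * g (f x))"
      unfolding set_lebesgue_integral_def
    proof (intro Bochner_Integration.integral_cong refl)
      fix x show "f x *\<^sub>R g (f x) = indicator (support_set f) x *\<^sub>R (f x * g (f x))"
        using f_nonneg[of x] by (auto simp: support_set_def indicator_def)
    qed
    finally show ?thesis by simp
  qed
  from this[of "\<lambda>t. (ln t)\<^sup>2"] this[of ln] show ?thesis by (simp add: varentropy_def)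
qed

lemma V_est_eq: "N \<ge> 1 \<Longrightarrow> V_est N x = (\<Sum>i=1..N. (zeta_stat N x i)\<^sup>2) / N - ((\<Sum>i=1..N. zeta_stat N x i) / N)\<^sup>2 - pi\<^sup>2 / 6"
  for x :: "nat \<Rightarrow> real^'d"
proof -
  assume N: "N \<ge> 1"
  have "(\<Sum>i=1..N. (zeta_stat N x i)\<^sup>2 - pi\<^sup>2 / 6) = (\<Sum>i=1..N. (zeta_stat N x i)\<^sup>2) - real N * (pi\<^sup>2 / 6)"
    by (simp add: sum_subtractf)
  then show ?thesis using N by (simp add: V_est_def S2_est_def H_est_def diff_divide_distrib)
qed

text \<open>The empirical variance of the \<open>\<zeta>\<close> converges to the variance of the
  mixture, which exceeds the varentropy by \<open>pi\<^sup>2 / 6\<close>; the estimator subtracts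
  the same amount, so both errors coincide for \<open>N \<ge> 1\<close>.\<close>

theorem V_est_consistent:
  assumes \<epsilon>: "\<epsilon>0 > 0" and K: "K_fun f 4 \<epsilon>0 < \<infinity>"
    and Q: "\<epsilon>1 > 0" "R1 > 0" "Q_fun f \<epsilon>1 R1 < \<infinity>" and T: "\<epsilon>2 > 0" "R2 > 0" "T_fun f \<epsilon>2 R2 < \<infinity>"
  shows "(\<lambda>N. \<integral>\<^sup>+ \<omega>. ennreal ((V_est N (\<lambda>i. Xs i \<omega>) - varentropy f)\<^sup>2) \<partial>P) \<longlonglongrightarrow> 0"
proof -
  note ln2 = ln_density_square_integrable[OF Q T]
  note G = gumbel_mixture[OF D_prob sets_D f_measurable AE_D_pos ln2]
  let ?Q = "D \<Otimes>\<^sub>M std_exp" and ?L = "\<lambda>(x, t). ln t + \<gamma> - ln (f x)"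
  have "(\<lambda>N. \<integral>\<^sup>+\<omega>. ennreal (((\<Sum>i=1..N. (\<zeta> N i \<omega>)\<^sup>2) / N - ((\<Sum>i=1..N. \<zeta> N i \<omega>) / N)\<^sup>2
      - ((\<integral>q. (?L q)\<^sup>2 \<partial>?Q) - (\<integral>q. ?L q \<partial>?Q)\<^sup>2))\<^sup>2) \<partial>P) \<longlonglongrightarrow> 0"
  proof (rule empirical_variance_tendsto[OF _ G(1,2,3)])
    show "(\<lambda>N. expectation (\<lambda>\<omega>. \<bar>(\<Sum>i=1..N. of_bool (\<zeta> N i \<omega> > u)) / N - measure ?Q {q \<in> space ?Q. ?L q > u}\<bar>)) \<longlonglongrightarrow> 0" for u
      unfolding G(5) using empirical_tail_zeta_tendsto[of u] by (simp only: tail_def)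
    show "\<exists>K>0. \<exists>N0. \<forall>N\<ge>N0. \<forall>i\<in>{1..N}.
        (\<integral>\<^sup>+\<omega>. ennreal (of_bool (\<bar>\<zeta> N i \<omega>\<bar> > K) * \<zeta> N i \<omega> ^ 4) \<partial>P) \<le> ennreal e" if "e > 0" for e
      by (rule zeta_fourth_moment_uniformly_integrable[OF W_integrable[OF \<epsilon> K] Q T that])
  qed (rule zeta_measurable)
  then show ?thesis
  proof (rule Lim_transform_eventually)
    show "\<forall>\<^sub>F N in sequentially. (\<integral>\<^sup>+\<omega>. ennreal (((\<Sum>i=1..N. (\<zeta> N i \<omega>)\<^sup>2) / N - ((\<Sum>i=1..N. \<zeta> N i \<omega>) / N)\<^sup>2
      - ((\<integral>q. (?L q)\<^sup>2 \<partial>?Q) - (\<integral>q. ?L q \<partial>?Q)\<^sup>2))\<^sup>2) \<partial>P) = (\<integral>\<^sup>+ \<omega>. ennreal ((V_est N (\<lambda>i. Xs i \<omega>) - varentropy f)\<^sup>2) \<partial>P)"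
      unfolding G(4) by (rule eventually_sequentiallyI[of 1]) (simp add: V_est_eq varentropy_eq algebra_simps)
  qed
qed

end

theorem theorem2:
  fixes P :: "'w measure"
    and X :: "'w \<Rightarrow> real^'d"
    and Xs :: "nat \<Rightarrow> 'w \<Rightarrow> real^'d"
    and f :: "real^'d \<Rightarrow> real"
    and \<epsilon>0 \<epsilon>1 \<epsilon>2 R1 R2 :: real
  assumes "prob_space P"
    and f_nonneg: "\<And>x. f x \<ge> 0"
    and X_density: "distributed P lborel X (\<lambda>x. ennreal (f x))"
    and indep: "prob_space.indep_vars P (\<lambda>_. borel) Xs {1..}"
    and same_law: "\<And>i. i \<ge> 1 \<Longrightarrow> distr P borel (Xs i) = distr P borel X"
    and pos: "\<epsilon>0 > 0" "\<epsilon>1 > 0" "\<epsilon>2 > 0" "R1 > 0" "R2 > 0"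
    and K_finite: "\<And>\<alpha>. \<alpha> \<in> {1, 2, 3, 4} \<Longrightarrow> K_fun f \<alpha> \<epsilon>0 < \<infinity>"
    and Q_finite: "Q_fun f \<epsilon>1 R1 < \<infinity>"
    and T_finite: "T_fun f \<epsilon>2 R2 < \<infinity>"
  shows "(\<lambda>N. \<integral>\<^sup>+ \<omega>. ennreal ((V_est N (\<lambda>i. Xs i \<omega>) - varentropy f)\<^sup>2) \<partial>P) \<longlonglongrightarrow> 0"
proof -
  interpret prob_space P by (rule assms(1))
  \<comment> \<open>The density assumption speaks of the extended real version of \<open>f\<close>;
    nonnegativity allows \<open>f\<close> itself to be recovered from it.\<close>
  have "(\<lambda>x. enn2real (ennreal (f x))) \<in> borel_measurable lborel"
    using distributed_borel_measurable[OF X_density] by measurable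
  then have f_meas: "f \<in> borel_measurable borel" using f_nonneg by simp
  have "distr P borel X = distr P lborel X" by (rule distr_cong) auto
  then have law: "distr P borel X = density lborel (\<lambda>x. ennreal (f x))"
    using distributed_distr_eq_density[OF X_density] by simp
  interpret density_sample P Xs f "CARD('d)"
    by unfold_locales (use f_nonneg f_meas indep same_law law in auto)
  show ?thesis
    by (rule V_est_consistent[OF pos(1) K_finite pos(2,4) Q_finite pos(3,5) T_finite]) simp
qed

end
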